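(* Let $d\ge 1$ be an integer, let $\lambda_0\ge\lambda>0$ be real numbers, and let $(e_1,\ldots,e_d)$ be the canonical basis of $\mathbb R^d$. Consider the catalytic branching random walk on $\mathbb Z^d$ with branching rate $\lambda_0$ at the origin and $\lambda$ elsewhere, started from one particle at the origin, and let $\widehat\Pi_t=\Pi_t/N_t$ be its normalised occupation measure. Let $\nu$ be a (deterministic) probability measure on $\mathbb Z^d$ and write $\nu_x=\nu(\{x\})$. If $\widehat\Pi_t\to\nu$ almost surely as $t\to\infty$ for the topology of weak convergence, then $\nu$ satisfies $$(1+(\lambda_0-\lambda)\nu_0)\,\nu_x=\frac1{2d}\sum_{i=1}^d(\nu_{x+e_i}+\nu_{x-e_i})\qquad\text{for all }x\in\mathbb Z^d\setminus\{0\},$$ and $$(1-(\lambda_0-\lambda)(1-\nu_0))\,\nu_0=\frac1{2d}\sum_{i=1}^d(\nu_{e_i}+\nu_{-e_i}).$$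
   Context: Catalytic branching random walk: a continuous-time system of particles on $\mathbb Z^d$. At time $0$ there is exactly one particle, located at the origin. Each particle carries two independent Poisson clocks (independent across particles): a jump-clock ringing at rate $1$, and a branch-clock ringing at rate $\lambda_0$ while the particle is at the origin and at rate $\lambda$ while it is at any other site. When the jump-clock of a particle rings, the particle moves to one of the $2d$ neighbouring sites chosen uniformly at random. When its branch-clock rings, it gives birth to one new particle at the same location (the original particle remains), and the new particle then behaves independently according to the same rules. Particles never die. $N_t$ denotes the number of particles alive at time $t$, $(X_i(t))_{1\le i\le N_t}$ their positions, and $\Pi_t=\sum_{i=1}^{N_t}\delta_{X_i(t)}$ is the occupation measure. *)

theory Defs
  imports "HOL-Probability.Probability"
begin

definition unit_steps :: "(int ^ 'd) set" where
  "unit_steps = range (\<lambda>i. axis i 1) \<union> range (\<lambda>i. - axis i 1)"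

definition exp_law :: "real measure" where
  "exp_law = density lborel (exponential_density 1)"

definition mark_law :: "(real \<times> (int ^ 'd) \<times> real) measure" where
  "mark_law = exp_law \<Otimes>\<^sub>M (measure_pmf (pmf_of_set unit_steps) \<Otimes>\<^sub>M exp_law)"

text \<open>
  Particles carry Ulam--Harris labels: \<open>[]\<close> is the initial particle and \<open>n # u\<close> is the particle
  born at the \<open>n\<close>-th ring (counted from \<open>0\<close>) of the branch-clock of \<open>u\<close>.

  For the particle \<open>u\<close>, \<open>J u k\<close> is the \<open>k\<close>-th waiting time of its jump-clock (a Poisson process of
  rate \<open>1\<close>, started at the birth of \<open>u\<close>) and \<open>S u k\<close> its \<open>k\<close>-th displacement. Its branch-clock is a
  Poisson process with the location-dependent rate \<open>branch_rate\<close>, realised as a unit-rate Poisson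
  process with waiting times \<open>B u k\<close> run at the speed \<open>branch_rate\<close>: its \<open>n\<close>-th ring occurs when the
  rate integrated along the trajectory of \<open>u\<close> reaches \<open>B u 0 + ... + B u n\<close>.

  Since \<open>mark_law\<close> is a product measure, independence of the triples makes all the variables
  \<open>J u k\<close>, \<open>S u k\<close>, \<open>B u k\<close> mutually independent.
\<close>

locale catalytic_brw = prob_space M for M :: "'w measure" +
  fixes lam0 lam :: real
    and J :: "nat list \<Rightarrow> nat \<Rightarrow> 'w \<Rightarrow> real"
    and S :: "nat list \<Rightarrow> nat \<Rightarrow> 'w \<Rightarrow> int ^ 'd"
    and B :: "nat list \<Rightarrow> nat \<Rightarrow> 'w \<Rightarrow> real"
  assumes marks_indep:
      "indep_vars (\<lambda>_. mark_law) (\<lambda>(u, k) \<omega>. (J u k \<omega>, S u k \<omega>, B u k \<omega>)) UNIV"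
    and marks_law:
      "\<And>u k. distr M mark_law (\<lambda>\<omega>. (J u k \<omega>, S u k \<omega>, B u k \<omega>)) = mark_law"
begin

definition branch_rate :: "int ^ 'd \<Rightarrow> real" where
  "branch_rate x = (if x = 0 then lam0 else lam)"

definition num_jumps :: "'w \<Rightarrow> nat list \<Rightarrow> real \<Rightarrow> nat" where
  "num_jumps \<omega> u a = card {n. (\<Sum>k\<le>n. J u k \<omega>) \<le> a}"

text \<open>In the next two definitions \<open>p\<close> is the birthplace of \<open>u\<close> and \<open>a\<close> is its age, i.e. the time
  elapsed since its birth.\<close>

definition site_at_age :: "'w \<Rightarrow> nat list \<Rightarrow> int ^ 'd \<Rightarrow> real \<Rightarrow> int ^ 'd" where
  "site_at_age \<omega> u p a = p + (\<Sum>k<num_jumps \<omega> u a. S u k \<omega>)"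

definition branch_age :: "'w \<Rightarrow> nat list \<Rightarrow> int ^ 'd \<Rightarrow> nat \<Rightarrow> real" where
  "branch_age \<omega> u p n =
     Inf {a. 0 \<le> a \<and>
       (\<Sum>k\<le>n. B u k \<omega>) \<le> integral {0..a} (\<lambda>s. branch_rate (site_at_age \<omega> u p s))}"

primrec birth :: "'w \<Rightarrow> nat list \<Rightarrow> real \<times> (int ^ 'd)" where
  "birth \<omega> [] = (0, 0)"
| "birth \<omega> (n # u) =
     (let (t, p) = birth \<omega> u; a = branch_age \<omega> u p n in (t + a, site_at_age \<omega> u p a))"

definition alive :: "real \<Rightarrow> 'w \<Rightarrow> nat list set" where
  "alive t \<omega> = {u. fst (birth \<omega> u) \<le> t}"

definition num_particles :: "real \<Rightarrow> 'w \<Rightarrow> nat" where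
  "num_particles t \<omega> = card (alive t \<omega>)"

definition position :: "real \<Rightarrow> 'w \<Rightarrow> nat list \<Rightarrow> int ^ 'd" where
  "position t \<omega> u = site_at_age \<omega> u (snd (birth \<omega> u)) (t - fst (birth \<omega> u))"

text \<open>The image of the counting measure on the living particles under their positions, i.e. the sum
  of the Dirac masses at the positions.\<close>

definition occupation :: "real \<Rightarrow> 'w \<Rightarrow> (int ^ 'd) measure" where
  "occupation t \<omega> = distr (count_space (alive t \<omega>)) (count_space UNIV) (position t \<omega>)"

definition normalised_occupation :: "real \<Rightarrow> 'w \<Rightarrow> (int ^ 'd) measure" where
  "normalised_occupation t \<omega> = scale_measure (1 / of_nat (num_particles t \<omega>)) (occupation t \<omega>)"

end

definition weakly_converges ::
    "('b \<Rightarrow> 'a::topological_space measure) \<Rightarrow> 'a measure \<Rightarrow> 'b filter \<Rightarrow> bool" where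
  "weakly_converges \<mu> \<nu> F \<longleftrightarrow>
     (\<forall>f :: 'a \<Rightarrow> real. continuous_on UNIV f \<longrightarrow> bounded (range f) \<longrightarrow>
        ((\<lambda>t. \<integral>x. f x \<partial>\<mu> t) \<longlongrightarrow> (\<integral>x. f x \<partial>\<nu>)) F)"

end

theory Submission
  imports Defs
begin

text \<open>The frequencies \<open>\<Pi>\<^sub>t(f) / N\<^sub>t\<close> converge, so \<open>\<nu>\<close> must be stationary for the
  normalised mean dynamics. Let \<open>gen f p\<close> be the mean of \<open>f (p + e) - f p\<close> over the unit steps \<open>e\<close>
  plus \<open>rate p * f p\<close>. For a bounded \<open>f\<close> and a fixed short step \<open>h\<close> the compensated increment
  \<open>\<Pi>\<^sub>t\<^sub>+\<^sub>h(f) - \<Pi>\<^sub>t(f) - \<integral>\<^sub>t \<Pi>\<^sub>s(gen f) ds\<close> (integral over an interval of length \<open>h\<close>) is, after division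
  by \<open>N\<^sub>t\<close>, small in mean square; therefore it vanishes almost surely along some sequence of times.
  Take \<open>f\<close> to be the indicator of \<open>x\<close> minus \<open>\<nu>\<^sub>x\<close>, whose integral is \<open>0\<close>, and divide by
  \<open>\<integral>\<^sub>t N\<^sub>s ds\<close>: in the limit the integral of \<open>gen f\<close> with respect to \<open>\<nu>\<close> is \<open>0\<close>, and this is the
  equation at \<open>x\<close>. The test function \<open>1\<close> controls \<open>N\<^sub>t\<^sub>+\<^sub>h\<close> by the same estimate. This deterministic
  argument is \<open>limit_stationary\<close>, the equation is computed in \<open>integral_gen_indicator\<close>.

  The mean square estimate avoids the Markov property at time \<open>t\<close>. The increment is a sum of
  compensated terms, one for each pair of a label and an index of one of its two clocks
  (\<open>jump_comp\<close> and \<open>ring_comp\<close>, with the exact identity in \<open>occ_decomposition\<close>). If a single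
  exponential waiting time is resampled while all the other marks are kept, then the population up
  to time \<open>t\<close> does not change as long as the corresponding event happens after \<open>t\<close>
  (\<open>alive_at_local_jump\<close>, \<open>alive_at_local_ring\<close>), and the term itself vanishes if the event happens
  before \<open>t\<close>. Hence every term has mean zero, even after multiplication by a function of the
  population at time \<open>t\<close> and by quantities that do not involve that waiting time
  (\<open>jump_comp_mean_zero\<close>, \<open>ring_comp_mean_zero\<close>). Of two different terms of the same kind, one never
  depends on the waiting time of the other, so distinct terms are orthogonal with the weight
  \<open>1 / N\<^sub>t\<^sup>2\<close>. The second moment is at most a constant times the weighted expected population at time
  \<open>t + h\<close>, which is at most twice the one at time \<open>t\<close> (\<open>weighted_growth\<close>) and so at most a multiple
  of the expectation of \<open>1 / N\<^sub>t\<close>. This tends to \<open>0\<close>. With the constant weight \<open>1\<close> the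
  growth estimate also shows that the population stays finite.\<close>

section \<open>Trajectories as functions of the marks\<close>

lemma Least_interval_eq:
  fixes x :: "nat \<Rightarrow> real"
  assumes "mono x" "x k \<le> r" "r < x (Suc k)"
  shows "(LEAST k. r < x (Suc k)) = k"
proof (rule Least_equality)
  fix j assume "r < x (Suc j)"
  then show "k \<le> j" using assms monoD[of x "Suc j" k] by (force simp: not_less_eq_eq)
qed (fact assms)

lemma Least_interval:
  fixes x :: "nat \<Rightarrow> real"
  assumes "filterlim x at_top sequentially" "x 0 \<le> r"
  defines "k \<equiv> LEAST k. r < x (Suc k)"
  shows "x k \<le> r" "r < x (Suc k)"
proof -
  have "\<exists>k. r < x (Suc k)"
  proof -
    from assms(1) have "eventually (\<lambda>n. r < x n) sequentially"
      by (simp add: filterlim_at_top_dense)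
    then obtain N where "\<And>n. n \<ge> N \<Longrightarrow> r < x n" by (auto simp: eventually_sequentially)
    then show ?thesis by (metis le_SucI order_refl)
  qed
  then show "r < x (Suc k)" unfolding k_def by (rule LeastI_ex)
  show "x k \<le> r"
  proof (cases k)
    case (Suc j)
    then have "\<not> r < x (Suc j)" using not_less_Least[of j "\<lambda>k. r < x (Suc k)"] k_def by simp
    then show ?thesis using Suc by simp
  qed (use assms(2) in simp)
qed

lemma mono_sum_lessThan:
  fixes f :: "nat \<Rightarrow> real"
  assumes "\<And>k. 0 \<le> f k"
  shows "mono (\<lambda>n. \<Sum>k<n. f k)"
  by (rule incseq_SucI) (simp add: assms)

text \<open>A configuration assigns to a label \<open>u\<close> and an index \<open>k\<close> the \<open>k\<close>-th waiting time of the jump-clock, the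
  \<open>k\<close>-th displacement and the \<open>k\<close>-th waiting time of the unit-rate branch-clock of \<open>u\<close>.\<close>

type_synonym 'd config = "nat list \<times> nat \<Rightarrow> real \<times> (int ^ 'd) \<times> real"

definition wait_j :: "'d::finite config \<Rightarrow> nat list \<Rightarrow> nat \<Rightarrow> real" where
  "wait_j c u k = fst (c (u, k))"
definition disp :: "'d::finite config \<Rightarrow> nat list \<Rightarrow> nat \<Rightarrow> int ^ 'd" where
  "disp c u k = fst (snd (c (u, k)))"
definition wait_b :: "'d::finite config \<Rightarrow> nat list \<Rightarrow> nat \<Rightarrow> real" where
  "wait_b c u k = snd (snd (c (u, k)))"

text \<open>Modifications of a single mark: \<open>upd_jump\<close> replaces the jump waiting time and the displacement,
  \<open>upd_ring\<close> the branch waiting time.\<close>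

abbreviation upd_jump :: "'d::finite config \<Rightarrow> nat list \<Rightarrow> nat \<Rightarrow> real \<Rightarrow> int ^ 'd \<Rightarrow> 'd config" where
  "upd_jump c u k j s \<equiv> c((u, k) := (j, s, snd (snd (c (u, k)))))"
abbreviation upd_ring :: "'d::finite config \<Rightarrow> nat list \<Rightarrow> nat \<Rightarrow> real \<Rightarrow> 'd config" where
  "upd_ring c u n b \<equiv> c((u, n) := (fst (c (u, n)), fst (snd (c (u, n))), b))"

text \<open>The life of \<open>u\<close> is cut into segments by its jumps: segment \<open>k\<close> starts at the age \<open>jump_age c u k\<close> and
  is spent at \<open>site c u p k\<close>, where \<open>p\<close> is the birthplace. The \<open>n\<close>-th ring (counted from \<open>0\<close>) of the
  branch-clock occurs at the operational time \<open>ring_op c u (Suc n)\<close>, the integral of the branching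
  rate along the trajectory.\<close>

definition jump_age :: "'d::finite config \<Rightarrow> nat list \<Rightarrow> nat \<Rightarrow> real" where
  "jump_age c u k = (\<Sum>j<k. wait_j c u j)"
definition site :: "'d::finite config \<Rightarrow> nat list \<Rightarrow> int ^ 'd \<Rightarrow> nat \<Rightarrow> int ^ 'd" where
  "site c u p k = p + (\<Sum>j<k. disp c u j)"
definition ring_op :: "'d::finite config \<Rightarrow> nat list \<Rightarrow> nat \<Rightarrow> real" where
  "ring_op c u n = (\<Sum>i<n. wait_b c u i)"

text \<open>Good configurations have positive waiting times and finitely many jumps in bounded time. Almost
  every configuration is good.\<close>

definition good :: "'d::finite config \<Rightarrow> bool" where
  "good c \<longleftrightarrow> (\<forall>u k. 0 < wait_j c u k \<and> 0 < wait_b c u k) \<and>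
     (\<forall>u. filterlim (jump_age c u) at_top sequentially)"

lemma jump_age_0 [simp]: "jump_age c u 0 = 0"
  and jump_age_Suc: "jump_age c u (Suc k) = jump_age c u k + wait_j c u k"
  and site_0 [simp]: "site c u p 0 = p"
  and site_Suc: "site c u p (Suc k) = site c u p k + disp c u k"
  and ring_op_0 [simp]: "ring_op c u 0 = 0"
  and ring_op_Suc: "ring_op c u (Suc n) = ring_op c u n + wait_b c u n"
  by (simp_all add: jump_age_def site_def ring_op_def)

lemma good_wait_j: "good c \<Longrightarrow> 0 < wait_j c u k"
  and good_wait_b: "good c \<Longrightarrow> 0 < wait_b c u k"
  and good_jump_age: "good c \<Longrightarrow> filterlim (jump_age c u) at_top sequentially"
  by (simp_all add: good_def)

lemma mono_jump_age: "good c \<Longrightarrow> mono (jump_age c u)"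
  unfolding jump_age_def by (rule mono_sum_lessThan) (simp add: good_wait_j less_imp_le)
lemma mono_ring_op: "good c \<Longrightarrow> mono (ring_op c u)"
  unfolding ring_op_def by (rule mono_sum_lessThan) (simp add: good_wait_b less_imp_le)
lemma jump_age_nonneg: "good c \<Longrightarrow> 0 \<le> jump_age c u k"
  using monoD[OF mono_jump_age, of c 0 k u] by simp
lemma ring_op_nonneg: "good c \<Longrightarrow> 0 \<le> ring_op c u k"
  using monoD[OF mono_ring_op, of c 0 k u] by simp

locale catalytic_rates =
  fixes lam0 lam :: real
  assumes lam_pos: "0 < lam" and lam_le: "lam \<le> lam0"
begin

definition rate :: "int ^ 'd::finite \<Rightarrow> real" where
  "rate x = (if x = 0 then lam0 else lam)"

lemma rate_pos [simp]: "0 < rate x" and rate_le: "rate x \<le> lam0" and rate_ge: "lam \<le> rate x"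
  using lam_pos lam_le by (auto simp: rate_def)
lemma rate_neq_0 [simp]: "rate x \<noteq> 0" using rate_pos[of x] by linarith
lemma rate_nonneg [simp]: "0 \<le> rate x" using rate_pos[of x] by linarith
lemma lam0_pos: "0 < lam0" using lam_pos lam_le by simp

text \<open>\<open>op_time c u p k\<close> is the operational time at the start of segment \<open>k\<close>. At the operational time \<open>r\<close>
  the particle is in segment \<open>segment c u p r\<close>, has the age \<open>age c u p r\<close> and sits at
  \<open>op_site c u p r\<close>.\<close>

definition op_time :: "'d::finite config \<Rightarrow> nat list \<Rightarrow> int ^ 'd \<Rightarrow> nat \<Rightarrow> real" where
  "op_time c u p k = (\<Sum>j<k. rate (site c u p j) * wait_j c u j)"

lemma op_time_0 [simp]: "op_time c u p 0 = 0"
  and op_time_Suc: "op_time c u p (Suc k) = op_time c u p k + rate (site c u p k) * wait_j c u k"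
  by (simp_all add: op_time_def)

definition segment :: "'d::finite config \<Rightarrow> nat list \<Rightarrow> int ^ 'd \<Rightarrow> real \<Rightarrow> nat" where
  "segment c u p r = (LEAST k. r < op_time c u p (Suc k))"
definition age :: "'d::finite config \<Rightarrow> nat list \<Rightarrow> int ^ 'd \<Rightarrow> real \<Rightarrow> real" where
  "age c u p r = jump_age c u (segment c u p r) +
     (r - op_time c u p (segment c u p r)) / rate (site c u p (segment c u p r))"
definition op_site :: "'d::finite config \<Rightarrow> nat list \<Rightarrow> int ^ 'd \<Rightarrow> real \<Rightarrow> int ^ 'd" where
  "op_site c u p r = site c u p (segment c u p r)"

lemma mono_op_time: "good c \<Longrightarrow> mono (op_time c u p)"
  unfolding op_time_def by (rule mono_sum_lessThan) (simp add: good_wait_j less_imp_le)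

lemma op_time_at_top:
  assumes "good c" shows "filterlim (op_time c u p) at_top sequentially"
proof (rule filterlim_at_top_mono)
  show "filterlim (\<lambda>k. lam * jump_age c u k) at_top sequentially"
    by (rule filterlim_tendsto_pos_mult_at_top[OF tendsto_const lam_pos good_jump_age[OF assms]])
  show "eventually (\<lambda>k. lam * jump_age c u k \<le> op_time c u p k) sequentially"
    unfolding op_time_def jump_age_def sum_distrib_left
    by (intro always_eventually allI sum_mono mult_right_mono rate_ge less_imp_le good_wait_j assms)
qed

lemma segment_bounds:
  assumes "good c" "0 \<le> r"
  shows "op_time c u p (segment c u p r) \<le> r" "r < op_time c u p (Suc (segment c u p r))"
  unfolding segment_def using Least_interval[OF op_time_at_top[OF assms(1)], of u p r] assms(2)
  by simp_all

lemma segment_eq: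
  assumes "good c" "op_time c u p k \<le> r" "r < op_time c u p (Suc k)"
  shows "segment c u p r = k"
  unfolding segment_def by (rule Least_interval_eq[OF mono_op_time assms(2,3)]) (fact assms)

lemma age_eq:
  assumes "good c" "op_time c u p k \<le> r" "r < op_time c u p (Suc k)"
  shows "age c u p r = jump_age c u k + (r - op_time c u p k) / rate (site c u p k)"
  by (simp add: age_def segment_eq[OF assms])

lemma age_bounds:
  assumes "good c" "0 \<le> r"
  shows "jump_age c u (segment c u p r) \<le> age c u p r"
    "age c u p r < jump_age c u (Suc (segment c u p r))"
  using segment_bounds[OF assms, of u p]
  by (auto simp: age_def op_time_Suc jump_age_Suc field_simps)

lemma age_nonneg: "good c \<Longrightarrow> 0 \<le> r \<Longrightarrow> 0 \<le> age c u p r"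
  using age_bounds(1)[of c r u p] jump_age_nonneg[of c u] order_trans by blast

text \<open>The branching rate is at most \<open>lam0\<close>, so the age grows at least at the speed \<open>1 / lam0\<close> in the
  operational time; in other words, \<open>lam0 * age r - r\<close> is nondecreasing in the operational time \<open>r\<close>.\<close>

lemma age_slope:
  assumes g: "good c" and r: "0 \<le> r" "r \<le> r'"
  shows "age c u p r + (r' - r) / lam0 \<le> age c u p r'"
proof -
  \<comment> \<open>the value of \<open>lam0 * age r - r\<close> at the start of segment \<open>k\<close>\<close>
  define z where "z k = lam0 * jump_age c u k - op_time c u p k" for k
  have z_Suc: "z (Suc k) = z k + (lam0 - rate (site c u p k)) * wait_j c u k" for k
    by (simp add: z_def jump_age_Suc op_time_Suc algebra_simps)
  have "mono z" by (rule incseq_SucI) (simp add: z_Suc rate_le good_wait_j[OF g] less_imp_le)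
  have *: "lam0 * age c u p r - r = z k + (r - op_time c u p k) * (lam0 / rate (site c u p k) - 1)"
    if "op_time c u p k \<le> r" "r < op_time c u p (Suc k)" for k r
    by (subst age_eq[OF g that]) (simp add: z_def field_simps)
  have lr: "0 \<le> lam0 / rate (site c u p k) - 1" for k using rate_le by (simp add: field_simps)
  define k k' where "k = segment c u p r" and "k' = segment c u p r'"
  have r': "0 \<le> r'" using r by simp
  note k = segment_bounds[OF g r(1), of u p, folded k_def]
  note k' = segment_bounds[OF g r', of u p, folded k'_def]
  have "k \<le> k'"
  proof (rule ccontr)
    assume "\<not> k \<le> k'"
    then have "op_time c u p (Suc k') \<le> op_time c u p k" using monoD[OF mono_op_time[OF g]] by simp
    then show False using k k' r by simp
  qed
  have "lam0 * age c u p r - r \<le> lam0 * age c u p r' - r'"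
  proof (cases "k = k'")
    case True
    show ?thesis unfolding *[OF k] *[OF k'] using True r lr[of k'] by (simp add: mult_right_mono)
  next
    case False
    have "lam0 * age c u p r - r \<le>
        z k + (op_time c u p (Suc k) - op_time c u p k) * (lam0 / rate (site c u p k) - 1)"
      unfolding *[OF k] by (intro add_left_mono mult_right_mono lr) (use k in simp)
    also have "\<dots> = z (Suc k)" by (simp add: z_Suc op_time_Suc field_simps)
    also have "\<dots> \<le> z k'" using False \<open>k \<le> k'\<close> by (intro monoD[OF \<open>mono z\<close>]) simp
    also have "\<dots> \<le> lam0 * age c u p r' - r'" unfolding *[OF k'] using lr k' by simp
    finally show ?thesis .
  qed
  then show ?thesis using lam0_pos by (simp add: field_simps)
qed

lemma age_mono: "good c \<Longrightarrow> 0 \<le> r \<Longrightarrow> r \<le> r' \<Longrightarrow> age c u p r \<le> age c u p r'"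
  using age_slope[of c r r' u p] lam0_pos divide_nonneg_pos[of "r' - r" lam0] by linarith

text \<open>Time and place of birth.\<close>

primrec born :: "'d::finite config \<Rightarrow> nat list \<Rightarrow> real \<times> (int ^ 'd)" where
  "born c [] = (0, 0)"
| "born c (n # u) = (fst (born c u) + age c u (snd (born c u)) (ring_op c u (Suc n)),
                     op_site c u (snd (born c u)) (ring_op c u (Suc n)))"

lemma born_le: "good c \<Longrightarrow> fst (born c u) \<le> fst (born c (n # u))"
  by (simp add: age_nonneg ring_op_nonneg)
lemma born_nonneg: "good c \<Longrightarrow> 0 \<le> fst (born c u)"
  by (induction u) (auto simp: age_nonneg ring_op_nonneg add_nonneg_nonneg)

lemma born_mono_ring: "good c \<Longrightarrow> n \<le> m \<Longrightarrow> fst (born c (n # u)) \<le> fst (born c (m # u))"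
  using monoD[OF mono_ring_op, of c "Suc n" "Suc m" u] by (auto intro!: age_mono ring_op_nonneg)

lemma marks_cong:
  assumes "\<And>k. c (u, k) = c' (u, k)"
  shows "jump_age c u = jump_age c' u" "site c u = site c' u" "ring_op c u = ring_op c' u"
    "op_time c u = op_time c' u" "segment c u = segment c' u" "age c u = age c' u" "op_site c u = op_site c' u"
proof -
  show *: "jump_age c u = jump_age c' u" "site c u = site c' u" "ring_op c u = ring_op c' u"
    by (simp_all add: fun_eq_iff jump_age_def site_def ring_op_def wait_j_def wait_b_def disp_def assms)
  show 2: "op_time c u = op_time c' u"
    by (simp add: fun_eq_iff op_time_def * wait_j_def assms)
  show 3: "segment c u = segment c' u" by (simp add: fun_eq_iff segment_def 2)
  show "age c u = age c' u" "op_site c u = op_site c' u"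
    by (simp_all add: fun_eq_iff age_def op_site_def 2 3 *)
qed

lemma marks_upd:
  assumes "fst i \<noteq> v"
  shows "jump_age (c(i := x)) v = jump_age c v" "site (c(i := x)) v = site c v"
    "ring_op (c(i := x)) v = ring_op c v" "op_time (c(i := x)) v = op_time c v"
    "segment (c(i := x)) v = segment c v" "age (c(i := x)) v = age c v" "op_site (c(i := x)) v = op_site c v"
proof -
  have "(c(i := x)) (v, k) = c (v, k)" for k using assms by auto
  from marks_cong[of "c(i := x)" v c, OF this]
  show "jump_age (c(i := x)) v = jump_age c v" "site (c(i := x)) v = site c v"
    "ring_op (c(i := x)) v = ring_op c v" "op_time (c(i := x)) v = op_time c v"
    "segment (c(i := x)) v = segment c v" "age (c(i := x)) v = age c v" "op_site (c(i := x)) v = op_site c v"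
    by blast+
qed

text \<open>A birth is determined by the marks of the strict ancestors, whose labels are shorter.\<close>

lemma born_upd:
  assumes "length v \<le> length (fst i)"
  shows "born (c(i := x)) v = born c v"
  using assms
proof (induction v)
  case (Cons n w)
  then have "fst i \<noteq> w" by auto
  with Cons show ?case by (simp add: marks_upd del: fun_upd_apply)
qed simp

text \<open>Resampling only the branch waiting time changes no trajectory.\<close>

lemma marks_upd_b:
  shows "jump_age (upd_ring c u n b) v = jump_age c v" (is "jump_age ?c v = _")
    "site (upd_ring c u n b) v = site c v"
    "op_time (upd_ring c u n b) v = op_time c v"
    "segment (upd_ring c u n b) v = segment c v"
    "age (upd_ring c u n b) v = age c v"
    "op_site (upd_ring c u n b) v = op_site c v"
proof -
  show *: "jump_age ?c v = jump_age c v" "site ?c v = site c v"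
    by (auto simp: fun_eq_iff jump_age_def site_def wait_j_def disp_def intro!: sum.cong)
  show 2: "op_time ?c v = op_time c v"
    by (auto simp: fun_eq_iff op_time_def * wait_j_def intro!: sum.cong)
  show 3: "segment ?c v = segment c v" by (simp add: fun_eq_iff segment_def 2)
  show "age ?c v = age c v" "op_site ?c v = op_site c v"
    by (simp_all add: fun_eq_iff age_def op_site_def 2 3 *)
qed

text \<open>Marks with index at least \<open>k\<close> do not influence the first \<open>k\<close> jumps and rings.\<close>

lemma marks_upd_later:
  assumes "k \<le> n"
  shows "jump_age (c((u, n) := x)) v k = jump_age c v k" "site (c((u, n) := x)) v p k = site c v p k"
    "ring_op (c((u, n) := x)) v k = ring_op c v k" "op_time (c((u, n) := x)) v p k = op_time c v p k"
proof -
  have *: "(c((u, n) := x)) (v, j) = c (v, j)" if "j < k" for j using that assms by auto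
  show "jump_age (c((u, n) := x)) v k = jump_age c v k" "ring_op (c((u, n) := x)) v k = ring_op c v k"
    "site (c((u, n) := x)) v p k = site c v p k"
    using assms by (auto simp: jump_age_def ring_op_def site_def wait_j_def wait_b_def disp_def intro!: sum.cong)
  have "site (c((u, n) := x)) v p j = site c v p j" if "j < k" for j
    using assms that by (auto simp: site_def disp_def intro!: sum.cong)
  then show "op_time (c((u, n) := x)) v p k = op_time c v p k"
    using * by (auto simp: op_time_def wait_j_def intro!: sum.cong)
qed

lemma good_upd:
  assumes "good c" "0 < j" "0 < b"
  shows "good (c(i := (j, s, b)))"
proof -
  obtain u k where i: "i = (u, k)" by (cases i)
  let ?c = "c(i := (j, s, b))"
  have "filterlim (jump_age ?c v) at_top sequentially" for v
  proof (cases "v = u")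
    case True
    have "jump_age ?c u m = (if m \<le> k then 0 else j - wait_j c u k) + jump_age c u m" for m
      proof (induction m)
      case (Suc m)
      then show ?case by (cases "m = k") (auto simp: jump_age_Suc wait_j_def i)
    qed simp
    then have le: "- \<bar>j - wait_j c u k\<bar> + jump_age c u m \<le> jump_age ?c u m" for m
      by (smt (verit, best))
    have lim: "filterlim (\<lambda>m. - \<bar>j - wait_j c u k\<bar> + jump_age c u m) at_top sequentially"
      by (rule filterlim_tendsto_add_at_top[OF tendsto_const good_jump_age[OF assms(1)]])
    have "filterlim (jump_age ?c u) at_top sequentially"
      by (rule filterlim_at_top_mono[OF lim always_eventually]) (use le in blast)
    with True show ?thesis by simp
  next
    case False
    then show ?thesis using marks_upd(1)[of i v c] good_jump_age[OF assms(1), of v] i by simp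
  qed
  moreover have "0 < wait_j ?c v m \<and> 0 < wait_b ?c v m" for v m
    using assms good_wait_j[OF assms(1), of v m] good_wait_b[OF assms(1), of v m]
    by (auto simp: wait_j_def wait_b_def)
  ultimately show ?thesis by (auto simp: good_def)
qed

text \<open>\<open>jump_time c u k\<close> is the time at which \<open>u\<close> starts its segment \<open>k\<close>; so \<open>jump_time c u 0\<close> is its
  time of birth.\<close>

definition jump_time :: "'d::finite config \<Rightarrow> nat list \<Rightarrow> nat \<Rightarrow> real" where
  "jump_time c u k = fst (born c u) + jump_age c u k"

definition alive_at :: "'d::finite config \<Rightarrow> real \<Rightarrow> nat list set" where
  "alive_at c t = {u. fst (born c u) \<le> t}"

text \<open>Locality: a mark whose event takes place after time \<open>t\<close>, before and after the modification,
  does not influence the births up to time \<open>t\<close>.\<close>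

lemma born_local_jump:
  fixes c :: "'d::finite config" and j :: real and u :: "nat list" and k :: nat and s :: "int ^ 'd"
  defines "c' \<equiv> upd_jump c u k j s"
  assumes g: "good c" "good c'" and t: "t < jump_time c u (Suc k)" "t < jump_time c' u (Suc k)"
  shows "fst (born c v) \<le> t \<Longrightarrow> born c' v = born c v"
proof (induction v)
  case (Cons n w)
  have "fst (born c w) \<le> t" using Cons.prems born_le[OF g(1), of w n] by linarith
  note IH = Cons.IH[OF this]
  show ?case
  proof (cases "w = u")
    case False
    then have "fst (u, k) \<noteq> w" by auto
    from marks_upd[OF this, of c, folded c'_def] show ?thesis using IH by (simp add: c'_def del: fun_upd_apply)
  next
    case True
    define b p r where "b = fst (born c u)" and "p = snd (born c u)" and "r = ring_op c u (Suc n)"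
    define \<kappa> where "\<kappa> = segment c u p r"
    have b': "fst (born c' u) = b" "snd (born c' u) = p" using IH True by (simp_all add: b_def p_def)
    have r': "ring_op c' u (Suc n) = r"
      by (auto simp: r_def ring_op_def wait_b_def c'_def intro!: sum.cong)
    have r0: "0 \<le> r" by (simp add: r_def ring_op_nonneg g)
    note seg = segment_bounds[OF g(1) r0, of u p, folded \<kappa>_def]
    have le_t: "b + age c u p r \<le> t" using Cons.prems True by (simp add: b_def p_def r_def)
    have "jump_age c u \<kappa> \<le> age c u p r" unfolding \<kappa>_def by (rule age_bounds[OF g(1) r0])
    then have "jump_age c u \<kappa> < jump_age c u (Suc k)" using le_t t(1) by (simp add: jump_time_def b_def)
    then have "\<kappa> \<le> k" using monoD[OF mono_jump_age[OF g(1)], of "Suc k" \<kappa> u] by (force simp: not_less_eq_eq)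
    note eq = marks_upd_later[OF \<open>\<kappa> \<le> k\<close>, of c u "(j, s, snd (snd (c (u, k))))" u, folded c'_def]
    have ge: "r < op_time c' u p (Suc \<kappa>)"
    proof (cases "\<kappa> = k")
      case False
      with \<open>\<kappa> \<le> k\<close> have "Suc \<kappa> \<le> k" by simp
      from marks_upd_later(4)[OF this, of c u "(j, s, snd (snd (c (u, k))))" u, folded c'_def] seg
      show ?thesis by simp
    next
      case True
      \<comment> \<open>the ring happens by time \<open>t\<close>, hence before the modified jump\<close>
      have "b + (jump_age c u k + (r - op_time c u p k) / rate (site c u p k)) \<le> t"
        using le_t age_eq[OF g(1) seg] True by simp
      also have "t < b + (jump_age c u k + j)"
        using t(2) eq(1) True b' by (simp add: jump_time_def jump_age_Suc wait_j_def) (simp add: c'_def)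
      finally have "r < op_time c u p k + rate (site c u p k) * j" by (simp add: field_simps)
      then show ?thesis unfolding op_time_Suc using eq(2,4)[of p] True by (simp add: wait_j_def) (simp add: c'_def)
    qed
    have "op_time c' u p \<kappa> \<le> r" using seg eq by simp
    with ge have seg': "segment c' u p r = \<kappa>" by (intro segment_eq g)
    have "age c' u p r = age c u p r" "op_site c' u p r = op_site c u p r"
      by (simp_all add: age_def op_site_def seg' \<kappa>_def[symmetric] eq)
    then show ?thesis by (simp add: True b' r' b_def[symmetric] p_def[symmetric] r_def[symmetric])
  qed
qed simp

lemma born_local_ring:
  fixes c :: "'d::finite config" and b :: real and u :: "nat list" and m :: nat
  defines "c' \<equiv> upd_ring c u m b"
  assumes g: "good c" "good c'" and t: "t < fst (born c (m # u))" "t < fst (born c' (m # u))"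
  shows "fst (born c v) \<le> t \<Longrightarrow> born c' v = born c v"
proof (induction v)
  case (Cons n w)
  have "fst (born c w) \<le> t" using Cons.prems born_le[OF g(1), of w n] by linarith
  note IH = Cons.IH[OF this]
  note eq = marks_upd_b[of c u m b, folded c'_def]
  have "ring_op c' w (Suc n) = ring_op c w (Suc n)"
  proof (cases "w = u")
    case True
    have "\<not> m \<le> n" using born_mono_ring[OF g(1), of m n u] Cons.prems t(1) True by auto
    then show ?thesis unfolding c'_def by (intro marks_upd_later) simp
  next
    case False
    then show ?thesis unfolding c'_def by (intro fun_cong[OF marks_upd(3)]) auto
  qed
  then show ?case using IH eq by simp
qed simp

lemma alive_at_local_jump:
  fixes c :: "'d::finite config" and j :: real and u :: "nat list" and k :: nat and s :: "int ^ 'd"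
  defines "c' \<equiv> upd_jump c u k j s"
  assumes g: "good c" "good c'" and t: "t < jump_time c u (Suc k)" "t < jump_time c' u (Suc k)"
  shows "alive_at c' t = alive_at c t"
proof -
  have c: "c = c'((u, k) := (fst (c (u, k)), fst (snd (c (u, k))), snd (snd (c' (u, k)))))"
    by (auto simp: c'_def)
  have "fst (born c v) \<le> t \<Longrightarrow> born c' v = born c v" for v
    using born_local_jump[of c u k j s t v, folded c'_def] g t by blast
  moreover have "fst (born c' v) \<le> t \<Longrightarrow> born c v = born c' v" for v
    using born_local_jump[of c' u k "fst (c (u, k))" "fst (snd (c (u, k)))" t v, folded c] g t by blast
  ultimately have "fst (born c' v) \<le> t \<longleftrightarrow> fst (born c v) \<le> t" for v by metis
  then show ?thesis by (simp add: alive_at_def)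
qed

lemma alive_at_local_ring:
  fixes c :: "'d::finite config" and b :: real and u :: "nat list" and m :: nat
  defines "c' \<equiv> upd_ring c u m b"
  assumes g: "good c" "good c'" and t: "t < fst (born c (m # u))" "t < fst (born c' (m # u))"
  shows "alive_at c' t = alive_at c t"
proof -
  have c: "c = c'((u, m) := (fst (c' (u, m)), fst (snd (c' (u, m))), snd (snd (c (u, m)))))"
    by (auto simp: c'_def)
  have "fst (born c v) \<le> t \<Longrightarrow> born c' v = born c v" for v
    using born_local_ring[of c u m b t v, folded c'_def] g t by blast
  moreover have "fst (born c' v) \<le> t \<Longrightarrow> born c v = born c' v" for v
    using born_local_ring[of c' u m "snd (snd (c (u, m)))" t v, folded c] g t by blast
  ultimately have "fst (born c' v) \<le> t \<longleftrightarrow> fst (born c v) \<le> t" for v by metis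
  then show ?thesis by (simp add: alive_at_def)
qed

end

section \<open>The law of the marks\<close>

lemma measurable_count_space_compose2:
  fixes X :: "'a \<Rightarrow> 'b::countable" and Y :: "'a \<Rightarrow> 'c::countable"
  assumes [measurable]: "X \<in> measurable M (count_space UNIV)" "Y \<in> measurable M (count_space UNIV)"
  shows "(\<lambda>x. f (X x) (Y x)) \<in> measurable M (count_space UNIV)"
proof (rule measurable_compose_countable[OF _ assms(1)])
  fix i show "(\<lambda>x. f i (Y x)) \<in> measurable M (count_space UNIV)"
    by (rule measurable_compose[OF assms(2)]) simp
qed

lemma sets_exp_law [measurable_cong]: "sets exp_law = sets borel"
  by (simp add: exp_law_def)
lemma space_exp_law [simp]: "space exp_law = UNIV"
  by (simp add: exp_law_def)
lemma prob_space_exp_law: "prob_space exp_law"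
  unfolding exp_law_def by (rule prob_space_exponential_density) simp
lemma prob_space_mark_law: "prob_space (mark_law :: (real \<times> (int ^ 'd::finite) \<times> real) measure)"
  unfolding mark_law_def by (intro prob_space_pair prob_space_exp_law measure_pmf.prob_space_axioms)
lemma space_mark_law [simp]: "space mark_law = UNIV"
  by (simp add: mark_law_def space_pair_measure)

lemma measurable_mark [measurable]:
  "(fst :: real \<times> (int ^ 'd::finite) \<times> real \<Rightarrow> _) \<in> measurable mark_law borel"
  "(\<lambda>x :: real \<times> (int ^ 'd) \<times> real. fst (snd x)) \<in> measurable mark_law (count_space UNIV)"
  "(\<lambda>x :: real \<times> (int ^ 'd) \<times> real. snd (snd x)) \<in> measurable mark_law borel"
  unfolding mark_law_def by measurable

lemma finite_unit_steps [simp]: "finite (unit_steps :: (int ^ 'd::finite) set)"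
  and unit_steps_nonempty [simp]: "(unit_steps :: (int ^ 'd) set) \<noteq> {}"
  by (simp_all add: unit_steps_def)

lemma AE_exp_law_pos: "AE x in exp_law. 0 < x"
  unfolding exp_law_def by (subst AE_density) (use AE_lborel_singleton[of 0] in \<open>auto simp: exponential_density_def\<close>)

lemma measure_exp_law_greater: "0 \<le> a \<Longrightarrow> measure exp_law {a<..} = exp (- a)"
proof -
  assume "0 \<le> a"
  interpret prob_space exp_law by (rule prob_space_exp_law)
  have D: "distributed exp_law lborel (\<lambda>x. x) (exponential_density 1)"
    unfolding distributed_def by (auto simp: exp_law_def distr_id2 cong: distr_cong)
  show ?thesis using exponential_distributedD_gt[OF D \<open>0 \<le> a\<close>] by (simp add: greaterThan_def)
qed

lemma integral_mark_law:
  fixes G :: "real \<times> (int ^ 'd::finite) \<times> real \<Rightarrow> real"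
  assumes [measurable]: "G \<in> borel_measurable mark_law" and "\<And>x. \<bar>G x\<bar> \<le> K"
  shows integral_mark_law_b: "(\<integral>x. G x \<partial>mark_law) =
      (\<integral>j. \<integral>s. \<integral>b. G (j, s, b) \<partial>exp_law \<partial>measure_pmf (pmf_of_set unit_steps) \<partial>exp_law)"
    and integral_mark_law_j: "(\<integral>x. G x \<partial>mark_law) =
      (\<integral>b. \<integral>s. \<integral>j. G (j, s, b) \<partial>exp_law \<partial>measure_pmf (pmf_of_set unit_steps) \<partial>exp_law)"
proof -
  let ?S = "measure_pmf (pmf_of_set unit_steps) :: (int ^ 'd) measure"
  interpret E: prob_space exp_law by (rule prob_space_exp_law)
  interpret SE: pair_prob_space ?S exp_law ..
  interpret ESE: pair_prob_space exp_law "?S \<Otimes>\<^sub>M exp_law" ..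
  have Gm [measurable]: "G \<in> borel_measurable (exp_law \<Otimes>\<^sub>M (?S \<Otimes>\<^sub>M exp_law))"
    using assms(1) unfolding mark_law_def by simp
  have int: "integrable (exp_law \<Otimes>\<^sub>M (?S \<Otimes>\<^sub>M exp_law)) G"
    by (rule ESE.P.integrable_const_bound[where B = K]) (use assms(2) in auto)
  have int2: "integrable (?S \<Otimes>\<^sub>M exp_law) (\<lambda>y. G (j, y))" for j
    by (rule SE.P.integrable_const_bound[where B = K]) (use assms(2) in auto)
  have "(\<integral>x. G x \<partial>mark_law) = (\<integral>j. (\<integral>y. G (j, y) \<partial>(?S \<Otimes>\<^sub>M exp_law)) \<partial>exp_law)"
    unfolding mark_law_def by (rule ESE.integral_fst'[OF int, symmetric])
  also have "\<dots> = (\<integral>j. \<integral>s. \<integral>b. G (j, s, b) \<partial>exp_law \<partial>?S \<partial>exp_law)"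
    by (intro Bochner_Integration.integral_cong refl SE.integral_fst'[OF int2, symmetric])
  finally show "(\<integral>x. G x \<partial>mark_law) = (\<integral>j. \<integral>s. \<integral>b. G (j, s, b) \<partial>exp_law \<partial>?S \<partial>exp_law)" .
  let ?H = "\<lambda>y. \<integral>j. G (j, y) \<partial>exp_law"
  have "\<bar>?H y\<bar> \<le> K" for y
  proof -
    have "integrable exp_law (\<lambda>j. G (j, y))"
      by (rule E.integrable_const_bound[where B = K])
        (use assms(2) in \<open>auto intro!: measurable_compose[OF measurable_Pair2' Gm] simp: space_pair_measure\<close>)
    then show ?thesis
      using E.integral_le_const[of "\<lambda>j. G (j, y)" K] E.integral_ge_const[of "\<lambda>j. G (j, y)" "-K"] assms(2)
      by (auto simp: abs_le_iff minus_le_iff)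
  qed
  then have int3: "integrable (?S \<Otimes>\<^sub>M exp_law) ?H"
    by (intro SE.P.integrable_const_bound[where B = K]) auto
  have "(\<integral>x. G x \<partial>mark_law) = (\<integral>y. ?H y \<partial>(?S \<Otimes>\<^sub>M exp_law))"
    unfolding mark_law_def using ESE.integral_snd[of "\<lambda>x y. G (x, y)"] int by simp
  also have "\<dots> = (\<integral>b. \<integral>s. ?H (s, b) \<partial>?S \<partial>exp_law)"
    using SE.integral_snd[of "\<lambda>s b. ?H (s, b)"] int3 by (simp add: split_beta')
  finally show "(\<integral>x. G x \<partial>mark_law) = (\<integral>b. \<integral>s. \<integral>j. G (j, s, b) \<partial>exp_law \<partial>?S \<partial>exp_law)" .
qed

text \<open>The marks of all the labels are independent with law \<open>mark_law\<close>.\<close>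

definition conf_law :: "'d::finite config measure" where
  "conf_law = PiM UNIV (\<lambda>_. mark_law)"

lemma prob_space_conf_law: "prob_space (conf_law :: 'd::finite config measure)"
  unfolding conf_law_def by (intro prob_space_PiM prob_space_mark_law)
lemma space_conf_law [simp]: "space conf_law = UNIV"
  by (simp add: conf_law_def space_PiM)

lemma measurable_conf_component [measurable]: "(\<lambda>c. c i) \<in> measurable conf_law mark_law"
  unfolding conf_law_def by (rule measurable_component_singleton) simp

lemma measurable_conf_upd [measurable]:
  "(\<lambda>(x, c). c(i := x)) \<in> measurable (mark_law \<Otimes>\<^sub>M conf_law) conf_law"
proof -
  have "(\<lambda>(c, x). c(i := x)) \<in> measurable (conf_law \<Otimes>\<^sub>M mark_law) conf_law"
    using measurable_add_dim[of i UNIV "\<lambda>_. mark_law"] unfolding conf_law_def by simp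
  from measurable_compose[OF measurable_pair_swap' this] show ?thesis by (simp add: split_beta')
qed

lemma measurable_conf_upd1 [measurable]: "(\<lambda>x. c(i := x)) \<in> measurable mark_law conf_law"
  using measurable_compose[OF measurable_Pair2'[of c conf_law mark_law] measurable_conf_upd[of i]]
  by (simp add: measurable_Pair1')

lemma conf_law_resample:
  "distr (mark_law \<Otimes>\<^sub>M conf_law) conf_law (\<lambda>(x, c). c(i := x)) = conf_law"
  using distr_pair_PiM_eq_PiM[of UNIV "\<lambda>_. mark_law" i] prob_space_mark_law unfolding conf_law_def by simp

text \<open>An expectation does not change when one mark is resampled.\<close>

lemma integral_resample:
  fixes F :: "'d::finite config \<Rightarrow> real"
  assumes [measurable]: "F \<in> borel_measurable conf_law" and "\<And>c. \<bar>F c\<bar> \<le> K"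
  shows "(\<integral>c. F c \<partial>conf_law) = (\<integral>c. \<integral>x. F (c(i := x)) \<partial>mark_law \<partial>conf_law)"
proof -
  interpret M: prob_space "mark_law :: (real \<times> (int ^ 'd) \<times> real) measure" by (rule prob_space_mark_law)
  interpret C: prob_space "conf_law :: 'd config measure" by (rule prob_space_conf_law)
  interpret MC: pair_prob_space "mark_law :: (real \<times> (int ^ 'd) \<times> real) measure" "conf_law :: 'd config measure" ..
  have "integrable (mark_law \<Otimes>\<^sub>M conf_law) (\<lambda>(x, c). F (c(i := x)))"
    by (rule MC.P.integrable_const_bound[where B = K]) (use assms(2) in \<open>auto simp: split_beta'\<close>)
  from MC.integral_snd[OF this] have "(\<integral>c. \<integral>x. F (c(i := x)) \<partial>mark_law \<partial>conf_law) =
      (\<integral>z. (case z of (x, c) \<Rightarrow> F (c(i := x))) \<partial>(mark_law \<Otimes>\<^sub>M conf_law))" .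
  also have "\<dots> = (\<integral>z. F (case z of (x, c) \<Rightarrow> c(i := x)) \<partial>(mark_law \<Otimes>\<^sub>M conf_law))"
    by (simp add: split_beta')
  also have "\<dots> = (\<integral>c. F c \<partial>distr (mark_law \<Otimes>\<^sub>M conf_law) conf_law (\<lambda>(x, c). c(i := x)))"
    by (rule integral_distr[symmetric]) measurable
  also have "\<dots> = (\<integral>c. F c \<partial>conf_law)" by (simp only: conf_law_resample)
  finally show ?thesis ..
qed

lemma integral_resample_zero:
  fixes F :: "'d::finite config \<Rightarrow> real"
  assumes "F \<in> borel_measurable conf_law" "\<And>c. \<bar>F c\<bar> \<le> K"
    and "AE c in conf_law. (\<integral>x. F (c(i := x)) \<partial>mark_law) = 0"
  shows "(\<integral>c. F c \<partial>conf_law) = 0"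
  by (subst integral_resample[OF assms(1,2)]) (rule integral_eq_zero_AE[OF assms(3)])

lemma AE_conf_pos: "AE c :: 'd::finite config in conf_law. \<forall>u k. 0 < wait_j c u k \<and> 0 < wait_b c u k"
proof -
  let ?S = "measure_pmf (pmf_of_set unit_steps) :: (int ^ 'd) measure"
  interpret E: prob_space exp_law by (rule prob_space_exp_law)
  interpret SE: pair_prob_space ?S exp_law ..
  interpret ESE: pair_prob_space exp_law "?S \<Otimes>\<^sub>M exp_law" ..
  have m: "AE x in mark_law. 0 < fst x \<and> 0 < snd (snd (x :: real \<times> (int ^ 'd) \<times> real))"
    unfolding mark_law_def
  proof (rule ESE.AE_pair_measure)
    have y: "AE y in ?S \<Otimes>\<^sub>M exp_law. 0 < snd y"
      by (rule SE.AE_pair_measure) (use AE_exp_law_pos in auto)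
    show "AE j in exp_law. AE y in ?S \<Otimes>\<^sub>M exp_law. 0 < fst (j, y) \<and> 0 < snd (snd (j, y))"
      using AE_exp_law_pos by eventually_elim (use y in auto)
  qed measurable
  have "AE c in conf_law. 0 < fst (c i) \<and> 0 < snd (snd ((c :: 'd config) i))" for i
    unfolding conf_law_def by (rule AE_PiM_component[OF prob_space_mark_law _ m]) auto
  then have "AE c in conf_law. \<forall>i. 0 < fst (c i) \<and> 0 < snd (snd ((c :: 'd config) i))"
    by (simp add: AE_all_countable)
  then show ?thesis by eventually_elim (simp add: wait_j_def wait_b_def)
qed

lemma measurable_marks [measurable (raw)]:
  fixes f :: "'a \<Rightarrow> 'd::finite config"
  assumes f: "f \<in> measurable M conf_law"
  shows "(\<lambda>x. wait_j (f x) u k) \<in> borel_measurable M"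
    and "(\<lambda>x. wait_b (f x) u k) \<in> borel_measurable M"
    and "(\<lambda>x. disp (f x) u k) \<in> measurable M (count_space UNIV)"
proof -
  have "(\<lambda>x. f x (u, k)) \<in> measurable M mark_law"
    by (rule measurable_compose[OF f measurable_conf_component])
  note * = measurable_compose[OF this]
  show "(\<lambda>x. wait_j (f x) u k) \<in> borel_measurable M" "(\<lambda>x. wait_b (f x) u k) \<in> borel_measurable M"
    "(\<lambda>x. disp (f x) u k) \<in> measurable M (count_space UNIV)"
    unfolding wait_j_def wait_b_def disp_def by (rule *, rule measurable_mark)+
qed

lemma measurable_jump_age [measurable (raw)]:
  assumes [measurable]: "f \<in> measurable M conf_law"
  shows "(\<lambda>x. jump_age (f x) u k) \<in> borel_measurable M"
  unfolding jump_age_def by measurable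

lemma measurable_ring_op [measurable (raw)]:
  assumes [measurable]: "f \<in> measurable M conf_law"
  shows "(\<lambda>x. ring_op (f x) u k) \<in> borel_measurable M"
  unfolding ring_op_def by measurable

lemma measurable_site [measurable (raw)]:
  assumes [measurable]: "f \<in> measurable M conf_law" "p \<in> measurable M (count_space UNIV)"
  shows "(\<lambda>x. site (f x) u (p x) k) \<in> measurable M (count_space UNIV)"
proof (induction k)
  case (Suc k)
  show ?case unfolding site_Suc
    by (rule measurable_count_space_compose2[where f = "(+)", OF Suc]) measurable
qed simp

text \<open>For \<open>t \<le> t'\<close> this is the projection of \<open>x\<close> to \<open>[t, t']\<close>, so that \<open>clip t t' y - clip t t' x\<close> is
  the length of the part of the interval from \<open>x\<close> to \<open>y\<close> that lies in \<open>[t, t']\<close>.\<close>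

definition clip :: "real \<Rightarrow> real \<Rightarrow> real \<Rightarrow> real" where
  "clip t t' x = max t (min t' x)"

definition op_integral :: "(real \<Rightarrow> real) \<Rightarrow> real \<Rightarrow> real \<Rightarrow> real" where
  "op_integral \<psi> x y = (\<integral>r. indicator {x<..y} r * \<psi> r \<partial>lborel)"

lemma op_integral_indicator:
  assumes "x \<le> y" "t \<le> t'"
  shows "op_integral (indicator {t<..t'}) x y = clip t t' y - clip t t' x"
proof -
  have "op_integral (indicator {t<..t'}) x y = (\<integral>r. indicator {max x t<..min y t'} r \<partial>lborel)"
    unfolding op_integral_def by (intro Bochner_Integration.integral_cong) (auto simp: indicator_def)
  also have "\<dots> = measure lborel {max x t<..min y t'}" by simp
  also have "\<dots> = max 0 (min y t' - max x t)"
    by (cases "max x t \<le> min y t'") (auto simp: max_def)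
  also have "\<dots> = clip t t' y - clip t t' x" using assms by (auto simp: clip_def max_def min_def)
  finally show ?thesis .
qed

text \<open>The compensator of an exponential waiting time started at \<open>\<beta>\<close>: the expected value of \<open>\<psi>\<close> at
  the end of the waiting time equals the expected integral of \<open>\<psi>\<close> up to that point.\<close>

lemma exp_law_compensator:
  fixes \<psi> :: "real \<Rightarrow> real"
  assumes int: "integrable lborel \<psi>" and K: "\<And>r. \<bar>\<psi> r\<bar> \<le> K"
  shows "(\<integral>e. \<psi> (\<beta> + e) \<partial>exp_law) = (\<integral>e. op_integral \<psi> \<beta> (\<beta> + e) \<partial>exp_law)"
    and "integrable exp_law (\<lambda>e. \<psi> (\<beta> + e))"
    and "integrable exp_law (\<lambda>e. op_integral \<psi> \<beta> (\<beta> + e))"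
proof -
  interpret E: prob_space exp_law by (rule prob_space_exp_law)
  interpret LE: pair_sigma_finite lborel exp_law ..
  interpret EL: pair_sigma_finite exp_law lborel ..
  have [measurable]: "\<psi> \<in> borel_measurable borel" using int by simp
  define f where "f = (\<lambda>(r, e). indicator {\<beta><..\<beta> + e} r * \<psi> r)"
  have f_eq: "f = (\<lambda>x. (if \<beta> < fst x \<and> fst x \<le> \<beta> + snd x then 1 else 0) * \<psi> (fst x))"
    by (auto simp: f_def indicator_def)
  have f_meas: "f \<in> borel_measurable (lborel \<Otimes>\<^sub>M exp_law)"
    unfolding f_eq
  proof (rule borel_measurable_times)
    show "(\<lambda>x. \<psi> (fst x)) \<in> borel_measurable (lborel \<Otimes>\<^sub>M exp_law)"
      by (rule measurable_compose[OF measurable_fst]) simp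
  qed measurable
  have inner: "integrable exp_law (\<lambda>e. f (r, e))" for r
  proof (rule E.integrable_const_bound[where B = "\<bar>\<psi> r\<bar>"])
    show "AE e in exp_law. norm (f (r, e)) \<le> \<bar>\<psi> r\<bar>" by (simp add: f_eq)
    show "(\<lambda>e. f (r, e)) \<in> borel_measurable exp_law" unfolding f_eq fst_conv snd_conv by measurable
  qed
  have int_f: "integrable (lborel \<Otimes>\<^sub>M exp_law) f"
  proof (rule LE.Fubini_integrable[OF f_meas])
    show "integrable lborel (\<lambda>r. \<integral>e. norm (f (r, e)) \<partial>exp_law)"
    proof (rule Bochner_Integration.integrable_bound[OF integrable_norm[OF int]])
      have "(\<integral>e. norm (f (r, e)) \<partial>exp_law) \<le> \<bar>\<psi> r\<bar>" for r
        by (rule E.integral_le_const) (use inner in \<open>simp_all add: f_eq\<close>)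
      then show "AE r in lborel. norm (\<integral>e. norm (f (r, e)) \<partial>exp_law) \<le> norm (norm (\<psi> r))"
        by simp
      show "(\<lambda>r. \<integral>e. norm (f (r, e)) \<partial>exp_law) \<in> borel_measurable lborel"
        by (rule E.borel_measurable_lebesgue_integral) (use f_meas in simp)
    qed
  qed (use inner in simp_all)
  show i: "integrable exp_law (\<lambda>e. \<psi> (\<beta> + e))"
    by (rule E.integrable_const_bound[where B = K]) (use K in auto)
  have int_f': "integrable (exp_law \<Otimes>\<^sub>M lborel) (\<lambda>(e, r). f (r, e))"
    using int_f by (simp add: LE.integrable_product_swap_iff)
  show "integrable exp_law (\<lambda>e. op_integral \<psi> \<beta> (\<beta> + e))"
    using EL.integrable_fst'[OF int_f'] by (simp add: f_def op_integral_def)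
  have "(\<integral>e. op_integral \<psi> \<beta> (\<beta> + e) \<partial>exp_law) = (\<integral>e. \<integral>r. f (r, e) \<partial>lborel \<partial>exp_law)"
    by (simp add: f_def op_integral_def)
  also have "\<dots> = (\<integral>r. \<integral>e. f (r, e) \<partial>exp_law \<partial>lborel)"
    using LE.Fubini_integral[of "\<lambda>r e. f (r, e)"] int_f by simp
  also have "\<dots> = (\<integral>r. exponential_density 1 (r - \<beta>) * \<psi> r \<partial>lborel)"
  proof (rule integral_cong_AE)
    show "AE r in lborel. (\<integral>e. f (r, e) \<partial>exp_law) = exponential_density 1 (r - \<beta>) * \<psi> r"
      using AE_lborel_singleton[of \<beta>]
    proof eventually_elim
      case (elim r)
      have ne: "AE e in exp_law. e \<noteq> r - \<beta>"
        unfolding exp_law_def by (subst AE_density) (use AE_lborel_singleton[of "r - \<beta>"] in auto)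
      have "(\<integral>e. f (r, e) \<partial>exp_law) = (\<integral>e. (if \<beta> < r then indicator {r - \<beta><..} e else 0) * \<psi> r \<partial>exp_law)"
      proof (rule integral_cong_AE)
        show "(\<lambda>e. f (r, e)) \<in> borel_measurable exp_law" using inner by simp
        show "AE e in exp_law. f (r, e) = (if \<beta> < r then indicator {r - \<beta><..} e else 0) * \<psi> r"
          using ne by eventually_elim (auto simp: f_eq indicator_def)
      qed measurable
      also have "\<dots> = exponential_density 1 (r - \<beta>) * \<psi> r"
        using elim measure_exp_law_greater[of "r - \<beta>"] by (auto simp: exponential_density_def)
      finally show ?case .
    qed
    show "(\<lambda>r. \<integral>e. f (r, e) \<partial>exp_law) \<in> borel_measurable lborel"
      by (rule E.borel_measurable_lebesgue_integral) (use f_meas in simp)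
    show "(\<lambda>r. exponential_density 1 (r - \<beta>) * \<psi> r) \<in> borel_measurable lborel"
      unfolding exponential_density_def by measurable
  qed
  also have "\<dots> = (\<integral>e. exponential_density 1 e * \<psi> (\<beta> + e) \<partial>lborel)"
    by (subst lborel_integral_real_affine[where c = 1 and t = \<beta>]) simp_all
  also have "\<dots> = (\<integral>e. \<psi> (\<beta> + e) \<partial>exp_law)"
    unfolding exp_law_def by (subst integral_density) (auto simp: exponential_density_def)
  finally show "(\<integral>e. \<psi> (\<beta> + e) \<partial>exp_law) = (\<integral>e. op_integral \<psi> \<beta> (\<beta> + e) \<partial>exp_law)" ..
qed

context catalytic_rates begin

lemma measurable_rate [measurable]: "rate \<in> borel_measurable (count_space UNIV)"
  by simp

lemma measurable_op_time [measurable (raw)]: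
  assumes [measurable]: "f \<in> measurable M conf_law" "p \<in> measurable M (count_space UNIV)"
  shows "(\<lambda>x. op_time (f x) u (p x) k) \<in> borel_measurable M"
  unfolding op_time_def by measurable

lemma measurable_segment [measurable (raw)]:
  assumes [measurable]: "f \<in> measurable M conf_law" "p \<in> measurable M (count_space UNIV)" "r \<in> borel_measurable M"
  shows "(\<lambda>x. segment (f x) u (p x) (r x)) \<in> measurable M (count_space UNIV)"
  unfolding segment_def by measurable

lemma measurable_age [measurable (raw)]:
  assumes [measurable]: "f \<in> measurable M conf_law" "p \<in> measurable M (count_space UNIV)" "r \<in> borel_measurable M"
  shows "(\<lambda>x. age (f x) u (p x) (r x)) \<in> borel_measurable M"
  unfolding age_def
  by (rule measurable_compose_countable[where g = "\<lambda>x. segment (f x) u (p x) (r x)"]) measurable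

lemma measurable_op_site [measurable (raw)]:
  assumes [measurable]: "f \<in> measurable M conf_law" "p \<in> measurable M (count_space UNIV)" "r \<in> borel_measurable M"
  shows "(\<lambda>x. op_site (f x) u (p x) (r x)) \<in> measurable M (count_space UNIV)"
  unfolding op_site_def
  by (rule measurable_compose_countable[where g = "\<lambda>x. segment (f x) u (p x) (r x)"]) measurable

lemma measurable_born [measurable (raw)]:
  assumes [measurable]: "f \<in> measurable M conf_law"
  shows "(\<lambda>x. fst (born (f x) u)) \<in> borel_measurable M"
    and "(\<lambda>x. snd (born (f x) u)) \<in> measurable M (count_space UNIV)"
  by (induction u) simp_all

end

section \<open>Compensated jumps and rings\<close>

lemma op_integral_additive:
  fixes \<psi> :: "real \<Rightarrow> real"
  assumes "integrable lborel \<psi>" "x \<le> y" "y \<le> z"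
  shows "op_integral \<psi> x y + op_integral \<psi> y z = op_integral \<psi> x z"
proof -
  have i: "integrable lborel (\<lambda>r. indicator {a<..b} r * \<psi> r)" for a b :: real
    using integrable_mult_indicator[OF _ assms(1), of "{a<..b}"] by simp
  have "op_integral \<psi> x y + op_integral \<psi> y z =
      (\<integral>r. indicator {x<..y} r * \<psi> r + indicator {y<..z} r * \<psi> r \<partial>lborel)"
    unfolding op_integral_def by (rule Bochner_Integration.integral_add[symmetric]; rule i)
  also have "\<dots> = op_integral \<psi> x z"
    unfolding op_integral_def by (intro Bochner_Integration.integral_cong refl) (use assms(2,3) in \<open>auto simp: indicator_def\<close>)
  finally show ?thesis .
qed

lemma op_integral_sum:
  fixes \<psi> x :: "_ \<Rightarrow> real"
  assumes "integrable lborel \<psi>" "mono x"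
  shows "(\<Sum>n<m. op_integral \<psi> (x n) (x (Suc n))) = op_integral \<psi> (x 0) (x m)"
proof (induction m)
  case (Suc m)
  then show ?case using op_integral_additive[OF assms(1), of "x 0" "x m" "x (Suc m)"] monoD[OF assms(2)] by simp
qed (simp add: op_integral_def)

lemma abs_op_integral_le:
  fixes \<psi> \<eta> :: "real \<Rightarrow> real"
  assumes "integrable lborel \<psi>" "integrable lborel \<eta>" "\<And>r. \<bar>\<psi> r\<bar> \<le> K * \<eta> r"
  shows "\<bar>op_integral \<psi> x y\<bar> \<le> K * op_integral \<eta> x y"
proof -
  have i: "integrable lborel (\<lambda>r. indicator {x<..y} r * f r)" if "integrable lborel f" for f :: "real \<Rightarrow> real"
    using integrable_mult_indicator[OF _ that, of "{x<..y}"] by simp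
  have "\<bar>op_integral \<psi> x y\<bar> \<le> (\<integral>r. \<bar>indicator {x<..y} r * \<psi> r\<bar> \<partial>lborel)"
    unfolding op_integral_def by (rule integral_abs_bound)
  also have "\<dots> \<le> (\<integral>r. K * (indicator {x<..y} r * \<eta> r) \<partial>lborel)"
    by (intro integral_mono integrable_abs integrable_mult_right i assms(1,2))
      (use assms(3) in \<open>auto simp: indicator_def\<close>)
  finally show ?thesis by (simp add: op_integral_def)
qed

lemma integrable_indicator_Icc: "integrable lborel (indicator {a..b} :: real \<Rightarrow> real)"
  by (cases "a \<le> b") auto

lemma pred_good [measurable]: "Measurable.pred conf_law (good :: 'd::finite config \<Rightarrow> bool)"
proof -
  have "good = (\<lambda>c :: 'd config. (\<forall>u k. 0 < wait_j c u k \<and> 0 < wait_b c u k) \<and>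
      (\<forall>u. \<forall>Z::nat. \<exists>N. \<forall>n. N \<le> n \<longrightarrow> real Z \<le> jump_age c u n))"
    unfolding good_def filterlim_at_top eventually_sequentially fun_eq_iff
    by (auto, meson order_trans real_arch_simple)
  also have "Measurable.pred conf_law \<dots>" by measurable
  finally show ?thesis .
qed

text \<open>The mean of \<open>\<phi> p e\<close> over the possible displacements \<open>e\<close>.\<close>

definition step_mean :: "(int ^ 'd::finite \<Rightarrow> int ^ 'd \<Rightarrow> real) \<Rightarrow> int ^ 'd \<Rightarrow> real" where
  "step_mean \<phi> p = (\<Sum>e\<in>unit_steps. \<phi> p e) / card (unit_steps :: (int ^ 'd) set)"

lemma abs_step_mean_le: "(\<And>p e. \<bar>\<phi> p e\<bar> \<le> K) \<Longrightarrow> \<bar>step_mean \<phi> p\<bar> \<le> K"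
proof -
  assume *: "\<And>p e. \<bar>\<phi> p e\<bar> \<le> K"
  have "\<bar>\<Sum>e\<in>unit_steps. \<phi> p e\<bar> \<le> of_nat (card (unit_steps :: (int ^ 'a) set)) * K"
    by (rule order_trans[OF sum_abs sum_bounded_above]) (rule *)
  then show ?thesis by (simp add: step_mean_def card_gt_0_iff divide_le_eq mult.commute)
qed

lemma clip_mono: "x \<le> y \<Longrightarrow> clip t t' x \<le> clip t t' y"
  and clip_bounds: "t \<le> t' \<Longrightarrow> t \<le> clip t t' x" "t \<le> t' \<Longrightarrow> clip t t' x \<le> t'"
  by (auto simp: clip_def)

lemma measurable_clip [measurable]: "clip t t' \<in> borel_measurable borel"
  unfolding clip_def by measurable

context catalytic_rates begin

lemma measurable_jump_time [measurable (raw)]: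
  assumes [measurable]: "f \<in> measurable M conf_law"
  shows "(\<lambda>x. jump_time (f x) u k) \<in> borel_measurable M"
  unfolding jump_time_def by measurable

text \<open>The contribution \<open>\<phi> p e\<close> of the \<open>k\<close>-th jump of \<open>u\<close>, from \<open>p\<close> by the displacement \<open>e\<close>, if it occurs in
  \<open>(t, t']\<close>, minus its compensator: the mean over the displacements times the time that \<open>u\<close> spends in its
  segment \<open>k\<close> within \<open>[t, t']\<close>.\<close>

definition jump_comp ::
    "(int ^ 'd::finite \<Rightarrow> int ^ 'd \<Rightarrow> real) \<Rightarrow> real \<Rightarrow> real \<Rightarrow> 'd config \<Rightarrow> nat list \<Rightarrow> nat \<Rightarrow> real" where
  "jump_comp \<phi> t t' c u k =
     indicator {t<..t'} (jump_time c u (Suc k)) * \<phi> (site c u (snd (born c u)) k) (disp c u k) -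
     step_mean \<phi> (site c u (snd (born c u)) k) *
       (clip t t' (jump_time c u (Suc k)) - clip t t' (jump_time c u k))"

lemma measurable_jump_comp [measurable]: "(\<lambda>c. jump_comp \<phi> t t' c u k) \<in> borel_measurable conf_law"
proof -
  have "(\<lambda>c. case_prod \<phi> (site c u (snd (born c u)) k, disp c u k)) \<in> borel_measurable conf_law"
    by (rule measurable_compose[OF measurable_count_space_compose2[where f = Pair]]) measurable
  then have [measurable]: "(\<lambda>c. \<phi> (site c u (snd (born c u)) k) (disp c u k)) \<in> borel_measurable conf_law"
    by simp
  have [measurable]: "step_mean \<phi> \<in> borel_measurable (count_space UNIV)" by simp
  show ?thesis unfolding jump_comp_def by measurable
qed

lemma abs_jump_comp_le:
  assumes "t \<le> t'" and K: "\<And>p e. \<bar>\<phi> p e\<bar> \<le> K"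
  shows "\<bar>jump_comp \<phi> t t' c u k\<bar> \<le> K + K * (t' - t)"
proof -
  have "0 \<le> K" using K abs_ge_zero order_trans by blast
  have "\<bar>clip t t' (jump_time c u (Suc k)) - clip t t' (jump_time c u k)\<bar> \<le> t' - t"
    using clip_bounds[OF assms(1)] by (smt (verit))
  with \<open>0 \<le> K\<close> have "\<bar>step_mean \<phi> p * (clip t t' (jump_time c u (Suc k)) - clip t t' (jump_time c u k))\<bar> \<le> K * (t' - t)" for p
    unfolding abs_mult by (intro mult_mono abs_step_mean_le K) auto
  moreover have "\<bar>indicator {t<..t'} (jump_time c u (Suc k)) * \<phi> p e\<bar> \<le> K" for p e
    using K[of p e] \<open>0 \<le> K\<close> by (auto simp: indicator_def)
  ultimately show ?thesis unfolding jump_comp_def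
    by (intro order_trans[OF abs_triangle_ineq4 add_mono])
qed

text \<open>The predicate \<open>Q\<close> singles out the configurations for which locality is available. The lemma is used with
  \<open>Q\<close> trivial to show that almost every configuration is good, and with \<open>Q\<close> meaning good afterwards.\<close>

lemma jump_comp_mean_zero:
  fixes V :: "'d::finite config \<Rightarrow> real"
  assumes V [measurable]: "V \<in> borel_measurable conf_law" and VC: "\<And>c. \<bar>V c\<bar> \<le> C"
    and t: "t \<le> t'" and K: "\<And>p e. \<bar>\<phi> p e\<bar> \<le> K"
    and Q: "AE c in conf_law. Q c"
    and Q_upd: "\<And>c j s b. Q c \<Longrightarrow> 0 < j \<Longrightarrow> 0 < b \<Longrightarrow> Q (c((u, k) := (j, s, b)))"
    and local: "\<And>c j s. Q c \<Longrightarrow> Q (upd_jump c u k j s) \<Longrightarrow>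
       t < jump_time c u (Suc k) \<Longrightarrow> t < jump_time (upd_jump c u k j s) u (Suc k) \<Longrightarrow>
       V (upd_jump c u k j s) = V c"
  shows "(\<integral>c. V c * jump_comp \<phi> t t' c u k \<partial>conf_law) = 0"
proof (rule integral_resample_zero)
  let ?i = "(u, k)"
  let ?F = "\<lambda>c. V c * jump_comp \<phi> t t' c u k"
  let ?S = "measure_pmf (pmf_of_set unit_steps) :: (int ^ 'd) measure"
  interpret E: prob_space exp_law by (rule prob_space_exp_law)
  have "0 \<le> C" using VC abs_ge_zero order_trans by blast
  show F_bound: "\<bar>?F c\<bar> \<le> C * (K + K * (t' - t))" for c
    unfolding abs_mult by (intro mult_mono VC abs_jump_comp_le t K \<open>0 \<le> C\<close>) auto
  show "?F \<in> borel_measurable conf_law" by measurable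
  show "AE c in conf_law. (\<integral>x. ?F (c(?i := x)) \<partial>mark_law) = 0"
    using Q
  proof eventually_elim
    case (elim c)
    define p where "p = site c u (snd (born c u)) k"
    define \<beta> where "\<beta> = jump_time c u k"
    have "(\<integral>s. \<integral>j. ?F (c(?i := (j, s, b))) \<partial>exp_law \<partial>?S) = 0" if "0 < b" for b
    proof -
      \<comment> \<open>by locality, \<open>V\<close> takes this value whenever the jump happens after \<open>t\<close>; otherwise the compensated jump is \<open>0\<close>\<close>
      define v where "v = V (c(?i := (max 1 (t - \<beta> + 1), 0, b)))"
      define A :: real where "A = (\<integral>j. indicator {t<..t'} (\<beta> + j) \<partial>exp_law)"
      have comp: "jump_comp \<phi> t t' (c(?i := (j, s, b))) u k =
          indicator {t<..t'} (\<beta> + j) * \<phi> p s - step_mean \<phi> p * (clip t t' (\<beta> + j) - clip t t' \<beta>)" for j s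
      proof -
        have "born (c(?i := (j, s, b))) u = born c u" by (rule born_upd) simp
        then show ?thesis
          unfolding jump_comp_def jump_time_def jump_age_Suc marks_upd_later[OF order_refl] p_def \<beta>_def
          by (simp add: wait_j_def disp_def add.assoc)
      qed
      have time: "jump_time (c(?i := (j, s, b))) u (Suc k) = \<beta> + j" for j s
      proof -
        have "born (c(?i := (j, s, b))) u = born c u" by (rule born_upd) simp
        then show ?thesis
          unfolding jump_time_def jump_age_Suc marks_upd_later[OF order_refl] \<beta>_def
          by (simp add: wait_j_def add.assoc)
      qed
      have *: "?F (c(?i := (j, s, b))) =
          v * (indicator {t<..t'} (\<beta> + j) * \<phi> p s - step_mean \<phi> p * (clip t t' (\<beta> + j) - clip t t' \<beta>))"
        if "0 < j" for j s
      proof (cases "t < \<beta> + j")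
        case True
        have "V (c(?i := (j, s, b))) = v"
          using local[of "c(?i := (max 1 (t - \<beta> + 1), 0, b))" j s] Q_upd[OF elim] that \<open>0 < b\<close> True
          unfolding v_def by (auto simp: time[simplified])
        then show ?thesis by (simp only: comp)
      next
        case False
        then have "clip t t' (\<beta> + j) = clip t t' \<beta>" using that by (simp add: clip_def)
        then show ?thesis unfolding comp using False by simp
      qed
      have int: "integrable exp_law (\<lambda>j. indicator {t<..t'} (\<beta> + j) :: real)"
        by (rule E.integrable_const_bound[where B = 1]) (auto simp: indicator_def)
      have int': "integrable exp_law (\<lambda>j. clip t t' (\<beta> + j) - clip t t' \<beta>)"
        by (rule E.integrable_const_bound[where B = "t' - t"])
          (use clip_bounds[OF t] in \<open>auto intro!: AE_I2 simp: abs_le_iff add_mono diff_mono\<close>)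
      have A': "(\<integral>j. clip t t' (\<beta> + j) - clip t t' \<beta> \<partial>exp_law) = A"
      proof -
        have ind: "integrable lborel (indicator {t<..t'} :: real \<Rightarrow> real)" using t by simp
        from exp_law_compensator(1)[OF this, of 1 \<beta>]
        have "A = (\<integral>j. op_integral (indicator {t<..t'}) \<beta> (\<beta> + j) \<partial>exp_law)"
          unfolding A_def by (simp add: indicator_def)
        also have "\<dots> = (\<integral>j. clip t t' (\<beta> + j) - clip t t' \<beta> \<partial>exp_law)"
        proof (rule integral_cong_AE)
          show "(\<lambda>j. op_integral (indicator {t<..t'}) \<beta> (\<beta> + j)) \<in> borel_measurable exp_law"
            using exp_law_compensator(3)[OF ind, of 1 \<beta>] by (simp add: indicator_def)
          show "AE j in exp_law. op_integral (indicator {t<..t'}) \<beta> (\<beta> + j) = clip t t' (\<beta> + j) - clip t t' \<beta>"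
            using AE_exp_law_pos by eventually_elim (rule op_integral_indicator[OF _ t], simp)
        qed measurable
        finally show ?thesis ..
      qed
      have "(\<integral>j. ?F (c(?i := (j, s, b))) \<partial>exp_law) = v * (A * \<phi> p s - step_mean \<phi> p * A)" for s
      proof -
        have "(\<integral>j. ?F (c(?i := (j, s, b))) \<partial>exp_law) = (\<integral>j. v * (indicator {t<..t'} (\<beta> + j) * \<phi> p s -
            step_mean \<phi> p * (clip t t' (\<beta> + j) - clip t t' \<beta>)) \<partial>exp_law)"
        proof (rule integral_cong_AE)
          have "(\<lambda>j. c(?i := (j, s, b))) \<in> measurable exp_law conf_law"
            by (rule measurable_compose[OF _ measurable_conf_upd1])
              (simp add: mark_law_def space_pair_measure)
          then show "(\<lambda>j. ?F (c(?i := (j, s, b)))) \<in> borel_measurable exp_law"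
            by (rule measurable_compose) measurable
          show "AE j in exp_law. ?F (c(?i := (j, s, b))) = v * (indicator {t<..t'} (\<beta> + j) * \<phi> p s -
            step_mean \<phi> p * (clip t t' (\<beta> + j) - clip t t' \<beta>))"
            using AE_exp_law_pos by eventually_elim (rule *)
        qed measurable
        also have "\<dots> = v * (A * \<phi> p s - step_mean \<phi> p * A)"
          using int int' by (simp add: A_def A'[unfolded A_def])
        finally show ?thesis .
      qed
      then have "(\<integral>s. \<integral>j. ?F (c(?i := (j, s, b))) \<partial>exp_law \<partial>?S) =
          (\<integral>s. v * (A * \<phi> p s - step_mean \<phi> p * A) \<partial>?S)" by simp
      also have "\<dots> = (\<Sum>s\<in>unit_steps. v * (A * \<phi> p s - step_mean \<phi> p * A)) / card (unit_steps :: (int ^ 'd) set)"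
        by (rule integral_pmf_of_set) simp_all
      also have "(\<Sum>s\<in>unit_steps. v * (A * \<phi> p s - step_mean \<phi> p * A)) =
          v * (A * sum (\<phi> p) unit_steps - card (unit_steps :: (int ^ 'd) set) * (step_mean \<phi> p * A))"
        by (simp add: sum_subtractf sum_distrib_left right_diff_distrib ac_simps)
      also have "\<dots> = 0" by (simp add: step_mean_def)
      finally show ?thesis by (simp del: fun_upd_apply)
    qed
    then have "AE b in exp_law. (\<integral>s. \<integral>j. ?F (c(?i := (j, s, b))) \<partial>exp_law \<partial>?S) = 0"
      using AE_exp_law_pos by (auto elim: AE_mp)
    then have "(\<integral>b. \<integral>s. \<integral>j. ?F (c(?i := (j, s, b))) \<partial>exp_law \<partial>?S \<partial>exp_law) = 0"
      by (rule integral_eq_zero_AE)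
    then show ?case
      by (subst integral_mark_law_j[OF _ F_bound]) (auto intro!: measurable_compose[OF measurable_conf_upd1[of c ?i]])
  qed
qed

text \<open>Almost surely each particle jumps finitely often in bounded time, since the expected number of its jumps in
  an interval is at most the length of the interval. The windows \<open>(-a, a]\<close> also catch a time of birth that is
  negative, which is not yet excluded here.\<close>

lemma AE_good: "AE c :: 'd::finite config in conf_law. good c"
proof -
  interpret C: prob_space "conf_law :: 'd config measure" by (rule prob_space_conf_law)
  have *: "AE c :: 'd config in conf_law. finite {k. jump_time c u (Suc k) \<in> {-a<..a}}" if "0 \<le> a" for u a
  proof -
    let ?I = "\<lambda>c :: 'd config. \<lambda>k. indicator {-a<..a} (jump_time c u (Suc k)) :: real"
    have i1: "integrable conf_law (\<lambda>c. ?I c k)" for k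
      by (rule C.integrable_const_bound[where B = 1]) (auto simp: indicator_def)
    have le: "(\<integral>c. (\<Sum>k<m. ?I c k) \<partial>conf_law) \<le> 2 * a" for m
    proof -
      have i2: "integrable conf_law (\<lambda>c :: 'd config. clip (-a) a (jump_time c u k))" for k
        by (rule C.integrable_const_bound[where B = a])
          (use clip_bounds[of "-a" a] that in \<open>auto simp: abs_le_iff minus_le_iff\<close>)
      have "(\<integral>c. ?I c k \<partial>conf_law) =
          (\<integral>c. clip (-a) a (jump_time (c :: 'd config) u (Suc k)) - clip (-a) a (jump_time c u k) \<partial>conf_law)" for k
      proof -
        have "(\<integral>c. 1 * jump_comp (\<lambda>_ _. 1) (-a) a (c :: 'd config) u k \<partial>conf_law) = 0"
          by (rule jump_comp_mean_zero[where C = 1 and K = 1 and Q = "\<lambda>_. True"]) (use that in auto)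
        then show ?thesis using i1 i2 by (simp add: jump_comp_def step_mean_def Bochner_Integration.integral_diff[OF i2 i2])
      qed
      then have "(\<integral>c. (\<Sum>k<m. ?I c k) \<partial>conf_law) =
          (\<Sum>k<m. \<integral>c. clip (-a) a (jump_time (c :: 'd config) u (Suc k)) - clip (-a) a (jump_time c u k) \<partial>conf_law)"
        using i1 by simp
      also have "\<dots> = (\<integral>c. clip (-a) a (jump_time (c :: 'd config) u m) - clip (-a) a (jump_time c u 0) \<partial>conf_law)"
        using i2 sum_lessThan_telescope[of "\<lambda>k. \<integral>c. clip (-a) a (jump_time (c :: 'd config) u k) \<partial>conf_law" m]
        by simp
      also have "\<dots> \<le> 2 * a"
      proof (rule C.integral_le_const)
        have "clip (-a) a x - clip (-a) a y \<le> 2 * a" for x y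
          using clip_bounds(1)[of "-a" a y] clip_bounds(2)[of "-a" a x] that by simp
        then show "AE c :: 'd config in conf_law. clip (-a) a (jump_time c u m) - clip (-a) a (jump_time c u 0) \<le> 2 * a"
          by simp
      qed (use i2 in simp)
      finally show ?thesis .
    qed
    have "(\<integral>\<^sup>+c. (\<Sum>k. ennreal (?I c k)) \<partial>conf_law) \<le> ennreal (2 * a)"
    proof -
      have "(\<integral>\<^sup>+c. (\<Sum>k. ennreal (?I c k)) \<partial>conf_law) = (\<Sum>k. \<integral>\<^sup>+c. ennreal (?I c k) \<partial>conf_law)"
        by (rule nn_integral_suminf) measurable
      also have "\<dots> \<le> ennreal (2 * a)"
      proof (rule suminf_le_const)
        fix m
        have "(\<Sum>k<m. \<integral>\<^sup>+c. ennreal (?I c k) \<partial>conf_law) = (\<integral>\<^sup>+c. ennreal (\<Sum>k<m. ?I c k) \<partial>conf_law)"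
          by (subst nn_integral_sum[symmetric]) (auto simp: sum_ennreal)
        also have "\<dots> = ennreal (\<integral>c. (\<Sum>k<m. ?I c k) \<partial>conf_law)"
          by (rule nn_integral_eq_integral)
            (intro Bochner_Integration.integrable_sum i1, simp add: sum_nonneg)
        finally show "(\<Sum>k<m. \<integral>\<^sup>+c. ennreal (?I c k) \<partial>conf_law) \<le> ennreal (2 * a)" using le[of m] by (simp add: ennreal_leI)
      qed simp
      finally show ?thesis .
    qed
    then have "(\<integral>\<^sup>+c. (\<Sum>k. ennreal (?I c k)) \<partial>conf_law) \<noteq> \<infinity>" by (auto simp: top_unique)
    then have "AE c in conf_law. (\<Sum>k. ennreal (?I c k)) \<noteq> \<infinity>"
      by (intro nn_integral_PInf_AE) measurable
    then show ?thesis
    proof eventually_elim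
      case (elim c)
      then have "summable (?I c)" by (intro summable_suminf_not_top) auto
      then have "?I c \<longlonglongrightarrow> 0" by (rule summable_LIMSEQ_zero)
      then have "eventually (\<lambda>k. ?I c k < 1) sequentially" by (rule order_tendstoD) simp
      then have "eventually (\<lambda>k. jump_time c u (Suc k) \<notin> {-a<..a}) sequentially"
        by eventually_elim (auto simp: indicator_def split: if_splits)
      then show ?case unfolding eventually_cofinite[symmetric] cofinite_eq_sequentially[symmetric]
        by (simp add: eventually_cofinite)
    qed
  qed
  have "AE c :: 'd config in conf_law. \<forall>u. \<forall>a::nat. finite {k. jump_time c u (Suc k) \<in> {-real a<..real a}}"
    using * by (simp add: AE_all_countable)
  then show ?thesis using AE_conf_pos
  proof eventually_elim
    case (elim c)
    have "filterlim (jump_age c u) at_top sequentially" for u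
    proof (rule ccontr)
      have m: "mono (jump_age c u)" unfolding jump_age_def
        by (rule mono_sum_lessThan) (use elim(2) less_imp_le in blast)
      assume "\<not> ?thesis"
      then obtain Z where Z: "\<And>k. jump_age c u k < Z"
        unfolding filterlim_at_top eventually_sequentially
        by (meson m monoD not_le order_trans)
      obtain a :: nat where a: "\<bar>fst (born c u)\<bar> + \<bar>Z\<bar> + 1 \<le> real a" using real_arch_simple by blast
      have "jump_time c u (Suc k) \<in> {-real a<..real a}" for k
        using Z[of "Suc k"] a monoD[OF m, of 0 "Suc k"] by (auto simp: jump_time_def)
      then have "{k. jump_time c u (Suc k) \<in> {-real a<..real a}} = UNIV" by blast
      with elim(1) show False by (metis infinite_UNIV_nat)
    qed
    with elim(2) show ?case by (auto simp: good_def)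
  qed
qed

text \<open>\<open>ring_window g t t' c u r\<close> is the value of \<open>g\<close> at the place where \<open>u\<close> is at the operational time \<open>r\<close>, if
  \<open>r\<close> is positive and corresponds to a real time in \<open>(t, t']\<close>, and \<open>0\<close> otherwise. A ring at the operational time \<open>r\<close>
  contributes \<open>ring_window g t t' c u r\<close> to the increment, and \<open>ring_comp\<close> subtracts the compensator. On
  configurations that are not good, \<open>ring_comp\<close> is set to \<open>0\<close> to make it bounded.\<close>

definition ring_window ::
    "(int ^ 'd::finite \<Rightarrow> real) \<Rightarrow> real \<Rightarrow> real \<Rightarrow> 'd config \<Rightarrow> nat list \<Rightarrow> real \<Rightarrow> real" where
  "ring_window g t t' c u r =
     (if 0 < r \<and> t < fst (born c u) + age c u (snd (born c u)) r \<and> fst (born c u) + age c u (snd (born c u)) r \<le> t'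
      then g (op_site c u (snd (born c u)) r) else 0)"

definition ring_comp ::
    "(int ^ 'd::finite \<Rightarrow> real) \<Rightarrow> real \<Rightarrow> real \<Rightarrow> 'd config \<Rightarrow> nat list \<Rightarrow> nat \<Rightarrow> real" where
  "ring_comp g t t' c u n = (if good c then
     ring_window g t t' c u (ring_op c u (Suc n)) -
       op_integral (ring_window g t t' c u) (ring_op c u n) (ring_op c u (Suc n)) else 0)"

lemma measurable_ring_window [measurable (raw)]:
  assumes [measurable]: "f \<in> measurable M conf_law" "r \<in> borel_measurable M"
  shows "(\<lambda>x. ring_window g t t' (f x) u (r x)) \<in> borel_measurable M"
proof -
  have [measurable]: "g \<in> borel_measurable (count_space UNIV)" by simp
  show ?thesis unfolding ring_window_def by measurable
qed

lemma measurable_op_integral_ring_window [measurable (raw)]: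
  assumes [measurable]: "x \<in> borel_measurable conf_law" "y \<in> borel_measurable conf_law"
  shows "(\<lambda>c. op_integral (ring_window g t t' c u) (x c) (y c)) \<in> borel_measurable conf_law"
  unfolding op_integral_def indicator_def greaterThanAtMost_iff by measurable

lemma measurable_ring_comp [measurable]: "(\<lambda>c. ring_comp g t t' c u n) \<in> borel_measurable conf_law"
  unfolding ring_comp_def by measurable

lemma abs_ring_window_le:
  assumes "\<And>p. \<bar>g p\<bar> \<le> K" shows "\<bar>ring_window g t t' c u r\<bar> \<le> K * ring_window (\<lambda>_. 1) t t' c u r"
  using assms by (simp add: ring_window_def)

lemma ring_window_1_bounds: "0 \<le> ring_window (\<lambda>_. 1) t t' c u r" "ring_window (\<lambda>_. 1) t t' c u r \<le> 1"
  by (simp_all add: ring_window_def)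

text \<open>Any two operational times that fall into the window \<open>(t, t']\<close> differ by at most \<open>lam0 * (t' - t)\<close>.\<close>

lemma ring_window_support:
  assumes g: "good c" and "t \<le> t'"
  obtains r0 where "\<And>r. ring_window (\<lambda>_. 1) t t' c u r \<le> indicator {r0 - lam0 * (t' - t)..r0 + lam0 * (t' - t)} r"
proof (cases "\<exists>r0. ring_window (\<lambda>_. 1) t t' c u r0 \<noteq> 0")
  case True
  then obtain r0 where r0: "ring_window (\<lambda>_. 1) t t' c u r0 \<noteq> 0" by blast
  have close: "r' \<le> r + lam0 * (t' - t)"
    if "ring_window (\<lambda>_. 1) t t' c u r \<noteq> 0" "ring_window (\<lambda>_. 1) t t' c u r' \<noteq> 0" for r r'
  proof (cases "r \<le> r'")
    case True
    have "(r' - r) / lam0 \<le> t' - t"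
      using age_slope[OF g _ True, of u "snd (born c u)"] that by (auto simp: ring_window_def split: if_splits)
    then show ?thesis using lam0_pos by (simp add: field_simps)
  next
    case False
    then show ?thesis using lam0_pos assms(2) by (smt (verit) mult_nonneg_nonneg)
  qed
  show ?thesis
  proof (rule that)
    fix r
    show "ring_window (\<lambda>_. 1) t t' c u r \<le> indicator {r0 - lam0 * (t' - t)..r0 + lam0 * (t' - t)} r"
      using close[OF r0, of r] close[of r r0] r0 ring_window_1_bounds(2)[of t t' c u r]
      by (cases "ring_window (\<lambda>_. 1) t t' c u r = 0") (auto simp: indicator_def)
  qed
next
  case False
  show ?thesis by (rule that[of 0]) (use False in \<open>auto simp: indicator_def\<close>)
qed

lemma integrable_ring_window:
  assumes "good c" "t \<le> t'" and K: "\<And>p. \<bar>g p\<bar> \<le> K"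
  shows "integrable lborel (ring_window g t t' c u)"
proof -
  obtain r0 where r0: "\<And>r. ring_window (\<lambda>_. 1) t t' c u r \<le> indicator {r0 - lam0 * (t' - t)..r0 + lam0 * (t' - t)} r"
    using ring_window_support[OF assms(1,2)] by metis
  have K0: "0 \<le> K" using K abs_ge_zero order_trans by blast
  show ?thesis
  proof (rule Bochner_Integration.integrable_bound)
    show "integrable lborel (\<lambda>r. K * indicator {r0 - lam0 * (t' - t)..r0 + lam0 * (t' - t)} r)"
      by (intro integrable_mult_right integrable_indicator_Icc)
    show "AE r in lborel. norm (ring_window g t t' c u r) \<le>
        norm (K * indicator {r0 - lam0 * (t' - t)..r0 + lam0 * (t' - t)} r)"
      using order_trans[OF abs_ring_window_le[OF K] mult_left_mono[OF r0 K0]] K0 by (simp add: abs_mult)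
    show "ring_window g t t' c u \<in> borel_measurable lborel"
      by (intro measurable_ring_window[where f = "\<lambda>_. c" and r = "\<lambda>r. r"]) simp_all
  qed
qed

lemma op_integral_ring_window_1:
  assumes "good c" "t \<le> t'"
  shows "0 \<le> op_integral (ring_window (\<lambda>_. 1) t t' c u) x y"
    and "op_integral (ring_window (\<lambda>_. 1) t t' c u) x y \<le>
      2 * lam0 * (t' - t) * indicator {..t'} (fst (born c u))"
proof -
  let ?w = "ring_window (\<lambda>_. 1) t t' c u"
  show "0 \<le> op_integral ?w x y"
    unfolding op_integral_def by (intro Bochner_Integration.integral_nonneg) (simp add: ring_window_1_bounds)
  show "op_integral ?w x y \<le> 2 * lam0 * (t' - t) * indicator {..t'} (fst (born c u))"
  proof (cases "fst (born c u) \<le> t'")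
    case True
    obtain r0 where r0: "\<And>r. ?w r \<le> indicator {r0 - lam0 * (t' - t)..r0 + lam0 * (t' - t)} r"
      using ring_window_support[OF assms] by metis
    have "op_integral ?w x y \<le> (\<integral>r. indicator {r0 - lam0 * (t' - t)..r0 + lam0 * (t' - t)} r \<partial>lborel)"
      unfolding op_integral_def
    proof (rule integral_mono)
      show "integrable lborel (\<lambda>r. indicator {x<..y} r * ?w r)"
        using integrable_mult_indicator[OF _ integrable_ring_window[OF assms, of "\<lambda>_. 1" 1], of "{x<..y}"] by simp
      show "indicator {x<..y} r * ?w r \<le> indicator {r0 - lam0 * (t' - t)..r0 + lam0 * (t' - t)} r" for r
        using r0[of r] ring_window_1_bounds(1)[of t t' c u r] by (auto simp: indicator_def)
    qed (rule integrable_indicator_Icc)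
    also have "\<dots> = 2 * lam0 * (t' - t)" using lam0_pos assms(2) by simp
    finally show ?thesis using True by simp
  next
    case False
    have "?w r = 0" for r
      using False age_nonneg[OF assms(1), of r u "snd (born c u)"] by (auto simp: ring_window_def)
    then show ?thesis using False by (simp add: op_integral_def)
  qed
qed

lemma abs_op_integral_ring_window_le:
  assumes "good c" "t \<le> t'" and K: "\<And>p. \<bar>g p\<bar> \<le> K"
  shows "\<bar>op_integral (ring_window g t t' c u) x y\<bar> \<le> K * op_integral (ring_window (\<lambda>_. 1) t t' c u) x y"
  by (rule abs_op_integral_le) (use assms in \<open>auto intro!: integrable_ring_window abs_ring_window_le[where K = K]\<close>)

lemma abs_ring_comp_le:
  assumes "t \<le> t'" and K: "\<And>p. \<bar>g p\<bar> \<le> K"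
  shows "\<bar>ring_comp g t t' c u n\<bar> \<le> K + K * (2 * lam0 * (t' - t))"
proof (cases "good c")
  case True
  have K0: "0 \<le> K" using K abs_ge_zero order_trans by blast
  have a: "\<bar>ring_window g t t' c u r\<bar> \<le> K" for r
    using order_trans[OF abs_ring_window_le[OF K] mult_left_mono[OF ring_window_1_bounds(2) K0]] by simp
  have L: "0 \<le> 2 * lam0 * (t' - t)" using lam0_pos assms(1) by simp
  have "op_integral (ring_window (\<lambda>_. 1) t t' c u) x y \<le> 2 * lam0 * (t' - t)" for x y
    using op_integral_ring_window_1(2)[OF True assms(1), of u x y] L by (cases "fst (born c u) \<le> t'") auto
  then have "\<bar>op_integral (ring_window g t t' c u) x y\<bar> \<le> K * (2 * lam0 * (t' - t))" for x y
    by (intro order_trans[OF abs_op_integral_ring_window_le[OF True assms]] mult_left_mono K0)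
  with a show ?thesis using True unfolding ring_comp_def
    by (simp only: if_True) (intro order_trans[OF abs_triangle_ineq4 add_mono])
next
  case False
  have "0 \<le> K" using K abs_ge_zero order_trans by blast
  with False show ?thesis using lam0_pos assms(1) by (simp add: ring_comp_def)
qed

lemma ring_comp_mean_zero:
  fixes V :: "'d::finite config \<Rightarrow> real"
  assumes V [measurable]: "V \<in> borel_measurable conf_law" and VC: "\<And>c. \<bar>V c\<bar> \<le> C"
    and t: "t \<le> t'" and K: "\<And>p. \<bar>g p\<bar> \<le> K"
    and local: "\<And>c b. good c \<Longrightarrow> good (upd_ring c u n b) \<Longrightarrow>
       t < fst (born c (n # u)) \<Longrightarrow> t < fst (born (upd_ring c u n b) (n # u)) \<Longrightarrow>
       V (upd_ring c u n b) = V c"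
  shows "(\<integral>c. V c * ring_comp g t t' c u n \<partial>conf_law) = 0"
proof (rule integral_resample_zero)
  let ?i = "(u, n)"
  let ?F = "\<lambda>c. V c * ring_comp g t t' c u n"
  let ?S = "measure_pmf (pmf_of_set unit_steps) :: (int ^ 'd) measure"
  interpret E: prob_space exp_law by (rule prob_space_exp_law)
  have "0 \<le> C" using VC abs_ge_zero order_trans by blast
  show F_bound: "\<bar>?F c\<bar> \<le> C * (K + K * (2 * lam0 * (t' - t)))" for c
    unfolding abs_mult by (intro mult_mono VC abs_ring_comp_le t K \<open>0 \<le> C\<close>) auto
  show "?F \<in> borel_measurable conf_law" by measurable
  show "AE c in conf_law. (\<integral>x. ?F (c(?i := x)) \<partial>mark_law) = 0"
    using AE_good
  proof eventually_elim
    case (elim c)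
    have "(\<integral>b. ?F (c(?i := (j, s, b))) \<partial>exp_law) = 0" if "0 < j" for j s
    proof -
      define C where "C b = c(?i := (j, s, b))" for b
      have C_upd: "C b = (C b')(?i := (fst (C b' ?i), fst (snd (C b' ?i)), b))" for b b'
        by (simp add: C_def)
      have good: "good (C b)" if "0 < b" for b
        unfolding C_def by (rule good_upd) (use elim that \<open>0 < j\<close> in auto)
      define \<beta> where "\<beta> = ring_op c u n"
      have \<beta>: "0 \<le> \<beta>" unfolding \<beta>_def by (rule ring_op_nonneg[OF elim])
      define \<psi> where "\<psi> = ring_window g t t' (C 1) u"
      have born: "born (C b) u = born c u" for b unfolding C_def by (rule born_upd) simp
      have age: "age (C b) u = age (C 1) u" and site: "op_site (C b) u = op_site (C 1) u" for b
        by (subst C_upd[of b 1], rule marks_upd_b)+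
      have \<psi>: "ring_window g t t' (C b) u = \<psi>" for b
        unfolding \<psi>_def fun_eq_iff ring_window_def by (simp add: born age[of b] site[of b])
      have op: "ring_op (C b) u n = \<beta>" "ring_op (C b) u (Suc n) = \<beta> + b" for b
        unfolding ring_op_Suc \<beta>_def C_def marks_upd_later(3)[OF order_refl] by (simp_all add: wait_b_def)
      have comp: "ring_comp g t t' (C b) u n = \<psi> (\<beta> + b) - op_integral \<psi> \<beta> (\<beta> + b)" if "0 < b" for b
        unfolding ring_comp_def \<psi> op using good[OF that] by simp
      have time: "fst (born (C b) (n # u)) = fst (born c u) + age (C 1) u (snd (born c u)) (\<beta> + b)" for b
        by (simp add: born op age[of b])
      \<comment> \<open>by locality, \<open>V\<close> takes a single value \<open>v\<close> whenever the ring happens after \<open>t\<close>\<close>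
      obtain v where v: "\<And>b. 0 < b \<Longrightarrow> t < fst (born (C b) (n # u)) \<Longrightarrow> V (C b) = v"
      proof (cases "\<exists>b0>0. t < fst (born (C b0) (n # u))")
        case True
        then obtain b0 where b0: "0 < b0" "t < fst (born (C b0) (n # u))" by blast
        show ?thesis
        proof (rule that)
          fix b assume "0 < b" "t < fst (born (C b) (n # u))"
          then show "V (C b) = V (C b0)"
            using local[of "C b0" b] b0 good unfolding C_upd[of b b0, symmetric] by blast
        qed
      next
        case False
        then show ?thesis by (intro that[of 0]) blast
      qed
      have *: "?F (C b) = v * (\<psi> (\<beta> + b) - op_integral \<psi> \<beta> (\<beta> + b))" if "0 < b" for b
      proof (cases "t < fst (born (C b) (n # u))")
        case True
        then show ?thesis using v that comp by simp
      next
        case False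
        have "\<psi> r = 0" if "\<beta> < r" "r \<le> \<beta> + b" for r
          using that False \<beta> age_mono[OF good[of 1], of r "\<beta> + b" u "snd (born c u)"] unfolding time
          by (auto simp: \<psi>_def ring_window_def born)
        then have "\<psi> (\<beta> + b) = 0" "(\<lambda>r. indicator {\<beta><..\<beta> + b} r * \<psi> r) = (\<lambda>_. 0)"
          using that by (auto simp: indicator_def)
        then show ?thesis using comp[OF that] by (simp add: op_integral_def)
      qed
      have int: "integrable lborel \<psi>"
        unfolding \<psi>_def by (rule integrable_ring_window[OF _ t K]) (use good in simp)
      have bound: "\<bar>\<psi> r\<bar> \<le> K" for r
        using abs_ring_window_le[of g K t t' "C 1" u r, OF K] K[of 0]
        by (auto simp: \<psi>_def ring_window_def split: if_splits)
      have "(\<integral>b. ?F (C b) \<partial>exp_law) = (\<integral>b. v * (\<psi> (\<beta> + b) - op_integral \<psi> \<beta> (\<beta> + b)) \<partial>exp_law)"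
      proof (rule integral_cong_AE)
        have "C \<in> measurable exp_law conf_law" unfolding C_def
          by (rule measurable_compose[OF _ measurable_conf_upd1])
            (simp add: mark_law_def space_pair_measure)
        then show "(\<lambda>b. ?F (C b)) \<in> borel_measurable exp_law"
          by (rule measurable_compose) measurable
        show "(\<lambda>b. v * (\<psi> (\<beta> + b) - op_integral \<psi> \<beta> (\<beta> + b))) \<in> borel_measurable exp_law"
          by (rule borel_measurable_integrable)
            (intro integrable_mult_right Bochner_Integration.integrable_diff exp_law_compensator(2,3)[OF int bound])
        show "AE b in exp_law. ?F (C b) = v * (\<psi> (\<beta> + b) - op_integral \<psi> \<beta> (\<beta> + b))"
          using AE_exp_law_pos by eventually_elim (rule *)
      qed
      also have "\<dots> = 0"
        using exp_law_compensator[OF int bound, of \<beta>] by simp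
      finally show ?thesis by (simp add: C_def)
    qed
    then have "AE j in exp_law. (\<integral>s. \<integral>b. ?F (c(?i := (j, s, b))) \<partial>exp_law \<partial>?S) = 0"
      using AE_exp_law_pos by (auto elim: AE_mp)
    then have "(\<integral>j. \<integral>s. \<integral>b. ?F (c(?i := (j, s, b))) \<partial>exp_law \<partial>?S \<partial>exp_law) = 0"
      by (rule integral_eq_zero_AE)
    then show ?case
      by (subst integral_mark_law_b[OF _ F_bound]) (auto intro!: measurable_compose[OF measurable_conf_upd1[of c ?i]])
  qed
qed

end

section \<open>Second moments\<close>

lemma (in prob_space) integral_sum_square_orthogonal:
  fixes X :: "'i \<Rightarrow> 'a \<Rightarrow> real"
  assumes F: "finite F" and X: "\<And>i. i \<in> F \<Longrightarrow> X i \<in> borel_measurable M"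
    and K: "\<And>i x. i \<in> F \<Longrightarrow> \<bar>X i x\<bar> \<le> K"
    and orth: "\<And>i j. i \<in> F \<Longrightarrow> j \<in> F \<Longrightarrow> i \<noteq> j \<Longrightarrow> (\<integral>x. X i x * X j x \<partial>M) = 0"
  shows "(\<integral>x. (\<Sum>i\<in>F. X i x)\<^sup>2 \<partial>M) = (\<Sum>i\<in>F. \<integral>x. (X i x)\<^sup>2 \<partial>M)"
proof -
  have int: "integrable M (\<lambda>x. X i x * X j x)" if "i \<in> F" "j \<in> F" for i j
  proof (rule integrable_const_bound[where B = "K * K"])
    have "0 \<le> K" using K[OF that(1)] abs_ge_zero order_trans by blast
    then show "AE x in M. norm (X i x * X j x) \<le> K * K"
      using K that by (auto simp: abs_mult intro!: mult_mono)
  qed (use X that in measurable)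
  have "(\<integral>x. (\<Sum>i\<in>F. X i x)\<^sup>2 \<partial>M) = (\<integral>x. (\<Sum>i\<in>F. \<Sum>j\<in>F. X i x * X j x) \<partial>M)"
    by (simp add: power2_eq_square sum_product)
  also have "\<dots> = (\<Sum>i\<in>F. \<Sum>j\<in>F. \<integral>x. X i x * X j x \<partial>M)"
    using int by (simp add: Bochner_Integration.integral_sum)
  also have "\<dots> = (\<Sum>i\<in>F. \<Sum>j\<in>F. if i = j then \<integral>x. (X i x)\<^sup>2 \<partial>M else 0)"
    by (intro sum.cong refl) (auto simp: orth power2_eq_square)
  also have "\<dots> = (\<Sum>i\<in>F. \<integral>x. (X i x)\<^sup>2 \<partial>M)" using F by (simp add: sum.delta)
  finally show ?thesis .
qed

text \<open>Finite sets of labels, closed under passage to the parent, that exhaust all labels.\<close>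

definition labels :: "nat \<Rightarrow> nat list set" where
  "labels m = {u. set u \<subseteq> {..<m} \<and> length u \<le> m}"

lemma finite_labels [simp]: "finite (labels m)"
  unfolding labels_def by (rule finite_lists_length_le) simp
lemma labels_Cons: "n # u \<in> labels m \<Longrightarrow> u \<in> labels m \<and> n < m"
  by (auto simp: labels_def)
lemma labels_mono: "m \<le> m' \<Longrightarrow> labels m \<subseteq> labels m'"
  by (force simp: labels_def)
lemma labels_exhaust: "finite A \<Longrightarrow> \<exists>m. A \<subseteq> labels m"
proof (induction A rule: finite_induct)
  case (insert u A)
  then obtain m where m: "A \<subseteq> labels m" by blast
  have "u \<in> labels (length u + Suc (Max (insert 0 (set u))))"
    by (auto simp: labels_def less_Suc_eq_le trans_le_add2)
  then show ?case
    using m labels_mono[of m "max m (length u + Suc (Max (insert 0 (set u))))"]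
      labels_mono[of "length u + Suc (Max (insert 0 (set u)))" "max m (length u + Suc (Max (insert 0 (set u))))"]
    by (intro exI[of _ "max m (length u + Suc (Max (insert 0 (set u))))"]) auto
qed simp

context catalytic_rates begin

text \<open>The number of particles with labels in \<open>A\<close> that are alive at time \<open>t\<close>.\<close>

definition count_alive :: "nat list set \<Rightarrow> 'd::finite config \<Rightarrow> real \<Rightarrow> real" where
  "count_alive A c t = (\<Sum>u\<in>A. indicator {..t} (fst (born c u)))"

lemma count_alive_eq_card: "finite A \<Longrightarrow> count_alive A c t = card (A \<inter> alive_at c t)"
  unfolding count_alive_def alive_at_def indicator_def
  by (subst card_eq_sum) (auto intro!: sum.mono_neutral_cong_right split: if_splits)

lemma measurable_count_alive [measurable]: "(\<lambda>c. count_alive A c t) \<in> borel_measurable conf_law"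
  unfolding count_alive_def by measurable

lemma count_alive_bounds: "0 \<le> count_alive A c t" "count_alive A c t \<le> card A"
proof -
  show "0 \<le> count_alive A c t" unfolding count_alive_def by (simp add: sum_nonneg)
  show "count_alive A c t \<le> card A" unfolding count_alive_def
    by (rule order_trans[OF sum_bounded_above[where K = 1]]) (auto simp: indicator_def)
qed

lemma jump_comp_upd:
  assumes "length v \<le> length u \<and> v \<noteq> u \<or> v = u \<and> l < k"
  shows "jump_comp \<phi> t t' (c((u, k) := x)) v l = jump_comp \<phi> t t' c v l"
proof -
  have born: "born (c((u, k) := x)) v = born c v" by (rule born_upd) (use assms in auto)
  have disp: "disp (c((u, k) := x)) v l = disp c v l" using assms by (auto simp: disp_def)
  have "jump_age (c((u, k) := x)) v l = jump_age c v l \<and> jump_age (c((u, k) := x)) v (Suc l) = jump_age c v (Suc l) \<and>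
      site (c((u, k) := x)) v p l = site c v p l" for p
  proof (cases "v = u")
    case True
    then show ?thesis using assms by (simp add: marks_upd_later del: fun_upd_apply)
  next
    case False
    then show ?thesis by (simp add: marks_upd del: fun_upd_apply)
  qed
  then show ?thesis unfolding jump_comp_def jump_time_def born disp by simp
qed

lemma ring_comp_upd:
  fixes c :: "'d::finite config" and b :: real and u :: "nat list" and n :: nat
  defines "c' \<equiv> upd_ring c u n b"
  assumes "length v \<le> length u \<and> v \<noteq> u \<or> v = u \<and> l < n" and g: "good c" "good c'"
  shows "ring_comp g t t' c' v l = ring_comp g t t' c v l"
proof -
  have born: "born c' v = born c v" unfolding c'_def by (rule born_upd) (use assms in auto)
  have "ring_window g t t' c' v = ring_window g t t' c v"
    unfolding fun_eq_iff ring_window_def born unfolding c'_def marks_upd_b by simp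
  moreover have "ring_op c' v l = ring_op c v l \<and> ring_op c' v (Suc l) = ring_op c v (Suc l)"
  proof (cases "v = u")
    case True
    then show ?thesis using assms(2) unfolding c'_def by (simp add: marks_upd_later del: fun_upd_apply)
  next
    case False
    then show ?thesis unfolding c'_def by (simp add: marks_upd del: fun_upd_apply)
  qed
  ultimately show ?thesis using g by (simp add: ring_comp_def)
qed

end

text \<open>A weight \<open>W\<close> with values in \<open>[0, 1]\<close> that is a function of the population at time \<open>t\<close>, and a window
  \<open>(t, t']\<close> of length at most \<open>1\<close> and at most \<open>1 / (4 * lam0)\<close>. The second bound makes the compensator of the
  births from one particle in the window at most \<open>1 / 2\<close>.\<close>

locale alive_weight = catalytic_rates +
  fixes w :: "nat list set \<Rightarrow> real" and t t' :: real
    and W :: "'d::finite config \<Rightarrow> real"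
  defines "W \<equiv> \<lambda>c. w (alive_at c t)"
  assumes W_meas [measurable]: "W \<in> borel_measurable conf_law"
    and w: "\<And>A. 0 \<le> w A" "\<And>A. w A \<le> 1"
    and t: "0 \<le> t" "t \<le> t'" "t' - t \<le> 1" "4 * lam0 * (t' - t) \<le> 1"
begin

sublocale prob_space "conf_law :: 'd config measure" by (rule prob_space_conf_law)

lemma W_bounds: "0 \<le> W c" "W c \<le> 1" "\<bar>W c\<bar> \<le> 1" "\<bar>(W c)\<^sup>2\<bar> \<le> 1" "0 \<le> (W c)\<^sup>2"
  using w[of "alive_at c t"] by (auto simp: W_def abs_le_iff power_le_one)

lemma integrable_bounded:
  fixes f :: "'d config \<Rightarrow> real"
  shows "f \<in> borel_measurable conf_law \<Longrightarrow> (\<And>c. \<bar>f c\<bar> \<le> B) \<Longrightarrow> integrable conf_law f"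
  by (rule integrable_const_bound[where B = B]) auto

lemma weighted_jump_mean_zero:
  assumes H [measurable]: "H \<in> borel_measurable conf_law" and HC: "\<And>c. \<bar>H c\<bar> \<le> C"
    and K: "\<And>p e. \<bar>\<phi> p e\<bar> \<le> K"
    and inv: "\<And>c x. H (c((u, k) := x)) = H c"
  shows "(\<integral>c. ((W c)\<^sup>2 * H c) * jump_comp \<phi> t t' c u k \<partial>conf_law) = 0"
proof (rule jump_comp_mean_zero[where Q = good and C = "1 * C" and K = K])
  show "\<bar>(W c)\<^sup>2 * H c\<bar> \<le> 1 * C" for c
    unfolding abs_mult by (intro mult_mono W_bounds HC) auto
  show "AE c in conf_law. good c" by (rule AE_good)
  fix c :: "'d config" and j s
  assume "good c" "good (upd_jump c u k j s)"
    "t < jump_time c u (Suc k)" "t < jump_time (upd_jump c u k j s) u (Suc k)"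
  from alive_at_local_jump[OF this]
  show "(W (upd_jump c u k j s))\<^sup>2 * H (upd_jump c u k j s) =
      (W c)\<^sup>2 * H c" unfolding W_def inv by simp
qed (use K t good_upd in auto)

lemma weighted_ring_mean_zero:
  assumes H [measurable]: "H \<in> borel_measurable conf_law" and HC: "\<And>c. \<bar>H c\<bar> \<le> C"
    and K: "\<And>p. \<bar>g p\<bar> \<le> K"
    and inv: "\<And>c b. good c \<Longrightarrow> good (upd_ring c u n b) \<Longrightarrow>
      H (upd_ring c u n b) = H c"
  shows "(\<integral>c. ((W c)\<^sup>2 * H c) * ring_comp g t t' c u n \<partial>conf_law) = 0"
proof (rule ring_comp_mean_zero[where C = "1 * C" and K = K])
  show "\<bar>(W c)\<^sup>2 * H c\<bar> \<le> 1 * C" for c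
    unfolding abs_mult by (intro mult_mono W_bounds HC) auto
  fix c :: "'d config" and b
  assume a: "good c" "good (upd_ring c u n b)"
    "t < fst (born c (n # u))" "t < fst (born (upd_ring c u n b) (n # u))"
  from alive_at_local_ring[OF this] inv[OF a(1,2)]
  show "(W (upd_ring c u n b))\<^sup>2 * H (upd_ring c u n b) =
      (W c)\<^sup>2 * H c" unfolding W_def by simp
qed (use K t in auto)

text \<open>Of two different compensated terms of the same kind, one does not involve the mark of the other: a particle
  is not affected by the marks of labels that are at least as long as its own, and its own later marks do not
  affect its earlier events.\<close>

lemma label_pair_cases:
  fixes u v :: "nat list"
  assumes "(u, k) \<noteq> (v, l)"
  obtains "length v \<le> length u \<and> v \<noteq> u \<or> v = u \<and> l < (k::nat)" |
    "length u \<le> length v \<and> u \<noteq> v \<or> u = v \<and> k < l"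
  using assms by (metis linorder_cases nat_le_linear)

lemma jump_comp_bound: "(\<And>p e. \<bar>\<phi> p e\<bar> \<le> K) \<Longrightarrow> \<bar>jump_comp \<phi> t t' c u k\<bar> \<le> 2 * K"
proof -
  assume K: "\<And>p e. \<bar>\<phi> p e\<bar> \<le> K"
  then have "0 \<le> K" using abs_ge_zero order_trans by blast
  then have "K * (t' - t) \<le> K * 1" using t by (intro mult_left_mono) auto
  with abs_jump_comp_le[where \<phi> = \<phi>, OF t(2) K, of c u k] show ?thesis by simp
qed

lemma ring_comp_bound: "(\<And>p. \<bar>g p\<bar> \<le> K) \<Longrightarrow> \<bar>ring_comp g t t' c u k\<bar> \<le> 2 * K"
proof -
  assume K: "\<And>p. \<bar>g p\<bar> \<le> K"
  then have "0 \<le> K" using abs_ge_zero order_trans by blast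
  then have "K * (2 * lam0 * (t' - t)) \<le> K * 1" using t by (intro mult_left_mono) auto
  with abs_ring_comp_le[where g = g, OF t(2) K, of c u k] show ?thesis by simp
qed

lemma jump_orthogonal:
  assumes K: "\<And>p e. \<bar>\<phi> p e\<bar> \<le> K" and "i \<noteq> j"
  shows "(\<integral>c. (W c * jump_comp \<phi> t t' c (fst i) (snd i)) * (W c * jump_comp \<phi> t t' c (fst j) (snd j)) \<partial>conf_law) = 0"
proof -
  obtain u k where i: "i = (u, k)" by (cases i)
  obtain v l where j: "j = (v, l)" by (cases j)
  have *: "(\<integral>c. (W c)\<^sup>2 * jump_comp \<phi> t t' c v l * jump_comp \<phi> t t' c u k \<partial>conf_law) = 0"
    if "length v \<le> length u \<and> v \<noteq> u \<or> v = u \<and> l < k" for u v k l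
    by (rule weighted_jump_mean_zero[where C = "2 * K" and K = K])
      (use K that in \<open>auto intro!: jump_comp_bound jump_comp_upd simp del: fun_upd_apply\<close>)
  from assms(2) have "(u, k) \<noteq> (v, l)" by (simp add: i j)
  then show ?thesis
    by (rule label_pair_cases) (use *[of v u l k] *[of u v k l] in \<open>simp_all add: i j power2_eq_square mult_ac\<close>)
qed

lemma ring_orthogonal:
  assumes K: "\<And>p. \<bar>g p\<bar> \<le> K" and "i \<noteq> j"
  shows "(\<integral>c. (W c * ring_comp g t t' c (fst i) (snd i)) * (W c * ring_comp g t t' c (fst j) (snd j)) \<partial>conf_law) = 0"
proof -
  obtain u k where i: "i = (u, k)" by (cases i)
  obtain v l where j: "j = (v, l)" by (cases j)
  have *: "(\<integral>c. (W c)\<^sup>2 * ring_comp g t t' c v l * ring_comp g t t' c u k \<partial>conf_law) = 0"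
    if "length v \<le> length u \<and> v \<noteq> u \<or> v = u \<and> l < k" for u v k l
    by (rule weighted_ring_mean_zero[where C = "2 * K" and K = K])
      (use K that in \<open>auto intro!: ring_comp_bound ring_comp_upd simp del: fun_upd_apply\<close>)
  from assms(2) have "(u, k) \<noteq> (v, l)" by (simp add: i j)
  then show ?thesis
    by (rule label_pair_cases) (use *[of v u l k] *[of u v k l] in \<open>simp_all add: i j power2_eq_square mult_ac\<close>)
qed

text \<open>The common part of the two second moment estimates: \<open>X i\<close> are the compensated terms, \<open>L i\<close> their
  compensators for the counting of events, and \<open>Y i\<close> the compensated indicators of the events, so that
  \<open>Y i + 2 * L i\<close> is the indicator plus the compensator.\<close>

lemma second_moment_bound:
  fixes X Y L :: "'i \<Rightarrow> 'd config \<Rightarrow> real" and Z :: "'d config \<Rightarrow> real"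
  assumes F: "finite F"
    and [measurable]: "\<And>i. X i \<in> borel_measurable conf_law" "\<And>i. Y i \<in> borel_measurable conf_law"
      "\<And>i. L i \<in> borel_measurable conf_law" "Z \<in> borel_measurable conf_law"
    and B: "\<And>i c. \<bar>X i c\<bar> \<le> B" "\<And>i c. \<bar>Y i c\<bar> \<le> B" "\<And>i c. \<bar>L i c\<bar> \<le> B" "\<And>c. \<bar>Z c\<bar> \<le> B"
    and orth: "\<And>i j. i \<noteq> j \<Longrightarrow> (\<integral>c. (W c * X i c) * (W c * X j c) \<partial>conf_law) = 0"
    and Y: "\<And>i. (\<integral>c. (W c)\<^sup>2 * Y i c \<partial>conf_law) = 0"
    and X_le: "AE c in conf_law. \<forall>i\<in>F. (X i c)\<^sup>2 \<le> 2 * K\<^sup>2 * (Y i c + 2 * L i c)"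
    and Z: "AE c in conf_law. (\<Sum>i\<in>F. L i c) \<le> Z c"
  shows "(\<integral>c. (W c * (\<Sum>i\<in>F. X i c))\<^sup>2 \<partial>conf_law) \<le> 4 * K\<^sup>2 * (\<integral>c. (W c)\<^sup>2 * Z c \<partial>conf_law)"
proof -
  have B0: "0 \<le> B" using B(4)[of undefined] by linarith
  have int: "integrable conf_law (\<lambda>c. (W c)\<^sup>2 * f c)"
    if [measurable]: "f \<in> borel_measurable conf_law" and "\<And>c. \<bar>f c\<bar> \<le> B" for f :: "'d config \<Rightarrow> real"
  proof (rule integrable_bounded[where B = "1 * B"])
    show "\<bar>(W c)\<^sup>2 * f c\<bar> \<le> 1 * B" for c
      unfolding abs_mult by (intro mult_mono W_bounds that) auto
  qed measurable
  note ints = int[OF _ B(2)] int[OF _ B(3)] int[OF _ B(4)]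
  have "(\<integral>c. (W c * (\<Sum>i\<in>F. X i c))\<^sup>2 \<partial>conf_law) = (\<integral>c. (\<Sum>i\<in>F. W c * X i c)\<^sup>2 \<partial>conf_law)"
    by (simp add: sum_distrib_left)
  also have "\<dots> = (\<Sum>i\<in>F. \<integral>c. (W c * X i c)\<^sup>2 \<partial>conf_law)"
  proof (rule integral_sum_square_orthogonal[where K = "1 * B"])
    show "\<bar>W c * X i c\<bar> \<le> 1 * B" for i c
      unfolding abs_mult by (intro mult_mono W_bounds B) auto
  qed (use F orth in measurable)
  also have "\<dots> \<le> (\<Sum>i\<in>F. 4 * K\<^sup>2 * (\<integral>c. (W c)\<^sup>2 * L i c \<partial>conf_law))"
  proof (rule sum_mono)
    fix i assume "i \<in> F"
    have "(\<integral>c. (W c * X i c)\<^sup>2 \<partial>conf_law) \<le>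
        (\<integral>c. 2 * K\<^sup>2 * ((W c)\<^sup>2 * Y i c) + 4 * K\<^sup>2 * ((W c)\<^sup>2 * L i c) \<partial>conf_law)"
    proof (rule integral_mono_AE)
      show "integrable conf_law (\<lambda>c. (W c * X i c)\<^sup>2)"
      proof (rule integrable_bounded[where B = "(1 * B)\<^sup>2"])
        show "\<bar>(W c * X i c)\<^sup>2\<bar> \<le> (1 * B)\<^sup>2" for c
          unfolding abs_power2 by (rule power2_le_iff_abs_le[THEN iffD2])
            (use B0 in \<open>auto simp: abs_mult intro!: mult_mono[of _ 1 _ B, simplified] W_bounds B\<close>)
      qed measurable
      show "AE c in conf_law. (W c * X i c)\<^sup>2 \<le>
          2 * K\<^sup>2 * ((W c)\<^sup>2 * Y i c) + 4 * K\<^sup>2 * ((W c)\<^sup>2 * L i c)"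
        using X_le
      proof eventually_elim
        case (elim c)
        then have "(W c)\<^sup>2 * (X i c)\<^sup>2 \<le> (W c)\<^sup>2 * (2 * K\<^sup>2 * (Y i c + 2 * L i c))"
          using \<open>i \<in> F\<close> by (intro mult_left_mono W_bounds) auto
        then show ?case by (simp add: power_mult_distrib algebra_simps)
      qed
    qed (intro Bochner_Integration.integrable_add integrable_mult_right ints; measurable)
    also have "\<dots> = 4 * K\<^sup>2 * (\<integral>c. (W c)\<^sup>2 * L i c \<partial>conf_law)"
    proof -
      have "integrable conf_law (\<lambda>c. (W c)\<^sup>2 * Y i c)" "integrable conf_law (\<lambda>c. (W c)\<^sup>2 * L i c)"
        by (rule ints, measurable)+
      then show ?thesis by (simp add: Y)
    qed
    finally show "(\<integral>c. (W c * X i c)\<^sup>2 \<partial>conf_law) \<le> 4 * K\<^sup>2 * (\<integral>c. (W c)\<^sup>2 * L i c \<partial>conf_law)" .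
  qed
  also have "\<dots> = 4 * K\<^sup>2 * (\<integral>c. (\<Sum>i\<in>F. (W c)\<^sup>2 * L i c) \<partial>conf_law)"
  proof -
    have "integrable conf_law (\<lambda>c. (W c)\<^sup>2 * L i c)" for i by (rule ints) measurable
    then show ?thesis by (simp add: sum_distrib_left)
  qed
  also have "\<dots> \<le> 4 * K\<^sup>2 * (\<integral>c. (W c)\<^sup>2 * Z c \<partial>conf_law)"
  proof (intro mult_left_mono integral_mono_AE)
    show "AE c in conf_law. (\<Sum>i\<in>F. (W c)\<^sup>2 * L i c) \<le> (W c)\<^sup>2 * Z c"
      using Z by eventually_elim (simp add: W_bounds mult_left_mono flip: sum_distrib_left)
    show "integrable conf_law (\<lambda>c. \<Sum>i\<in>F. (W c)\<^sup>2 * L i c)"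
      by (intro Bochner_Integration.integrable_sum ints) measurable
    show "integrable conf_law (\<lambda>c. (W c)\<^sup>2 * Z c)" by (rule ints) measurable
  qed simp
  finally show ?thesis .
qed

lemma square_bound:
  fixes x i l K :: real
  assumes "\<bar>x\<bar> \<le> K * (i + l)" "0 \<le> i" "i \<le> 1" "0 \<le> l" "l \<le> 1"
  shows "x\<^sup>2 \<le> 2 * K\<^sup>2 * (i + l)"
proof -
  have "x\<^sup>2 \<le> (K * (i + l))\<^sup>2" using assms(1) by (metis abs_le_square_iff abs_ge_self order_trans)
  also have "\<dots> = K\<^sup>2 * ((i + l) * (i + l))" by (simp add: power2_eq_square)
  also have "\<dots> \<le> K\<^sup>2 * (2 * (i + l))" using assms by (intro mult_left_mono mult_right_mono) auto
  finally show ?thesis by (simp add: algebra_simps)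
qed

lemma jump_second_moment:
  assumes A: "finite A" and K: "\<And>p e. \<bar>\<phi> p e\<bar> \<le> K"
  shows "(\<integral>c. (W c * (\<Sum>i\<in>A \<times> {..<m}. jump_comp \<phi> t t' c (fst i) (snd i)))\<^sup>2 \<partial>conf_law) \<le>
    4 * K\<^sup>2 * (\<integral>c. (W c)\<^sup>2 * count_alive A c t' \<partial>conf_law)"
proof (rule second_moment_bound)
  define L :: "nat list \<times> nat \<Rightarrow> 'd config \<Rightarrow> real"
    where "L i c = clip t t' (jump_time c (fst i) (Suc (snd i))) - clip t t' (jump_time c (fst i) (snd i))" for i c
  define Y :: "nat list \<times> nat \<Rightarrow> 'd config \<Rightarrow> real"
    where "Y i c = jump_comp (\<lambda>_ _. 1) t t' c (fst i) (snd i)" for i c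
  define B where "B = 2 * K + 2 + real (card A)"
  have K0: "0 \<le> K" using K abs_ge_zero order_trans by blast
  show "finite (A \<times> {..<m})" using A by simp
  show "\<And>i. (\<lambda>c. jump_comp \<phi> t t' c (fst i) (snd i)) \<in> borel_measurable conf_law"
    "\<And>i. Y i \<in> borel_measurable conf_law" "\<And>i. L i \<in> borel_measurable conf_law"
    "(\<lambda>c. count_alive A c t') \<in> borel_measurable conf_law"
    unfolding Y_def L_def by measurable
  show "\<bar>jump_comp \<phi> t t' c (fst i) (snd i)\<bar> \<le> B" for i c
    by (rule order_trans[OF jump_comp_bound[OF K]]) (simp add: B_def)
  show "\<bar>Y i c\<bar> \<le> B" for i c
    unfolding Y_def by (rule order_trans[OF jump_comp_bound[where K = 1]]) (auto simp: B_def K0)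
  have L1: "\<bar>L i c\<bar> \<le> 1" for i c
    unfolding L_def using clip_bounds[OF t(2)] t by (smt (verit))
  then show "\<bar>L i c\<bar> \<le> B" for i c
    by (rule order_trans) (use K0 in \<open>simp add: B_def\<close>)
  show "\<bar>count_alive A c t'\<bar> \<le> B" for c
    using count_alive_bounds[of A c t'] K0 by (simp add: B_def)
  show "(\<integral>c. (W c * jump_comp \<phi> t t' c (fst i) (snd i)) * (W c * jump_comp \<phi> t t' c (fst j) (snd j)) \<partial>conf_law) = 0"
    if "i \<noteq> j" for i j by (rule jump_orthogonal[OF K that])
  show "(\<integral>c. (W c)\<^sup>2 * Y i c \<partial>conf_law) = 0" for i
    using weighted_jump_mean_zero[of "\<lambda>_. 1" 1 "\<lambda>_ _. 1" 1] by (simp add: Y_def)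
  show "AE c in conf_law. \<forall>i\<in>A \<times> {..<m}. (jump_comp \<phi> t t' c (fst i) (snd i))\<^sup>2 \<le> 2 * K\<^sup>2 * (Y i c + 2 * L i c)"
    using AE_good
  proof (eventually_elim, intro ballI)
    fix c :: "'d config" and i :: "nat list \<times> nat" assume g: "good c"
    obtain u k where i: "i = (u, k)" by (cases i)
    let ?p = "site c u (snd (born c u)) k"
    have L0: "0 \<le> L i c"
      using monoD[OF mono_jump_age[OF g], of k "Suc k" u] by (auto simp: L_def i jump_time_def intro!: clip_mono)
    have "\<bar>jump_comp \<phi> t t' c u k\<bar> \<le>
        \<bar>indicator {t<..t'} (jump_time c u (Suc k)) * \<phi> ?p (disp c u k)\<bar> + \<bar>step_mean \<phi> ?p * L i c\<bar>"
      unfolding jump_comp_def L_def i fst_conv snd_conv by (rule abs_triangle_ineq4)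
    also have "\<dots> \<le> indicator {t<..t'} (jump_time c u (Suc k)) * K + K * L i c"
      unfolding abs_mult by (intro add_mono mult_mono abs_step_mean_le K) (use L0 K0 in auto)
    finally have "\<bar>jump_comp \<phi> t t' c u k\<bar> \<le> K * (indicator {t<..t'} (jump_time c u (Suc k)) + L i c)"
      by (simp add: algebra_simps)
    from square_bound[OF this] L0 L1[of i c]
    have "(jump_comp \<phi> t t' c u k)\<^sup>2 \<le> 2 * K\<^sup>2 * (indicator {t<..t'} (jump_time c u (Suc k)) + L i c)"
      by (simp add: indicator_def)
    also have "indicator {t<..t'} (jump_time c u (Suc k)) + L i c = Y i c + 2 * L i c"
      by (simp add: Y_def jump_comp_def L_def i step_mean_def)
    finally show "(jump_comp \<phi> t t' c (fst i) (snd i))\<^sup>2 \<le> 2 * K\<^sup>2 * (Y i c + 2 * L i c)" by (simp add: i)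
  qed
  show "AE c in conf_law. (\<Sum>i\<in>A \<times> {..<m}. L i c) \<le> count_alive A c t'"
    using AE_good
  proof eventually_elim
    case (elim c)
    have "(\<Sum>i\<in>A \<times> {..<m}. L i c) = (\<Sum>u\<in>A. \<Sum>k<m. L (u, k) c)"
      by (simp add: sum.cartesian_product)
    also have "\<dots> = (\<Sum>u\<in>A. clip t t' (jump_time c u m) - clip t t' (jump_time c u 0))"
      unfolding L_def fst_conv snd_conv by (intro sum.cong refl sum_lessThan_telescope)
    also have "\<dots> \<le> count_alive A c t'" unfolding count_alive_def
    proof (rule sum_mono)
      fix u
      have "jump_time c u 0 \<le> jump_time c u m" using jump_age_nonneg[OF elim, of u m] by (simp add: jump_time_def)
      then show "clip t t' (jump_time c u m) - clip t t' (jump_time c u 0) \<le> indicator {..t'} (fst (born c u))"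
        using t by (auto simp: clip_def jump_time_def indicator_def)
    qed
    finally show ?case .
  qed
qed

text \<open>The compensator of the counting of the \<open>n\<close>-th ring, that is, the part of its operational waiting time that falls
  into the window; \<open>0\<close> on configurations that are not good.\<close>

definition ring_length :: "'d config \<Rightarrow> nat list \<Rightarrow> nat \<Rightarrow> real" where
  "ring_length c u n = (if good c then
     op_integral (ring_window (\<lambda>_. 1) t t' c u) (ring_op c u n) (ring_op c u (Suc n)) else 0)"

lemma measurable_ring_length [measurable]: "(\<lambda>c. ring_length c u n) \<in> borel_measurable conf_law"
  unfolding ring_length_def by measurable

lemma ring_length_bounds: "0 \<le> ring_length c u n" "ring_length c u n \<le> 1"
proof -
  have "op_integral (ring_window (\<lambda>_. 1) t t' c u) x y \<le> 1" if "good c" for x y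
    using op_integral_ring_window_1(2)[OF that t(2), of u x y] t(4) by (cases "fst (born c u) \<le> t'") auto
  then show "0 \<le> ring_length c u n" "ring_length c u n \<le> 1"
    using op_integral_ring_window_1(1)[OF _ t(2)] by (auto simp: ring_length_def)
qed

lemma sum_ring_length_le:
  assumes "good c" "finite A"
  shows "(\<Sum>i\<in>A \<times> {..<m}. ring_length c (fst i) (snd i)) \<le> count_alive A c t' / 2"
proof -
  have "(\<Sum>i\<in>A \<times> {..<m}. ring_length c (fst i) (snd i)) = (\<Sum>u\<in>A. \<Sum>n<m. ring_length c u n)"
    by (simp add: sum.cartesian_product split_beta)
  also have "\<dots> = (\<Sum>u\<in>A. op_integral (ring_window (\<lambda>_. 1) t t' c u) (ring_op c u 0) (ring_op c u m))"
    unfolding ring_length_def using assms(1) t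
    by (simp add: op_integral_sum[OF integrable_ring_window[of c t t' "\<lambda>_. 1" 1] mono_ring_op] del: ring_op_0)
  also have "\<dots> \<le> (\<Sum>u\<in>A. indicator {..t'} (fst (born c u)) / 2)"
  proof (rule sum_mono)
    fix u
    have "2 * lam0 * (t' - t) * indicator {..t'} (fst (born c u)) \<le> indicator {..t'} (fst (born c u)) / 2"
      using t(4) by (auto simp: indicator_def)
    then show "op_integral (ring_window (\<lambda>_. 1) t t' c u) (ring_op c u 0) (ring_op c u m) \<le> indicator {..t'} (fst (born c u)) / 2"
      using op_integral_ring_window_1(2)[OF assms(1) t(2), of u "ring_op c u 0" "ring_op c u m"] by linarith
  qed
  finally show ?thesis by (simp add: count_alive_def sum_divide_distrib)
qed

lemma ring_second_moment:
  assumes A: "finite A" and K: "\<And>p. \<bar>g p\<bar> \<le> K"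
  shows "(\<integral>c. (W c * (\<Sum>i\<in>A \<times> {..<m}. ring_comp g t t' c (fst i) (snd i)))\<^sup>2 \<partial>conf_law) \<le>
    4 * K\<^sup>2 * (\<integral>c. (W c)\<^sup>2 * count_alive A c t' \<partial>conf_law)"
proof (rule second_moment_bound)
  define L :: "nat list \<times> nat \<Rightarrow> 'd config \<Rightarrow> real" where "L i c = ring_length c (fst i) (snd i)" for i c
  define Y :: "nat list \<times> nat \<Rightarrow> 'd config \<Rightarrow> real"
    where "Y i c = ring_comp (\<lambda>_. 1) t t' c (fst i) (snd i)" for i c
  define B where "B = 2 * K + 2 + real (card A)"
  have K0: "0 \<le> K" using K abs_ge_zero order_trans by blast
  show "finite (A \<times> {..<m})" using A by simp
  show "\<And>i. (\<lambda>c. ring_comp g t t' c (fst i) (snd i)) \<in> borel_measurable conf_law"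
    "\<And>i. Y i \<in> borel_measurable conf_law" "\<And>i. L i \<in> borel_measurable conf_law"
    "(\<lambda>c. count_alive A c t') \<in> borel_measurable conf_law"
    unfolding Y_def L_def by measurable
  show "\<bar>ring_comp g t t' c (fst i) (snd i)\<bar> \<le> B" for i c
    by (rule order_trans[OF ring_comp_bound[OF K]]) (simp add: B_def)
  show "\<bar>Y i c\<bar> \<le> B" for i c
    unfolding Y_def by (rule order_trans[OF ring_comp_bound[where K = 1]]) (auto simp: B_def K0)
  show "\<bar>L i c\<bar> \<le> B" for i c
    using ring_length_bounds[of c "fst i" "snd i"] K0 by (simp add: B_def L_def)
  show "\<bar>count_alive A c t'\<bar> \<le> B" for c
    using count_alive_bounds[of A c t'] K0 by (simp add: B_def)
  show "(\<integral>c. (W c * ring_comp g t t' c (fst i) (snd i)) * (W c * ring_comp g t t' c (fst j) (snd j)) \<partial>conf_law) = 0"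
    if "i \<noteq> j" for i j by (rule ring_orthogonal[OF K that])
  show "(\<integral>c. (W c)\<^sup>2 * Y i c \<partial>conf_law) = 0" for i
    using weighted_ring_mean_zero[of "\<lambda>_. 1" 1 "\<lambda>_. 1" 1] by (simp add: Y_def)
  show "AE c in conf_law. \<forall>i\<in>A \<times> {..<m}. (ring_comp g t t' c (fst i) (snd i))\<^sup>2 \<le> 2 * K\<^sup>2 * (Y i c + 2 * L i c)"
    using AE_good
  proof (eventually_elim, intro ballI)
    fix c :: "'d config" and i :: "nat list \<times> nat" assume g: "good c"
    obtain u k where i: "i = (u, k)" by (cases i)
    let ?r = "ring_window (\<lambda>_. 1) t t' c u (ring_op c u (Suc k))"
    have "\<bar>ring_comp g t t' c u k\<bar> \<le> \<bar>ring_window g t t' c u (ring_op c u (Suc k))\<bar> +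
        \<bar>op_integral (ring_window g t t' c u) (ring_op c u k) (ring_op c u (Suc k))\<bar>"
      unfolding ring_comp_def using g by (simp add: abs_triangle_ineq4)
    also have "\<dots> \<le> K * ?r + K * L i c"
      unfolding L_def ring_length_def i using g
      by (simp, intro add_mono abs_ring_window_le abs_op_integral_ring_window_le K t) auto
    finally have "\<bar>ring_comp g t t' c u k\<bar> \<le> K * (?r + L i c)" by (simp add: algebra_simps)
    then have "(ring_comp g t t' c u k)\<^sup>2 \<le> 2 * K\<^sup>2 * (?r + L i c)"
      by (rule square_bound) (simp_all add: ring_window_1_bounds L_def ring_length_bounds)
    also have "?r + L i c = Y i c + 2 * L i c"
      using g by (simp add: Y_def ring_comp_def L_def ring_length_def i)
    finally show "(ring_comp g t t' c (fst i) (snd i))\<^sup>2 \<le> 2 * K\<^sup>2 * (Y i c + 2 * L i c)" by (simp add: i)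
  qed
  show "AE c in conf_law. (\<Sum>i\<in>A \<times> {..<m}. L i c) \<le> count_alive A c t'"
    using AE_good
  proof eventually_elim
    case (elim c)
    show ?case unfolding L_def
      using sum_ring_length_le[OF elim A, of m] count_alive_bounds(1)[of A c t'] by linarith
  qed
qed

text \<open>On a short time interval the expected weighted number of particles at most doubles.\<close>

lemma weighted_growth:
  "(\<integral>c. (W c)\<^sup>2 * count_alive (labels m) c t' \<partial>conf_law) \<le>
    2 * (\<integral>c. (W c)\<^sup>2 * count_alive (labels m) c t \<partial>conf_law)"
proof -
  let ?F = "labels m \<times> {..<m}"
  let ?Y = "\<lambda>i c. ring_comp (\<lambda>_. 1) t t' (c :: 'd config) (fst i) (snd i)"
  have int: "integrable conf_law (\<lambda>c. (W c)\<^sup>2 * count_alive (labels m) c s)" for s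
  proof (rule integrable_bounded[where B = "1 * real (card (labels m))"])
    show "\<bar>(W c)\<^sup>2 * count_alive (labels m) c s\<bar> \<le> 1 * real (card (labels m))" for c
      unfolding abs_mult by (intro mult_mono W_bounds) (use count_alive_bounds[of "labels m" c s] in auto)
  qed measurable
  have intY: "integrable conf_law (\<lambda>c. (W c)\<^sup>2 * ?Y i c)" for i
  proof (rule integrable_bounded[where B = "1 * (2 * 1)"])
    show "\<bar>(W c)\<^sup>2 * ?Y i c\<bar> \<le> 1 * (2 * 1)" for c
      unfolding abs_mult by (intro mult_mono W_bounds ring_comp_bound) auto
  qed measurable
  have "(\<integral>c. (W c)\<^sup>2 * count_alive (labels m) c t' \<partial>conf_law) \<le>
      (\<integral>c. (W c)\<^sup>2 * count_alive (labels m) c t + (\<Sum>i\<in>?F. (W c)\<^sup>2 * ?Y i c) +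
        (W c)\<^sup>2 * count_alive (labels m) c t' / 2 \<partial>conf_law)"
  proof (rule integral_mono_AE)
    show "AE c in conf_law. (W c)\<^sup>2 * count_alive (labels m) c t' \<le>
       (W c)\<^sup>2 * count_alive (labels m) c t + (\<Sum>i\<in>?F. (W c)\<^sup>2 * ?Y i c) + (W c)\<^sup>2 * count_alive (labels m) c t' / 2"
      using AE_good
    proof eventually_elim
      case (elim c)
      define f :: "nat list \<Rightarrow> real" where "f v = indicator {t<..t'} (fst (born c v))" for v
      have "count_alive (labels m) c t' = count_alive (labels m) c t + (\<Sum>v\<in>labels m. f v)"
        unfolding count_alive_def sum.distrib[symmetric] f_def
        by (intro sum.cong refl) (use t in \<open>auto simp: indicator_def\<close>)
      also have "(\<Sum>v\<in>labels m. f v) = (\<Sum>v\<in>labels m - {[]}. f v)"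
        by (intro sum.mono_neutral_right) (use t in \<open>auto simp: f_def\<close>)
      also have "\<dots> = (\<Sum>i\<in>(\<lambda>v. (tl v, hd v)) ` (labels m - {[]}). f (snd i # fst i))"
        by (subst sum.reindex) (auto simp: inj_on_def intro: list.expand)
      also have "\<dots> \<le> (\<Sum>i\<in>?F. f (snd i # fst i))"
      proof (rule sum_mono2)
        show "(\<lambda>v. (tl v, hd v)) ` (labels m - {[]}) \<subseteq> ?F"
        proof
          fix i assume "i \<in> (\<lambda>v. (tl v, hd v)) ` (labels m - {[]})"
          then obtain v where "v \<in> labels m" "v \<noteq> []" "i = (tl v, hd v)" by auto
          then show "i \<in> ?F" using labels_Cons[of "hd v" "tl v" m] by simp
        qed
      qed (auto simp: f_def)
      also have "\<dots> = (\<Sum>i\<in>?F. ?Y i c + ring_length c (fst i) (snd i))"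
      proof (intro sum.cong refl)
        fix i
        have "0 < ring_op c (fst i) (Suc (snd i))"
          using good_wait_b[OF elim] ring_op_nonneg[OF elim] by (simp add: ring_op_Suc add_nonneg_pos)
        then show "f (snd i # fst i) = ?Y i c + ring_length c (fst i) (snd i)"
          using elim by (auto simp: f_def ring_comp_def ring_length_def ring_window_def indicator_def)
      qed
      also have "\<dots> \<le> (\<Sum>i\<in>?F. ?Y i c) + count_alive (labels m) c t' / 2"
        using sum_ring_length_le[OF elim finite_labels, of m m] by (simp add: sum.distrib)
      finally have "count_alive (labels m) c t' \<le>
          count_alive (labels m) c t + (\<Sum>i\<in>?F. ?Y i c) + count_alive (labels m) c t' / 2" by simp
      from mult_left_mono[OF this W_bounds(5), of c]
      show ?case by (simp add: algebra_simps sum_distrib_left)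
    qed
  qed (intro int intY Bochner_Integration.integrable_add Bochner_Integration.integrable_sum
       Bochner_Integration.integrable_divide)+
  also have "\<dots> = (\<integral>c. (W c)\<^sup>2 * count_alive (labels m) c t \<partial>conf_law) +
      (\<Sum>i\<in>?F. \<integral>c. (W c)\<^sup>2 * ?Y i c \<partial>conf_law) + (\<integral>c. (W c)\<^sup>2 * count_alive (labels m) c t' \<partial>conf_law) / 2"
    using int intY by (simp add: Bochner_Integration.integrable_sum)
  also have "(\<Sum>i\<in>?F. \<integral>c. (W c)\<^sup>2 * ?Y i c \<partial>conf_law) = 0"
    using weighted_ring_mean_zero[of "\<lambda>_. 1" 1 "\<lambda>_. 1" 1] by (intro sum.neutral) simp
  finally show ?thesis by simp
qed

end

section \<open>Finite populations and the mean square limit\<close>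

lemma abs_square_le_square: "\<bar>x\<bar> \<le> B \<Longrightarrow> \<bar>x\<^sup>2\<bar> \<le> B\<^sup>2" for x B :: real
  using abs_le_square_iff[of x B] by simp

lemma (in catalytic_rates) abs_count_alive_le: "\<bar>count_alive A c t\<bar> \<le> card A"
  using count_alive_bounds[of A c t] by simp

lemma (in alive_weight) weighted_sum_bound:
  assumes "\<And>i. \<bar>f i\<bar> \<le> B"
  shows "\<bar>W c * (\<Sum>i\<in>F. f i)\<bar> \<le> real (card F) * B"
proof -
  have "\<bar>\<Sum>i\<in>F. f i\<bar> \<le> (\<Sum>i\<in>F. \<bar>f i\<bar>)" by (rule sum_abs)
  also have "\<dots> \<le> of_nat (card F) * B" by (rule sum_bounded_above) (rule assms)
  finally have "\<bar>W c\<bar> * \<bar>\<Sum>i\<in>F. f i\<bar> \<le> 1 * (of_nat (card F) * B)"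
    by (intro mult_mono W_bounds) auto
  then show ?thesis by (simp add: abs_mult)
qed

lemma (in alive_weight) weighted_L2_bound:
  assumes K: "\<And>p. \<bar>g p\<bar> \<le> K"
  shows "(\<integral>c. (W c * (\<Sum>i\<in>labels m \<times> {..<m}. jump_comp (\<lambda>p e. g (p + e) - g p) t t' c (fst i) (snd i) +
      ring_comp g t t' c (fst i) (snd i)))\<^sup>2 \<partial>conf_law) \<le>
    80 * K\<^sup>2 * (\<integral>c. (W c)\<^sup>2 * count_alive (labels m) c t \<partial>conf_law)"
proof -
  let ?F = "labels m \<times> {..<m}"
  define a where "a c = W c * (\<Sum>i\<in>?F. jump_comp (\<lambda>p e. g (p + e) - g p) t t' c (fst i) (snd i))"
    for c :: "'d config"
  define b where "b c = W c * (\<Sum>i\<in>?F. ring_comp g t t' c (fst i) (snd i))" for c :: "'d config"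
  define E where "E = (\<integral>c. (W c)\<^sup>2 * count_alive (labels m) c t' \<partial>conf_law)"
  have [measurable]: "a \<in> borel_measurable conf_law" "b \<in> borel_measurable conf_law"
    unfolding a_def b_def by measurable
  have K2: "\<bar>g (p + e) - g p\<bar> \<le> 2 * K" for p e using K[of p] K[of "p + e"] by linarith
  have int: "integrable conf_law (\<lambda>c. (f c)\<^sup>2)" if [measurable]: "f \<in> borel_measurable conf_law"
    and B: "\<And>c. \<bar>f c\<bar> \<le> B" for f :: "'d config \<Rightarrow> real" and B
    by (rule integrable_bounded[OF _ abs_square_le_square[OF B]]) measurable
  have a: "\<bar>a c\<bar> \<le> real (card ?F) * (2 * (2 * K))" for c
    unfolding a_def by (rule weighted_sum_bound[OF jump_comp_bound[OF K2]])
  have b: "\<bar>b c\<bar> \<le> real (card ?F) * (2 * K)" for c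
    unfolding b_def by (rule weighted_sum_bound[OF ring_comp_bound[OF K]])
  have int_ab: "integrable conf_law (\<lambda>c. (a c)\<^sup>2)" "integrable conf_law (\<lambda>c. (b c)\<^sup>2)"
    by (rule int[OF _ a] int[OF _ b], measurable)+
  have int_sum: "integrable conf_law (\<lambda>c. (a c + b c)\<^sup>2)"
    by (rule int[OF _ order_trans[OF abs_triangle_ineq add_mono[OF a b]]]) measurable
  have "(\<integral>c. (W c * (\<Sum>i\<in>?F. jump_comp (\<lambda>p e. g (p + e) - g p) t t' c (fst i) (snd i) +
      ring_comp g t t' c (fst i) (snd i)))\<^sup>2 \<partial>conf_law) = (\<integral>c. (a c + b c)\<^sup>2 \<partial>conf_law)"
    unfolding a_def b_def sum.distrib distrib_left ..
  also have "\<dots> \<le> (\<integral>c. 2 * (a c)\<^sup>2 + 2 * (b c)\<^sup>2 \<partial>conf_law)"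
  proof (rule integral_mono)
    show "(a c + b c)\<^sup>2 \<le> 2 * (a c)\<^sup>2 + 2 * (b c)\<^sup>2" for c
      using sum_squares_bound[of "a c" "b c"] by (simp add: power2_sum)
  qed (use int_ab int_sum in simp_all)
  also have "\<dots> = 2 * (\<integral>c. (a c)\<^sup>2 \<partial>conf_law) + 2 * (\<integral>c. (b c)\<^sup>2 \<partial>conf_law)"
    using int_ab by simp
  also have "\<dots> \<le> 2 * (4 * (2 * K)\<^sup>2 * E) + 2 * (4 * K\<^sup>2 * E)"
  proof (intro add_mono mult_left_mono)
    show "(\<integral>c. (a c)\<^sup>2 \<partial>conf_law) \<le> 4 * (2 * K)\<^sup>2 * E"
      unfolding a_def E_def by (rule jump_second_moment[OF finite_labels K2])
    show "(\<integral>c. (b c)\<^sup>2 \<partial>conf_law) \<le> 4 * K\<^sup>2 * E"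
      unfolding b_def E_def by (rule ring_second_moment[OF finite_labels K])
  qed simp_all
  also have "\<dots> = 40 * K\<^sup>2 * E" by (simp add: power_mult_distrib)
  also have "\<dots> \<le> 40 * K\<^sup>2 * (2 * (\<integral>c. (W c)\<^sup>2 * count_alive (labels m) c t \<partial>conf_law))"
    unfolding E_def by (rule mult_left_mono[OF weighted_growth]) simp
  finally show ?thesis by simp
qed

context catalytic_rates begin

text \<open>The length of the time step, which satisfies the requirements on the windows.\<close>

definition step :: real where "step = min 1 (1 / (4 * lam0))"

lemma step: "0 < step" "step \<le> 1" "4 * lam0 * step \<le> 1"
proof -
  show "0 < step" "step \<le> 1" using lam0_pos by (auto simp: step_def)
  have "4 * lam0 * step \<le> 4 * lam0 * (1 / (4 * lam0))"
    using lam0_pos by (intro mult_left_mono) (auto simp: step_def)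
  then show "4 * lam0 * step \<le> 1" using lam0_pos by simp
qed

lemma alive_at_0:
  assumes "good c" shows "alive_at c 0 = {[]}"
proof -
  have "0 < fst (born c (n # u))" for n u
  proof -
    have "0 < ring_op c u (Suc n)"
      using good_wait_b[OF assms] ring_op_nonneg[OF assms] by (simp add: ring_op_Suc add_nonneg_pos)
    then have r: "0 < ring_op c u (Suc n) / lam0" "0 \<le> ring_op c u (Suc n)" using lam0_pos by simp_all
    with age_slope[OF assms order_refl r(2), of u "snd (born c u)"]
      age_nonneg[OF assms order_refl, of u "snd (born c u)"]
    have "0 < age c u (snd (born c u)) (ring_op c u (Suc n))" by simp
    then show ?thesis using born_nonneg[OF assms, of u] by simp
  qed
  then have "u \<notin> alive_at c 0" if "u \<noteq> []" for u
    using that by (cases u) (simp_all add: alive_at_def not_le del: born.simps)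
  moreover have "[] \<in> alive_at c 0" by (simp add: alive_at_def)
  ultimately show ?thesis by blast
qed

lemma alive_at_mono: "s \<le> t \<Longrightarrow> alive_at c s \<subseteq> alive_at c t"
  by (auto simp: alive_at_def)

lemma expected_count_le: "(\<integral>c. count_alive (labels m) (c :: 'd::finite config) (real n * step) \<partial>conf_law) \<le> 2 ^ n"
proof (induction n)
  case 0
  interpret prob_space "conf_law :: 'd config measure" by (rule prob_space_conf_law)
  show ?case
  proof (simp, rule integral_le_const)
    show "integrable conf_law (\<lambda>c :: 'd config. count_alive (labels m) c 0)"
      by (rule integrable_const_bound[where B = "card (labels m)"]) (auto intro!: AE_I2 abs_count_alive_le)
    show "AE c :: 'd config in conf_law. count_alive (labels m) c 0 \<le> 1"
      using AE_good
    proof eventually_elim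
      case (elim c)
      have "card (labels m \<inter> {[]}) \<le> card {[] :: nat list}" by (rule card_mono) auto
      then show ?case by (simp add: count_alive_eq_card alive_at_0[OF elim])
    qed
  qed
next
  case (Suc n)
  interpret alive_weight lam0 lam "\<lambda>_. 1" "real n * step" "real (Suc n) * step" "\<lambda>_ :: 'd config. 1"
    by unfold_locales (use step lam0_pos in \<open>auto simp: algebra_simps\<close>)
  from weighted_growth[of m] Suc show ?case by simp
qed

text \<open>No explosion: with the weight \<open>1\<close>, the expected number of living particles with labels in a finite set
  at most doubles in each step, uniformly in the set.\<close>

lemma AE_finite_alive: "AE c :: 'd::finite config in conf_law. \<forall>t. finite (alive_at c t)"
proof -
  interpret prob_space "conf_law :: 'd config measure" by (rule prob_space_conf_law)
  have "AE c :: 'd config in conf_law. finite (alive_at c (real n * step))" for n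
  proof -
    let ?f = "\<lambda>m (c :: 'd config). ennreal (count_alive (labels m) c (real n * step))"
    have "incseq ?f"
      by (intro incseq_SucI le_funI ennreal_leI)
        (auto simp: count_alive_eq_card intro!: card_mono dest: subsetD[OF labels_mono[OF le_SucI[OF order_refl]]])
    have "(\<integral>\<^sup>+c. ?f m c \<partial>conf_law) \<le> ennreal (2 ^ n)" for m
    proof -
      have "(\<integral>\<^sup>+c. ?f m c \<partial>conf_law) = ennreal (\<integral>c. count_alive (labels m) (c :: 'd config) (real n * step) \<partial>conf_law)"
        by (rule nn_integral_eq_integral)
          (auto intro!: AE_I2 abs_count_alive_le count_alive_bounds integrable_const_bound[where B = "card (labels m)"])
      also have "\<dots> \<le> ennreal (2 ^ n)" by (intro ennreal_leI expected_count_le)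
      finally show ?thesis .
    qed
    then have "(\<integral>\<^sup>+c. (SUP m. ?f m c) \<partial>conf_law) \<le> ennreal (2 ^ n)"
      by (subst nn_integral_monotone_convergence_SUP[OF \<open>incseq ?f\<close>]) (auto intro: SUP_least)
    then have "(\<integral>\<^sup>+c. (SUP m. ?f m c) \<partial>conf_law) \<noteq> \<infinity>"
      by (auto simp: top_unique)
    then have "AE c in conf_law. (SUP m. ?f m c) \<noteq> \<infinity>"
      by (intro nn_integral_PInf_AE) measurable
    then show ?thesis
    proof eventually_elim
      case (elim c)
      then obtain r where r: "0 \<le> r" "(SUP m. ?f m c) = ennreal r" by (cases "SUP m. ?f m c") auto
      have le: "count_alive (labels m) c (real n * step) \<le> r" for m
      proof -
        have "?f m c \<le> ennreal r" unfolding r(2)[symmetric] by (rule SUP_upper) simp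
        then show ?thesis using r(1) by (simp add: ennreal_le_iff)
      qed
      show ?case
      proof (rule ccontr)
        assume "infinite (alive_at c (real n * step))"
        obtain N :: nat where N: "r < N" using reals_Archimedean2 by blast
        obtain T where T: "finite T" "card T = N" "T \<subseteq> alive_at c (real n * step)"
          using infinite_arbitrarily_large[OF \<open>infinite _\<close>, of N] by blast
        obtain m where "T \<subseteq> labels m" using labels_exhaust[OF T(1)] by blast
        then have "card T \<le> card (labels m \<inter> alive_at c (real n * step))"
          using T by (intro card_mono) auto
        then show False using le[of m] N T(2) by (simp add: count_alive_eq_card)
      qed
    qed
  qed
  then have "AE c :: 'd config in conf_law. \<forall>n. finite (alive_at c (real n * step))"
    by (simp add: AE_all_countable)
  then show ?thesis
  proof eventually_elim
    case (elim c)
    show ?case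
    proof
      fix t
      obtain n :: nat where "t \<le> real n * step" using ex_less_of_nat_mult[OF step(1), of t] by (auto intro: less_imp_le)
      then show "finite (alive_at c t)" using elim finite_subset[OF alive_at_mono] by blast
    qed
  qed
qed

end

text \<open>The estimate passes to all labels and clock indices by Fatou's lemma.\<close>

lemma (in alive_weight) L2_limit_bound:
  fixes X :: "'d config \<Rightarrow> real"
  assumes K: "\<And>p. \<bar>g p\<bar> \<le> K" and [measurable]: "X \<in> borel_measurable conf_law"
    and lim: "AE c in conf_law. (\<lambda>m. W c * (\<Sum>i\<in>labels m \<times> {..<m}.
        jump_comp (\<lambda>p e. g (p + e) - g p) t t' c (fst i) (snd i) + ring_comp g t t' c (fst i) (snd i)))
      \<longlonglongrightarrow> X c"
    and W: "\<And>c m. (W c)\<^sup>2 * count_alive (labels m) c t \<le> W c"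
  shows "integrable conf_law (\<lambda>c. (X c)\<^sup>2)" "(\<integral>c. (X c)\<^sup>2 \<partial>conf_law) \<le> 80 * K\<^sup>2 * (\<integral>c. W c \<partial>conf_law)"
proof -
  let ?X = "\<lambda>m c. W c * (\<Sum>i\<in>labels m \<times> {..<m}.
        jump_comp (\<lambda>p e. g (p + e) - g p) t t' c (fst i) (snd i) + ring_comp g t t' c (fst i) (snd i))"
  let ?B = "80 * K\<^sup>2 * (\<integral>c. W c \<partial>conf_law)"
  have K2: "\<bar>g (p + e) - g p\<bar> \<le> 2 * K" for p e using K[of p] K[of "p + e"] by linarith
  have intW: "integrable conf_law W" by (rule integrable_bounded[OF W_meas W_bounds(3)])
  have m: "(\<integral>\<^sup>+c. ennreal ((?X m c)\<^sup>2) \<partial>conf_law) \<le> ennreal ?B" for m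
  proof -
    have "(\<integral>\<^sup>+c. ennreal ((?X m c)\<^sup>2) \<partial>conf_law) = ennreal (\<integral>c. (?X m c)\<^sup>2 \<partial>conf_law)"
    proof (rule nn_integral_eq_integral)
      let ?C = "real (card (labels m \<times> {..<m})) * (2 * (2 * K) + 2 * K)"
      have "\<bar>jump_comp (\<lambda>p e. g (p + e) - g p) t t' c u k + ring_comp g t t' c u k\<bar> \<le> 2 * (2 * K) + 2 * K" for c u k
        by (rule order_trans[OF abs_triangle_ineq add_mono[OF jump_comp_bound[OF K2] ring_comp_bound[OF K]]])
      then have "\<bar>?X m c\<bar> \<le> ?C" for c by (rule weighted_sum_bound)
      then have "\<bar>(?X m c)\<^sup>2\<bar> \<le> ?C\<^sup>2" for c by (rule abs_square_le_square)
      then show "integrable conf_law (\<lambda>c. (?X m c)\<^sup>2)"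
        by (intro integrable_bounded[where B = "?C\<^sup>2"]) measurable
    qed simp
    also have "(\<integral>c. (?X m c)\<^sup>2 \<partial>conf_law) \<le> 80 * K\<^sup>2 * (\<integral>c. (W c)\<^sup>2 * count_alive (labels m) c t \<partial>conf_law)"
      by (rule weighted_L2_bound[OF K])
    also have "\<dots> \<le> ?B"
    proof (intro mult_left_mono integral_mono)
      show "integrable conf_law (\<lambda>c. (W c)\<^sup>2 * count_alive (labels m) c t)"
      proof (rule integrable_bounded[where B = 1])
        show "\<bar>(W c)\<^sup>2 * count_alive (labels m) c t\<bar> \<le> 1" for c
          using order_trans[OF W[of c m] W_bounds(2)] count_alive_bounds(1)[of "labels m" c t]
          by (simp add: abs_mult)
      qed measurable
      show "integrable conf_law W" by (rule intW)
      show "(W c)\<^sup>2 * count_alive (labels m) c t \<le> W c" for c by (rule W)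
    qed simp
    finally show ?thesis by (simp add: ennreal_leI)
  qed
  have "(\<integral>\<^sup>+c. ennreal ((X c)\<^sup>2) \<partial>conf_law) = (\<integral>\<^sup>+c. liminf (\<lambda>m. ennreal ((?X m c)\<^sup>2)) \<partial>conf_law)"
  proof (rule nn_integral_cong_AE)
    show "AE c in conf_law. ennreal ((X c)\<^sup>2) = liminf (\<lambda>m. ennreal ((?X m c)\<^sup>2))"
      using lim
    proof eventually_elim
      case (elim c)
      then have "(\<lambda>m. ennreal ((?X m c)\<^sup>2)) \<longlonglongrightarrow> ennreal ((X c)\<^sup>2)"
        by (intro tendsto_ennrealI tendsto_power)
      then show ?case by (rule lim_imp_Liminf[OF sequentially_bot, symmetric])
    qed
  qed
  also have "\<dots> \<le> liminf (\<lambda>m. \<integral>\<^sup>+c. ennreal ((?X m c)\<^sup>2) \<partial>conf_law)"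
    by (rule nn_integral_liminf) measurable
  also have "\<dots> \<le> ennreal ?B"
  proof -
    have "liminf (\<lambda>m. \<integral>\<^sup>+c. ennreal ((?X m c)\<^sup>2) \<partial>conf_law) \<le> liminf (\<lambda>_ :: nat. ennreal ?B)"
      by (rule Liminf_mono) (rule always_eventually, rule allI, rule m)
    then show ?thesis by (simp add: Liminf_const)
  qed
  finally have le: "(\<integral>\<^sup>+c. ennreal ((X c)\<^sup>2) \<partial>conf_law) \<le> ennreal ?B" .
  show int: "integrable conf_law (\<lambda>c. (X c)\<^sup>2)"
  proof (rule integrableI_nonneg)
    show "(\<integral>\<^sup>+c. ennreal ((X c)\<^sup>2) \<partial>conf_law) < \<infinity>" using le by (rule le_less_trans) simp
  qed simp_all
  have "0 \<le> (\<integral>c. W c \<partial>conf_law)" by (rule Bochner_Integration.integral_nonneg) (rule W_bounds(1))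
  then have B0: "0 \<le> ?B" by simp
  have nn: "(\<integral>\<^sup>+c. ennreal ((X c)\<^sup>2) \<partial>conf_law) = ennreal (\<integral>c. (X c)\<^sup>2 \<partial>conf_law)"
    by (rule nn_integral_eq_integral[OF int]) simp
  show "(\<integral>c. (X c)\<^sup>2 \<partial>conf_law) \<le> ?B"
    using le unfolding nn by (rule ennreal_le_iff[OF B0, THEN iffD1])
qed

section \<open>Decomposition of the increments of the occupation measure\<close>

lemma clip_shift: "0 < a \<Longrightarrow> clip (b + a * s) (b + a * s') (b + a * x) = b + a * clip s s' x"
  unfolding clip_def by (auto simp: max_def min_def)

lemma has_integral_indicator_atLeast:
  assumes "t \<le> t'"
  shows "(indicator {x..} has_integral (t' - clip t t' x)) {t..t'}"
proof -
  have "((\<lambda>_. 1 :: real) has_integral measure lborel {max t x..t'} *\<^sub>R 1) {max t x..t'}"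
    by (rule has_integral_const_real)
  also have "measure lborel {max t x..t'} *\<^sub>R 1 = t' - clip t t' x"
    using assms by (auto simp: clip_def max_def min_def)
  finally have "((\<lambda>s. if s \<in> {max t x..t'} then 1 else 0 :: real) has_integral (t' - clip t t' x)) {t..t'}"
    by (subst has_integral_restrict) auto
  then show ?thesis
    by (rule has_integral_eq[rotated]) (auto simp: indicator_def)
qed

lemma sum_Abel:
  fixes e f :: "nat \<Rightarrow> real"
  shows "(\<Sum>k<m. (e k - e (Suc k)) * f k) = e 0 * f 0 + (\<Sum>k<m. e (Suc k) * (f (Suc k) - f k)) - e m * f m"
  by (induction m) (simp_all add: algebra_simps)

context catalytic_rates begin

text \<open>The position of \<open>u\<close> at time \<open>s\<close>, meaningful only after the birth of \<open>u\<close>.\<close>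

definition pos :: "'d::finite config \<Rightarrow> nat list \<Rightarrow> real \<Rightarrow> int ^ 'd" where
  "pos c u s = site c u (snd (born c u)) (LEAST k. s < jump_time c u (Suc k))"

text \<open>The integral of \<open>f\<close> with respect to the occupation measure at time \<open>s\<close>.\<close>

definition occ :: "'d::finite config \<Rightarrow> real \<Rightarrow> (int ^ 'd \<Rightarrow> real) \<Rightarrow> real" where
  "occ c s f = (\<Sum>u\<in>alive_at c s. f (pos c u s))"

text \<open>The generator of the mean dynamics: the random walk and the branching.\<close>

definition gen :: "(int ^ 'd::finite \<Rightarrow> real) \<Rightarrow> int ^ 'd \<Rightarrow> real" where
  "gen g p = step_mean (\<lambda>p e. g (p + e) - g p) p + rate p * g p"

text \<open>The contribution of the particle \<open>u\<close> to \<open>occ c s f\<close>.\<close>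

definition contrib :: "(int ^ 'd::finite \<Rightarrow> real) \<Rightarrow> 'd config \<Rightarrow> nat list \<Rightarrow> real \<Rightarrow> real" where
  "contrib f c u s = indicator (alive_at c s) u * f (pos c u s)"

lemma jump_time_0: "jump_time c u 0 = fst (born c u)"
  by (simp add: jump_time_def)
lemma mono_jump_time: "good c \<Longrightarrow> mono (jump_time c u)"
  using mono_jump_age[of c u] by (auto simp: jump_time_def mono_def)

lemma jump_time_at_top: "good c \<Longrightarrow> filterlim (jump_time c u) at_top sequentially"
  unfolding jump_time_def
  by (rule filterlim_tendsto_add_at_top[OF tendsto_const good_jump_age])

lemma contrib_eq:
  assumes g: "good c" and s: "s < jump_time c u m"
  shows "contrib f c u s = (\<Sum>k<m. (indicator {jump_time c u k..} s - indicator {jump_time c u (Suc k)..} s) *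
    f (site c u (snd (born c u)) k))"
proof (cases "u \<in> alive_at c s")
  case True
  define \<kappa> where "\<kappa> = (LEAST k. s < jump_time c u (Suc k))"
  have \<kappa>: "jump_time c u \<kappa> \<le> s" "s < jump_time c u (Suc \<kappa>)"
    unfolding \<kappa>_def using Least_interval[OF jump_time_at_top[OF g], of u s] True
    by (simp_all add: jump_time_0 alive_at_def)
  have "\<kappa> < m"
  proof (rule ccontr)
    assume "\<not> \<kappa> < m"
    then have "jump_time c u m \<le> jump_time c u \<kappa>" by (intro monoD[OF mono_jump_time[OF g]]) simp
    with \<kappa>(1) s show False by simp
  qed
  have "indicator {jump_time c u k..} s - indicator {jump_time c u (Suc k)..} s = (if k = \<kappa> then 1 else 0 :: real)" for k
  proof (cases "k = \<kappa>")
    case True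
    then show ?thesis using \<kappa> by (simp add: indicator_def)
  next
    case False
    have le: "jump_time c u k \<le> jump_time c u (Suc k)" by (rule monoD[OF mono_jump_time[OF g]]) simp
    have "\<not> (jump_time c u k \<le> s \<and> s < jump_time c u (Suc k))"
      using Least_interval_eq[OF mono_jump_time[OF g], of u k s] False unfolding \<kappa>_def by blast
    then show ?thesis using False le by (cases "jump_time c u k \<le> s") (simp_all add: indicator_def)
  qed
  then have "(\<Sum>k<m. (indicator {jump_time c u k..} s - indicator {jump_time c u (Suc k)..} s) *
      f (site c u (snd (born c u)) k)) = (\<Sum>k<m. if k = \<kappa> then f (site c u (snd (born c u)) k) else 0)"
    by (intro sum.cong refl) simp
  then show ?thesis using True \<open>\<kappa> < m\<close> by (simp add: contrib_def pos_def \<kappa>_def)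
next
  case False
  have "s < jump_time c u k" for k
    using False monoD[OF mono_jump_time[OF g], of 0 k u] by (simp add: jump_time_0 alive_at_def)
  then have "indicator {jump_time c u k..} s = (0 :: real)" for k by (simp add: not_le)
  then show ?thesis using False by (simp add: contrib_def)
qed

lemma occ_eq_sum_contrib:
  assumes "finite A" "alive_at c s \<subseteq> A"
  shows "occ c s f = (\<Sum>u\<in>A. contrib f c u s)"
  unfolding occ_def contrib_def using assms
  by (intro sum.mono_neutral_cong_left) (auto simp: indicator_def)

lemma contrib_has_integral:
  assumes g: "good c" and t: "t \<le> t'" "t' < jump_time c u m"
  shows "(contrib f c u has_integral (\<Sum>k<m. f (site c u (snd (born c u)) k) *
    (clip t t' (jump_time c u (Suc k)) - clip t t' (jump_time c u k)))) {t..t'}"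
proof (rule has_integral_eq)
  let ?P = "site c u (snd (born c u))" and ?T = "jump_time c u"
  show "(\<Sum>k<m. (indicator {?T k..} s - indicator {?T (Suc k)..} s) * f (?P k)) = contrib f c u s"
    if "s \<in> {t..t'}" for s using that t by (intro contrib_eq[symmetric] g) auto
  have "((\<lambda>s. (indicator {?T k..} s - indicator {?T (Suc k)..} s) * f (?P k)) has_integral
      ((t' - clip t t' (?T k)) - (t' - clip t t' (?T (Suc k)))) * f (?P k)) {t..t'}" for k
    by (intro has_integral_mult_left has_integral_diff has_integral_indicator_atLeast t)
  then have "((\<lambda>s. \<Sum>k<m. (indicator {?T k..} s - indicator {?T (Suc k)..} s) * f (?P k)) has_integral
      (\<Sum>k<m. ((t' - clip t t' (?T k)) - (t' - clip t t' (?T (Suc k)))) * f (?P k))) {t..t'}"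
    by (intro has_integral_sum) auto
  then show "((\<lambda>s. \<Sum>k<m. (indicator {?T k..} s - indicator {?T (Suc k)..} s) * f (?P k)) has_integral
      (\<Sum>k<m. f (?P k) * (clip t t' (?T (Suc k)) - clip t t' (?T k)))) {t..t'}"
    by (simp add: mult.commute)
qed

lemma sum_jump_comp:
  assumes g: "good c" and t: "t \<le> t'" "t' < jump_time c u m"
  shows "(\<Sum>k<m. jump_comp (\<lambda>p e. f (p + e) - f p) t t' c u k) =
    contrib f c u t' - contrib f c u t - indicator {t<..t'} (fst (born c u)) * f (snd (born c u)) -
    (\<Sum>k<m. step_mean (\<lambda>p e. f (p + e) - f p) (site c u (snd (born c u)) k) *
      (clip t t' (jump_time c u (Suc k)) - clip t t' (jump_time c u k)))"
proof -
  let ?P = "site c u (snd (born c u))" and ?T = "jump_time c u"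
  let ?e = "\<lambda>s k. indicator {?T k..} s :: real"
  have e: "indicator {t<..t'} (?T k) = ?e t' k - ?e t k" for k
    using t by (auto simp: indicator_def)
  have "contrib f c u s = ?e s 0 * f (?P 0) + (\<Sum>k<m. ?e s (Suc k) * (f (?P (Suc k)) - f (?P k)))" if "s \<le> t'" for s
  proof -
    have "contrib f c u s = (\<Sum>k<m. (?e s k - ?e s (Suc k)) * f (?P k))"
      by (rule contrib_eq[OF g le_less_trans[OF that t(2)]])
    also have "\<dots> = ?e s 0 * f (?P 0) + (\<Sum>k<m. ?e s (Suc k) * (f (?P (Suc k)) - f (?P k))) - ?e s m * f (?P m)"
      by (rule sum_Abel)
    also have "?e s m = 0" using that t by simp
    finally show ?thesis by (simp only: mult_zero_left diff_zero)
  qed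
  from this[of t'] this[OF t(1)]
  have "contrib f c u t' - contrib f c u t =
      (?e t' 0 - ?e t 0) * f (?P 0) + (\<Sum>k<m. (?e t' (Suc k) - ?e t (Suc k)) * (f (?P (Suc k)) - f (?P k)))"
    by (simp add: left_diff_distrib sum_subtractf)
  then show ?thesis unfolding jump_comp_def e[symmetric]
    by (simp add: sum_subtractf site_Suc jump_time_0)
qed

text \<open>The total compensator of the rings of \<open>u\<close>, written in real time.\<close>

lemma ring_window_integral:
  assumes g: "good c" and t: "t \<le> t'" "t' < jump_time c u m" and K: "\<And>p. \<bar>f p\<bar> \<le> K"
    and R: "\<And>r. R < r \<Longrightarrow> ring_window f t t' c u r = 0"
  shows "op_integral (ring_window f t t' c u) 0 R =
    (\<Sum>k<m. rate (site c u (snd (born c u)) k) * f (site c u (snd (born c u)) k) *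
      (clip t t' (jump_time c u (Suc k)) - clip t t' (jump_time c u k)))"
proof -
  let ?P = "site c u (snd (born c u))" and ?T = "jump_time c u" and ?\<psi> = "ring_window f t t' c u"
  let ?a = "op_time c u (snd (born c u))"
  have int: "integrable lborel ?\<psi>" by (rule integrable_ring_window[OF g t(1) K])
  have zero: "?\<psi> r = 0" if "?a m < r" for r
  proof (cases "0 < r")
    case True
    define \<kappa> where "\<kappa> = segment c u (snd (born c u)) r"
    have "r < ?a (Suc \<kappa>)" unfolding \<kappa>_def by (rule segment_bounds) (use g True in auto)
    have "m \<le> \<kappa>"
    proof (rule ccontr)
      assume "\<not> m \<le> \<kappa>"
      then have "?a (Suc \<kappa>) \<le> ?a m" by (intro monoD[OF mono_op_time[OF g]]) simp
      with \<open>r < _\<close> that show False by simp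
    qed
    then have "jump_age c u m \<le> jump_age c u \<kappa>" by (rule monoD[OF mono_jump_age[OF g]])
    also have "\<dots> \<le> age c u (snd (born c u)) r" unfolding \<kappa>_def by (rule age_bounds) (use g True in auto)
    finally show ?thesis using t(2) by (simp add: ring_window_def jump_time_def)
  qed (simp add: ring_window_def)
  have "op_integral ?\<psi> 0 R = op_integral ?\<psi> 0 (?a m)"
    unfolding op_integral_def
  proof (intro Bochner_Integration.integral_cong refl)
    fix r show "indicator {0<..R} r * ?\<psi> r = indicator {0<..?a m} r * ?\<psi> r"
      using R[of r] zero[of r] by (auto simp: indicator_def not_le)
  qed
  also have "\<dots> = (\<Sum>k<m. op_integral ?\<psi> (?a k) (?a (Suc k)))"
    using op_integral_sum[OF int mono_op_time[OF g], of u "snd (born c u)" m] by simp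
  also have "\<dots> = (\<Sum>k<m. rate (?P k) * f (?P k) * (clip t t' (?T (Suc k)) - clip t t' (?T k)))"
  proof (intro sum.cong refl)
    fix k
    let ?r = "rate (?P k)"
    \<comment> \<open>the operational time as a function of the real time on segment \<open>k\<close>, extended to an affine function\<close>
    define \<alpha> where "\<alpha> s = ?a k + ?r * (s - ?T k)" for s
    have mono: "\<alpha> s \<le> \<alpha> s' \<longleftrightarrow> s \<le> s'" "\<alpha> s < \<alpha> s' \<longleftrightarrow> s < s'" for s s' by (simp_all add: \<alpha>_def)
    have ak: "?a k = \<alpha> (?T k)" "?a (Suc k) = \<alpha> (?T (Suc k))"
      by (simp_all add: \<alpha>_def op_time_Suc jump_time_def jump_age_Suc)
    have \<psi>: "?\<psi> r = indicator {\<alpha> t<..\<alpha> t'} r * f (?P k)" if "?a k < r" "r < ?a (Suc k)" for r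
    proof -
      have seg: "segment c u (snd (born c u)) r = k" by (rule segment_eq[OF g]) (use that in auto)
      define s where "s = fst (born c u) + age c u (snd (born c u)) r"
      have r: "r = \<alpha> s" by (simp add: s_def \<alpha>_def age_def seg jump_time_def)
      have "0 \<le> ?a k" using monoD[OF mono_op_time[OF g], of 0 k u] by simp
      then have "0 < r" using that by simp
      then show ?thesis unfolding ring_window_def s_def[symmetric]
        by (simp add: op_site_def seg indicator_def) (simp add: r mono)
    qed
    have "op_integral ?\<psi> (?a k) (?a (Suc k)) = (\<integral>r. indicator {?a k<..?a (Suc k)} r * indicator {\<alpha> t<..\<alpha> t'} r * f (?P k) \<partial>lborel)"
      unfolding op_integral_def
    proof (rule integral_cong_AE)
      show "(\<lambda>r. indicator {?a k<..?a (Suc k)} r * ?\<psi> r) \<in> borel_measurable lborel" using int by measurable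
      show "AE r in lborel. indicator {?a k<..?a (Suc k)} r * ?\<psi> r =
          indicator {?a k<..?a (Suc k)} r * indicator {\<alpha> t<..\<alpha> t'} r * f (?P k)"
        using AE_lborel_singleton[of "?a (Suc k)"]
        by eventually_elim (use \<psi> in \<open>auto simp: indicator_def\<close>)
    qed measurable
    also have "\<dots> = op_integral (indicator {\<alpha> t<..\<alpha> t'}) (?a k) (?a (Suc k)) * f (?P k)"
      by (simp add: op_integral_def)
    also have "op_integral (indicator {\<alpha> t<..\<alpha> t'}) (?a k) (?a (Suc k)) =
        clip (\<alpha> t) (\<alpha> t') (?a (Suc k)) - clip (\<alpha> t) (\<alpha> t') (?a k)"
      by (rule op_integral_indicator) (use monoD[OF mono_op_time[OF g], of k "Suc k"] t(1) in \<open>auto simp: mono\<close>)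
    also have "\<dots> = ?r * (clip t t' (?T (Suc k)) - clip t t' (?T k))"
    proof -
      have cl: "clip (\<alpha> t) (\<alpha> t') (\<alpha> x) = \<alpha> (clip t t' x)" for x
        using clip_shift[of ?r "?a k - ?r * ?T k" t t' x] by (simp add: \<alpha>_def algebra_simps)
      show ?thesis unfolding ak cl by (simp add: \<alpha>_def right_diff_distrib)
    qed
    finally show "op_integral ?\<psi> (?a k) (?a (Suc k)) = ?r * f (?P k) * (clip t t' (?T (Suc k)) - clip t t' (?T k))"
      by simp
  qed
  finally show ?thesis .
qed

lemma sum_ring_comp:
  assumes g: "good c" and t: "t \<le> t'" and K: "\<And>p. \<bar>f p\<bar> \<le> K"
  shows "(\<Sum>n<m. ring_comp f t t' c u n) =
    (\<Sum>n<m. indicator {t<..t'} (fst (born c (n # u))) * f (snd (born c (n # u)))) -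
    op_integral (ring_window f t t' c u) 0 (ring_op c u m)"
proof -
  have "ring_window f t t' c u (ring_op c u (Suc n)) = indicator {t<..t'} (fst (born c (n # u))) * f (snd (born c (n # u)))" for n
    using good_wait_b[OF g, of u n] ring_op_nonneg[OF g, of u n]
    by (auto simp: ring_window_def indicator_def ring_op_Suc)
  then show ?thesis
    using op_integral_sum[OF integrable_ring_window[where g = f and u = u, OF g t K] mono_ring_op[where u = u, OF g], of m]
    by (simp add: ring_comp_def g sum_subtractf)
qed

text \<open>Once finitely many particles and clock rings are taken into account, the compensated sums are the
  increments of the occupation measure corrected by the integrated generator.\<close>

lemma occ_decomposition:
  assumes g: "good c" and fin: "\<And>s. finite (alive_at c s)" and t: "0 \<le> t" "t \<le> t'" and K: "\<And>p. \<bar>f p\<bar> \<le> K"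
  shows "(\<lambda>s. occ c s h) integrable_on {t..t'}"
    and "eventually (\<lambda>m. (\<Sum>i\<in>labels m \<times> {..<m}. jump_comp (\<lambda>p e. f (p + e) - f p) t t' c (fst i) (snd i) +
        ring_comp f t t' c (fst i) (snd i)) =
      occ c t' f - occ c t f - integral {t..t'} (\<lambda>s. occ c s (gen f))) sequentially"
proof -
  have 1: "eventually (\<lambda>m. alive_at c t' \<subseteq> labels m) sequentially"
    using labels_exhaust[OF fin[of t']] labels_mono unfolding eventually_sequentially by blast
  have 2: "eventually (\<lambda>m. \<forall>u\<in>alive_at c t'. t' < jump_time c u m) sequentially"
    using jump_time_at_top[OF g] fin[of t'] by (intro eventually_ball_finite) (auto simp: filterlim_at_top_dense)
  have 3: "eventually (\<lambda>m. \<forall>u\<in>alive_at c t'. \<forall>n. m \<le> Suc n \<longrightarrow> n # u \<notin> alive_at c t') sequentially"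
  proof (intro eventually_ball_finite fin ballI)
    fix u
    have "finite {n. n # u \<in> alive_at c t'}"
      by (rule finite_subset[OF _ finite_imageI[OF fin[of t'], of hd]]) (force simp: image_iff)
    then obtain N where "\<And>n. n # u \<in> alive_at c t' \<Longrightarrow> n < N" using finite_nat_set_iff_bounded by auto
    then show "eventually (\<lambda>m. \<forall>n. m \<le> Suc n \<longrightarrow> n # u \<notin> alive_at c t') sequentially"
      unfolding eventually_sequentially by (intro exI[of _ "Suc N"]) fastforce
  qed
  have *: "((\<lambda>s. occ c s h) has_integral (\<Sum>u\<in>labels m. \<Sum>k<m. h (site c u (snd (born c u)) k) *
      (clip t t' (jump_time c u (Suc k)) - clip t t' (jump_time c u k)))) {t..t'}"
    if m: "alive_at c t' \<subseteq> labels m" "\<forall>u\<in>alive_at c t'. t' < jump_time c u m" for h m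
  proof (rule has_integral_eq)
    show "(\<Sum>u\<in>labels m. contrib h c u s) = occ c s h" if "s \<in> {t..t'}" for s
      using that m(1) alive_at_mono[of s t' c] by (intro occ_eq_sum_contrib[symmetric]) auto
    have "t' < jump_time c u m" for u
      using m(2) monoD[OF mono_jump_time[OF g], of 0 m u] by (cases "u \<in> alive_at c t'") (auto simp: alive_at_def jump_time_0)
    then show "((\<lambda>s. \<Sum>u\<in>labels m. contrib h c u s) has_integral (\<Sum>u\<in>labels m. \<Sum>k<m. h (site c u (snd (born c u)) k) *
      (clip t t' (jump_time c u (Suc k)) - clip t t' (jump_time c u k)))) {t..t'}"
      by (intro has_integral_sum contrib_has_integral g t) auto
  qed
  obtain m where "alive_at c t' \<subseteq> labels m" "\<forall>u\<in>alive_at c t'. t' < jump_time c u m"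
    using eventually_happens[OF eventually_conj[OF 1 2]] by auto
  from *[OF this] show "(\<lambda>s. occ c s h) integrable_on {t..t'}" by (rule has_integral_integrable)
  show "eventually (\<lambda>m. (\<Sum>i\<in>labels m \<times> {..<m}. jump_comp (\<lambda>p e. f (p + e) - f p) t t' c (fst i) (snd i) +
        ring_comp f t t' c (fst i) (snd i)) =
      occ c t' f - occ c t f - integral {t..t'} (\<lambda>s. occ c s (gen f))) sequentially"
    using 1 2 3 eventually_ge_at_top[of 1]
  proof eventually_elim
    case (elim m')
    define m where "m = m'"
    note m = elim[folded m_def]
    let ?P = "\<lambda>u. site c u (snd (born c u))"
    let ?l = "\<lambda>u k. clip t t' (jump_time c u (Suc k)) - clip t t' (jump_time c u k)"
    define F where "F v = indicator {t<..t'} (fst (born c v)) * f (snd (born c v))" for v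
    have T: "t' < jump_time c u m" for u
      using m(2) monoD[OF mono_jump_time[OF g], of 0 m u] by (cases "u \<in> alive_at c t'") (auto simp: alive_at_def jump_time_0)
    have R: "ring_window f t t' c u r = 0" if "ring_op c u m < r" for u r
    proof (cases "u \<in> alive_at c t'")
      case True
      obtain n where n: "m = Suc n" using m(4) by (cases m) auto
      with m(3) True have "n # u \<notin> alive_at c t'" by blast
      then have "t' < fst (born c u) + age c u (snd (born c u)) (ring_op c u m)"
        by (simp add: alive_at_def n)
      also have "age c u (snd (born c u)) (ring_op c u m) \<le> age c u (snd (born c u)) r"
        by (rule age_mono[OF g ring_op_nonneg[OF g]]) (use that in simp)
      finally show ?thesis by (simp add: ring_window_def)
    next
      case False
      have "0 < r" using that ring_op_nonneg[OF g, of u m] by linarith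
      with False age_nonneg[OF g, of r u "snd (born c u)"] show ?thesis
        by (auto simp: ring_window_def alive_at_def)
    qed
    have births: "(\<Sum>u\<in>labels m. \<Sum>n<m. F (n # u)) = (\<Sum>v\<in>labels m. F v)"
    proof -
      have zero: "F v = 0" if "v \<notin> alive_at c t'" for v
        using that by (simp add: F_def alive_at_def indicator_def)
      have F0: "F [] = 0" using t(1) by (simp add: F_def)
      have "(\<Sum>u\<in>labels m. \<Sum>n<m. F (n # u)) = (\<Sum>i\<in>labels m \<times> {..<m}. F (snd i # fst i))"
        by (simp add: sum.cartesian_product split_beta)
      also have "\<dots> = (\<Sum>v\<in>(\<lambda>i. snd i # fst i) ` (labels m \<times> {..<m}). F v)"
        by (subst sum.reindex) (auto simp: inj_on_def)
      also have "\<dots> = (\<Sum>v\<in>alive_at c t' - {[]}. F v)"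
      proof (rule sum.mono_neutral_right)
        show "alive_at c t' - {[]} \<subseteq> (\<lambda>i. snd i # fst i) ` (labels m \<times> {..<m})"
        proof
          fix v assume v: "v \<in> alive_at c t' - {[]}"
          then obtain n u where nu: "v = n # u" by (cases v) auto
          have "u \<in> labels m \<and> n < m" by (rule labels_Cons) (use v m(1) nu in auto)
          then show "v \<in> (\<lambda>i. snd i # fst i) ` (labels m \<times> {..<m})" unfolding nu by force
        qed
        show "\<forall>v\<in>(\<lambda>i. snd i # fst i) ` (labels m \<times> {..<m}) - (alive_at c t' - {[]}). F v = 0"
          using zero by auto
      qed simp
      also have "\<dots> = (\<Sum>v\<in>labels m. F v)"
      proof (rule sum.mono_neutral_left)
        show "\<forall>v\<in>labels m - (alive_at c t' - {[]}). F v = 0" using zero F0 by auto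
      qed (use m(1) in auto)
      finally show ?thesis .
    qed
    have "(\<Sum>i\<in>labels m \<times> {..<m}. jump_comp (\<lambda>p e. f (p + e) - f p) t t' c (fst i) (snd i) +
        ring_comp f t t' c (fst i) (snd i)) =
      (\<Sum>u\<in>labels m. (\<Sum>k<m. jump_comp (\<lambda>p e. f (p + e) - f p) t t' c u k) + (\<Sum>k<m. ring_comp f t t' c u k))"
      unfolding sum.distrib[symmetric] sum.cartesian_product
      by (rule sum.cong[OF refl]) (simp add: split_beta)
    also have "\<dots> = (\<Sum>u\<in>labels m. (contrib f c u t' - contrib f c u t) + ((\<Sum>n<m. F (n # u)) - F u) -
        (\<Sum>k<m. gen f (?P u k) * ?l u k))"
    proof (intro sum.cong refl)
      fix u
      have "(\<Sum>k<m. gen f (?P u k) * ?l u k) =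
          (\<Sum>k<m. step_mean (\<lambda>p e. f (p + e) - f p) (?P u k) * ?l u k) + (\<Sum>k<m. rate (?P u k) * f (?P u k) * ?l u k)"
        by (simp add: gen_def distrib_right sum.distrib)
      moreover have "op_integral (ring_window f t t' c u) 0 (ring_op c u m) = (\<Sum>k<m. rate (?P u k) * f (?P u k) * ?l u k)"
        by (rule ring_window_integral[OF g t(2) T K R])
      moreover have "(\<Sum>k<m. ring_comp f t t' c u k) =
          (\<Sum>n<m. F (n # u)) - op_integral (ring_window f t t' c u) 0 (ring_op c u m)"
        unfolding F_def by (rule sum_ring_comp[OF g t(2) K])
      moreover have "(\<Sum>k<m. jump_comp (\<lambda>p e. f (p + e) - f p) t t' c u k) =
          contrib f c u t' - contrib f c u t - F u - (\<Sum>k<m. step_mean (\<lambda>p e. f (p + e) - f p) (?P u k) * ?l u k)"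
        unfolding F_def by (rule sum_jump_comp[OF g t(2) T])
      ultimately show "(\<Sum>k<m. jump_comp (\<lambda>p e. f (p + e) - f p) t t' c u k) + (\<Sum>k<m. ring_comp f t t' c u k) =
          (contrib f c u t' - contrib f c u t) + ((\<Sum>n<m. F (n # u)) - F u) - (\<Sum>k<m. gen f (?P u k) * ?l u k)"
        by linarith
    qed
    also have "\<dots> = ((\<Sum>u\<in>labels m. contrib f c u t') - (\<Sum>u\<in>labels m. contrib f c u t)) +
        ((\<Sum>u\<in>labels m. \<Sum>n<m. F (n # u)) - (\<Sum>u\<in>labels m. F u)) -
        (\<Sum>u\<in>labels m. \<Sum>k<m. gen f (?P u k) * ?l u k)"
      by (simp only: sum.distrib sum_subtractf)
    also have "(\<Sum>u\<in>labels m. \<Sum>n<m. F (n # u)) - (\<Sum>u\<in>labels m. F u) = 0"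
      using births by (simp only: diff_self)
    also have "(\<Sum>u\<in>labels m. contrib f c u t') = occ c t' f"
      by (rule occ_eq_sum_contrib[symmetric, OF finite_labels m(1)])
    also have "(\<Sum>u\<in>labels m. contrib f c u t) = occ c t f"
      by (rule occ_eq_sum_contrib[symmetric, OF finite_labels order_trans[OF alive_at_mono[OF t(2)] m(1)]])
    also have "(\<Sum>u\<in>labels m. \<Sum>k<m. gen f (?P u k) * ?l u k) = integral {t..t'} (\<lambda>s. occ c s (gen f))"
      by (rule integral_unique[OF *[OF m(1,2)], symmetric])
    finally have "(\<Sum>i\<in>labels m \<times> {..<m}. jump_comp (\<lambda>p e. f (p + e) - f p) t t' c (fst i) (snd i) +
        ring_comp f t t' c (fst i) (snd i)) =
      occ c t' f - occ c t f - integral {t..t'} (\<lambda>s. occ c s (gen f))" by (simp only: add_0_right)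
    then show ?case by (simp only: m_def)
  qed
qed

end

section \<open>Stationarity of the limiting frequencies\<close>

lemma card_unit_steps_sum:
  fixes f :: "int ^ 'd::finite \<Rightarrow> real"
  shows "card (unit_steps :: (int ^ 'd) set) = 2 * CARD('d)"
    and "(\<Sum>e\<in>unit_steps. f e) = (\<Sum>i\<in>UNIV. f (axis i 1) + f (- axis i 1))"
proof -
  let ?a = "\<lambda>i :: 'd. axis i (1 :: int)"
  have inj: "inj ?a" "inj (\<lambda>i. - ?a i)" by (auto simp: inj_on_def axis_eq_axis)
  have "?a i \<noteq> - ?a j" for i j
  proof
    assume "?a i = - ?a j"
    then have "?a i $ i = (- ?a j) $ i" by simp
    then show False by (simp add: axis_def split: if_splits)
  qed
  then have disj: "range ?a \<inter> range (\<lambda>i. - ?a i) = {}" by blast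
  show "card (unit_steps :: (int ^ 'd) set) = 2 * CARD('d)"
    unfolding unit_steps_def by (subst card_Un_disjoint) (auto simp: disj card_image inj)
  show "(\<Sum>e\<in>unit_steps. f e) = (\<Sum>i\<in>UNIV. f (axis i 1) + f (- axis i 1))"
    unfolding unit_steps_def
    by (subst sum.union_disjoint) (auto simp: disj sum.reindex inj sum.distrib)
qed

lemma continuous_on_int_vec: "continuous_on UNIV (f :: int ^ 'd::finite \<Rightarrow> 'b::topological_space)"
proof -
  have "open {x :: int ^ 'd}" for x
  proof -
    have "\<exists>S. (\<forall>i. open (S i) \<and> x $ i \<in> S i) \<and> (\<forall>y. (\<forall>i. y $ i \<in> S i) \<longrightarrow> y \<in> {x})" for x :: "int ^ 'd"
      by (intro exI[of _ "\<lambda>i. {x $ i}"]) (auto simp: vec_eq_iff intro: Topological_Spaces.open_discrete)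
    then show ?thesis unfolding open_vec_def by simp
  qed
  then have "open A" for A :: "(int ^ 'd) set"
    using open_Union[of "(\<lambda>x. {x}) ` A"] by auto
  then show ?thesis by (simp add: continuous_on_open_vimage)
qed

lemma scale_measure_eq_density: "scale_measure r M = density M (\<lambda>_. r)"
  by (rule measure_eqI) (auto simp: emeasure_density nn_integral_cmult_indicator)

context catalytic_rates begin

lemma gen_diff_const:
  "gen (\<lambda>p. g p - a) p = gen g p - a * rate p"
  by (simp add: gen_def step_mean_def algebra_simps)

lemma gen_bounded:
  assumes "\<And>p. \<bar>g p\<bar> \<le> K" shows "\<bar>gen g p\<bar> \<le> 2 * K + lam0 * K"
proof -
  have K0: "0 \<le> K" using assms abs_ge_zero order_trans by blast
  have "\<bar>g (p + e) - g p\<bar> \<le> 2 * K" for p e using assms[of p] assms[of "p + e"] by linarith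
  then have "\<bar>step_mean (\<lambda>p e. g (p + e) - g p) p\<bar> \<le> 2 * K" by (rule abs_step_mean_le)
  moreover have "\<bar>rate p * g p\<bar> \<le> lam0 * K"
    unfolding abs_mult by (intro mult_mono) (use rate_le[of p] lam0_pos assms in auto)
  ultimately show ?thesis unfolding gen_def by linarith
qed

lemma integral_gen_indicator:
  fixes \<nu> :: "(int ^ 'd::finite) measure"
  assumes "prob_space \<nu>" and [simp]: "sets \<nu> = UNIV"
  shows "(\<integral>p. gen (\<lambda>p. indicator {x} p - measure \<nu> {x}) p \<partial>\<nu>) =
    1 / (2 * real CARD('d)) * (\<Sum>i\<in>UNIV. measure \<nu> {x + axis i 1} + measure \<nu> {x - axis i 1}) -
    measure \<nu> {x} + rate x * measure \<nu> {x} - measure \<nu> {x} * (lam + (lam0 - lam) * measure \<nu> {0})"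
proof -
  interpret prob_space \<nu> by fact
  have space: "space \<nu> = UNIV" using sets_eq_imp_space_eq[of \<nu> "count_space UNIV"] by simp
  have int: "integrable \<nu> f" if "\<And>p. \<bar>f p\<bar> \<le> K" for f :: "int ^ 'd \<Rightarrow> real" and K
    by (rule integrable_const_bound[where B = K]) (use that in \<open>auto simp: measurable_def\<close>)
  have ind: "integrable \<nu> (\<lambda>p. indicator {x} (p + e) :: real)" for e x
    by (rule int[of _ 1]) (auto simp: indicator_def)
  have ind0: "integrable \<nu> (\<lambda>p. indicator {x} p :: real)" for x using ind[of x 0] by simp
  have shift: "(\<integral>p. indicator {x} (p + e) \<partial>\<nu>) = measure \<nu> {x - e}" for e
  proof -
    have "(\<lambda>p. indicator {x} (p + e) :: real) = indicator {x - e}"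
      by (auto simp: indicator_def fun_eq_iff eq_diff_eq)
    then show ?thesis by (simp add: space)
  qed
  have rate_eq: "rate p = lam + (lam0 - lam) * indicator {0} p" for p by (simp add: rate_def)
  have "gen (\<lambda>p. indicator {x} p - measure \<nu> {x}) p =
      ((\<Sum>e\<in>unit_steps. indicator {x} (p + e)) / card (unit_steps :: (int ^ 'd) set) - indicator {x} p) +
      rate x * indicator {x} p - measure \<nu> {x} * (lam + (lam0 - lam) * indicator {0} p)" for p
    unfolding gen_diff_const rate_eq[symmetric] unfolding gen_def step_mean_def
    by (simp add: sum_subtractf diff_divide_distrib indicator_def)
  then have "(\<integral>p. gen (\<lambda>p. indicator {x} p - measure \<nu> {x}) p \<partial>\<nu>) =
      ((\<Sum>e\<in>unit_steps. measure \<nu> {x - e}) / card (unit_steps :: (int ^ 'd) set) - measure \<nu> {x}) +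
      rate x * measure \<nu> {x} - measure \<nu> {x} * (lam + (lam0 - lam) * measure \<nu> {0})"
    using ind ind0 by (simp add: shift space prob_space[unfolded space])
  also have "(\<Sum>e\<in>unit_steps. measure \<nu> {x - e}) = (\<Sum>i\<in>UNIV. measure \<nu> {x + axis i 1} + measure \<nu> {x - axis i 1})"
    by (subst card_unit_steps_sum(2)) (simp add: add.commute)
  finally show ?thesis by (simp add: card_unit_steps_sum(1))
qed

lemma finite_alive_card_pos: "finite (alive_at c t) \<Longrightarrow> 0 \<le> t \<Longrightarrow> 0 < card (alive_at c t)"
  by (subst card_gt_0_iff) (auto simp: alive_at_def intro!: exI[of _ "[]"])

text \<open>Each of the infinitely many labels has a finite time of birth.\<close>

lemma card_alive_at_top:
  assumes fin: "\<And>t. finite (alive_at c t)"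
  shows "filterlim (\<lambda>t. real (card (alive_at c t))) at_top at_top"
  unfolding filterlim_at_top
proof
  fix Z :: real
  obtain N :: nat where N: "Z \<le> real N" using real_arch_simple by blast
  obtain T :: "nat list set" where T: "finite T" "card T = N"
    using infinite_arbitrarily_large[OF infinite_UNIV_listI, of N] by blast
  show "eventually (\<lambda>t. Z \<le> real (card (alive_at c t))) at_top"
    using eventually_ge_at_top[of "Max (insert 0 ((\<lambda>u. fst (born c u)) ` T))"]
  proof eventually_elim
    case (elim t)
    then have "T \<subseteq> alive_at c t" using T(1) by (auto simp: alive_at_def)
    then have "N \<le> card (alive_at c t)" using T card_mono[OF fin] by blast
    with N show ?case by simp
  qed
qed

text \<open>The deterministic core: if the normalised compensated increments vanish along a sequence of times, the
  limiting frequencies annihilate the generator.\<close>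

lemma limit_stationary:
  fixes c :: "'d::finite config"
  assumes g: "good c" and fin: "\<And>t. finite (alive_at c t)"
    and conv: "\<And>f K. (\<And>p. \<bar>f p\<bar> \<le> K) \<Longrightarrow> ((\<lambda>t. occ c t f / card (alive_at c t)) \<longlongrightarrow> avg f) at_top"
    and G: "\<And>p. \<bar>G p\<bar> \<le> 1" "avg G = 0"
    and r: "filterlim r at_top sequentially" "\<And>n. 0 \<le> r n"
    and X1: "(\<lambda>n. (occ c (r n + step) G - occ c (r n) G - integral {r n..r n + step} (\<lambda>s. occ c s (gen G))) /
      card (alive_at c (r n))) \<longlonglongrightarrow> 0"
    and X2: "(\<lambda>n. (occ c (r n + step) (\<lambda>_. 1) - occ c (r n) (\<lambda>_. 1) - integral {r n..r n + step} (\<lambda>s. occ c s (gen (\<lambda>_. 1)))) /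
      card (alive_at c (r n))) \<longlonglongrightarrow> 0"
  shows "avg (gen G) = 0"
proof -
  define N where "N t = real (card (alive_at c t))" for t
  define h where "h = avg (gen G)"
  have occ_1: "occ c t (\<lambda>_. 1) = N t" for t by (simp add: occ_def N_def)
  have N_pos: "0 < N t" if "0 \<le> t" for t using finite_alive_card_pos[OF fin that] by (simp add: N_def)
  have N_mono: "N s \<le> N t" if "s \<le> t" for s t
    unfolding N_def using card_mono[OF fin alive_at_mono[OF that]] by simp
  have int: "(\<lambda>s. occ c s f) integrable_on {t..t'}" if "0 \<le> t" "t \<le> t'" for f t t'
    by (rule occ_decomposition(1)[where f = "\<lambda>_. 0" and K = 0]) (use g fin that in auto)
  \<comment> \<open>with \<open>I\<close> the integral of \<open>N\<close> over a step, \<open>N t \<le> I / step\<close> and \<open>N t' \<le> 2 * N t + lam0 * I\<close>; \<open>C\<close> collects the resulting multiples of \<open>I\<close>\<close>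
  define C where "C = 2 + 4 / step + lam0"
  have *: "\<bar>h\<bar> \<le> C * \<epsilon>" if \<epsilon>: "0 < \<epsilon>" "\<epsilon> \<le> 1" for \<epsilon>
  proof -
    have e1: "eventually (\<lambda>t. \<bar>occ c t G / N t\<bar> < \<epsilon>) at_top"
      using tendstoD[OF conv[of G 1, OF G(1)] \<epsilon>(1)] by (simp add: G(2) dist_real_def N_def)
    have e2: "eventually (\<lambda>t. \<bar>occ c t (gen G) / N t - h\<bar> < \<epsilon>) at_top"
      using tendstoD[OF conv[of "gen G", OF gen_bounded[OF G(1)]] \<epsilon>(1)] by (simp add: dist_real_def N_def h_def)
    from eventually_conj[OF e1 e2] obtain t0 where t0: "\<And>t. t0 \<le> t \<Longrightarrow> \<bar>occ c t G / N t\<bar> < \<epsilon> \<and> \<bar>occ c t (gen G) / N t - h\<bar> < \<epsilon>"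
      unfolding eventually_at_top_linorder by blast
    have "eventually (\<lambda>n. t0 \<le> r n) sequentially" using r(1) by (simp add: filterlim_at_top)
    moreover note tendstoD[OF X1 \<epsilon>(1)] tendstoD[OF X2 \<epsilon>(1)]
    ultimately have "eventually (\<lambda>n. t0 \<le> r n \<and>
        \<bar>(occ c (r n + step) G - occ c (r n) G - integral {r n..r n + step} (\<lambda>s. occ c s (gen G))) / N (r n)\<bar> < \<epsilon> \<and>
        \<bar>(N (r n + step) - N (r n) - integral {r n..r n + step} (\<lambda>s. occ c s (gen (\<lambda>_. 1)))) / N (r n)\<bar> < \<epsilon>) sequentially"
      by eventually_elim (simp add: dist_real_def N_def[symmetric] occ_1)
    then obtain n where n: "t0 \<le> r n"
        "\<bar>(occ c (r n + step) G - occ c (r n) G - integral {r n..r n + step} (\<lambda>s. occ c s (gen G))) / N (r n)\<bar> < \<epsilon>"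
        "\<bar>(N (r n + step) - N (r n) - integral {r n..r n + step} (\<lambda>s. occ c s (gen (\<lambda>_. 1)))) / N (r n)\<bar> < \<epsilon>"
      using eventually_happens'[OF sequentially_bot] by blast
    define t t' I where "t = r n" and "t' = r n + step" and "I = integral {t..t'} N"
    have t: "0 \<le> t" "t \<le> t'" "t0 \<le> t" "0 \<le> t'" "t' - t = step" using r(2)[of n] step(1) n(1) by (auto simp: t_def t'_def)
    have intN: "N integrable_on {t..t'}" using int[OF t(1,2), of "\<lambda>_. 1"] by (simp add: occ_1)
    have intc: "(\<lambda>s. a * N s) integrable_on {t..t'}" for a using integrable_cmul[OF intN, of a] by simp
    have NI: "step * N t \<le> I"
    proof -
      have "((\<lambda>_. N t) has_integral (t' - t) *\<^sub>R N t) {t..t'}" using has_integral_const_real[of "N t" t t'] t(2) by simp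
      then have "(t' - t) *\<^sub>R N t \<le> I"
        by (rule has_integral_le[OF _ integrable_integral[OF intN, folded I_def]]) (use N_mono in auto)
      then show ?thesis by (simp add: t)
    qed
    have I_pos: "0 < I" using NI mult_pos_pos[OF step(1) N_pos[OF t(1)]] by linarith
    have bound_G: "\<bar>occ c s G\<bar> \<le> \<epsilon> * N s" if "t \<le> s" for s
    proof -
      have "0 < N s" using N_pos that t by simp
      with t0[of s] that t show ?thesis by (simp add: divide_simps mult.commute split: if_splits)
    qed
    have bound_H: "\<bar>occ c s (gen G) - h * N s\<bar> \<le> \<epsilon> * N s" if "t \<le> s" for s
    proof -
      have p: "0 < N s" using N_pos that t by simp
      have "\<bar>occ c s (gen G) / N s - h\<bar> * N s \<le> \<epsilon> * N s"
        using t0[of s] that t p by (intro mult_right_mono) auto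
      also have "\<bar>occ c s (gen G) / N s - h\<bar> * N s = \<bar>(occ c s (gen G) / N s - h) * N s\<bar>"
        using p by (simp add: abs_mult)
      also have "(occ c s (gen G) / N s - h) * N s = occ c s (gen G) - h * N s"
        using p by (simp add: left_diff_distrib)
      finally show ?thesis .
    qed
    have A: "\<bar>integral {t..t'} (\<lambda>s. occ c s (gen G)) - h * I\<bar> \<le> \<epsilon> * I"
    proof -
      have "integral {t..t'} (\<lambda>s. occ c s (gen G)) - h * I = integral {t..t'} (\<lambda>s. occ c s (gen G) - h * N s)"
        unfolding I_def by (subst Henstock_Kurzweil_Integration.integral_diff)
          (use int[OF t(1,2)] intc in auto)
      also have "\<bar>\<dots>\<bar> \<le> integral {t..t'} (\<lambda>s. \<epsilon> * N s)"
        unfolding real_norm_def[symmetric] by (rule integral_norm_bound_integral)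
          (use int[OF t(1,2)] intc bound_H in \<open>auto intro!: integrable_diff\<close>)
      finally show ?thesis by (simp add: I_def)
    qed
    have B: "integral {t..t'} (\<lambda>s. occ c s (gen (\<lambda>_. 1))) \<le> lam0 * I"
    proof -
      have "integral {t..t'} (\<lambda>s. occ c s (gen (\<lambda>_. 1))) \<le> integral {t..t'} (\<lambda>s. lam0 * N s)"
      proof (rule integral_le)
        fix s
        have "occ c s (gen (\<lambda>_. 1)) \<le> of_nat (card (alive_at c s)) * lam0"
          unfolding occ_def by (rule sum_bounded_above) (simp add: gen_def step_mean_def rate_le)
        then show "occ c s (gen (\<lambda>_. 1)) \<le> lam0 * N s" by (simp add: N_def mult.commute)
      qed (use int[OF t(1,2)] intc in auto)
      then show ?thesis by (simp add: I_def)
    qed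
    have d1: "\<bar>occ c t' G - occ c t G - integral {t..t'} (\<lambda>s. occ c s (gen G))\<bar> \<le> \<epsilon> * N t"
      and d2: "\<bar>N t' - N t - integral {t..t'} (\<lambda>s. occ c s (gen (\<lambda>_. 1)))\<bar> \<le> \<epsilon> * N t"
      using n(2,3) N_pos[OF t(1)] by (simp_all add: t_def t'_def divide_simps mult.commute split: if_splits)
    have Nt: "N t \<le> I / step" using NI step(1) by (simp add: field_simps)
    have "\<epsilon> * N t \<le> 1 * N t" using \<epsilon> N_pos[OF t(1)] by (intro mult_right_mono) auto
    with d2 B have Nt': "N t' \<le> 2 * N t + lam0 * I" by linarith
    have "\<bar>h\<bar> * I = \<bar>h * I\<bar>" using I_pos by (simp add: abs_mult)
    also have "\<dots> \<le> \<epsilon> * I + \<epsilon> * N t' + \<epsilon> * N t + \<epsilon> * N t"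
      using A d1 bound_G[of t'] bound_G[of t] t by linarith
    also have "\<dots> = \<epsilon> * (I + N t' + 2 * N t)" by (simp add: algebra_simps)
    also have "\<dots> \<le> \<epsilon> * (I + (2 * (I / step) + lam0 * I) + 2 * (I / step))"
      using Nt Nt' \<epsilon> by (intro mult_left_mono) auto
    also have "\<dots> \<le> (C * \<epsilon>) * I" using \<epsilon> I_pos by (simp add: C_def algebra_simps)
    finally show ?thesis using I_pos by simp
  qed
  have "\<bar>h\<bar> \<le> 0"
  proof (rule field_le_epsilon)
    fix e :: real assume "0 < e"
    have C: "0 < C" unfolding C_def using step(1) lam0_pos by (simp add: add_pos_pos)
    have "\<bar>h\<bar> \<le> C * min 1 (e / C)" by (rule *) (use \<open>0 < e\<close> C in auto)
    also have "\<dots> \<le> C * (e / C)" using C by (intro mult_left_mono) auto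
    finally show "\<bar>h\<bar> \<le> 0 + e" using C by simp
  qed
  then show ?thesis by (simp add: h_def)
qed

end

context catalytic_rates begin

section \<open>Vanishing relative increments\<close>

text \<open>The weight \<open>1 / N\<^sub>t\<close>, equal to \<open>0\<close> for an infinite population.\<close>

definition alive_inverse :: "real \<Rightarrow> 'd::finite config \<Rightarrow> real" where
  "alive_inverse t c = inverse (real (card (alive_at c t)))"

lemma measurable_alive_inverse [measurable]: "alive_inverse t \<in> borel_measurable conf_law"
proof -
  have "(\<lambda>c. card (to_nat ` alive_at c t)) \<in> measurable conf_law (count_space UNIV)"
  proof (rule measurable_card)
    fix i :: nat
    have "{c \<in> space conf_law. i \<in> to_nat ` alive_at c t} =
        {c \<in> space conf_law. \<exists>u. to_nat u = i \<and> fst (born c u) \<le> t}"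
      by (auto simp: alive_at_def)
    also have "\<dots> \<in> sets conf_law" by measurable
    finally show "{c \<in> space conf_law. i \<in> to_nat ` alive_at c t} \<in> sets conf_law" .
  qed
  then have "(\<lambda>c. card (alive_at c t)) \<in> measurable conf_law (count_space UNIV)"
    by (simp add: card_image inj_on_subset[OF inj_to_nat])
  then show ?thesis unfolding alive_inverse_def by measurable
qed

lemma alive_inverse_bounds: "0 \<le> alive_inverse t c" "alive_inverse t c \<le> 1"
proof -
  show "0 \<le> alive_inverse t c" by (simp add: alive_inverse_def)
  have "inverse (real n) \<le> 1" for n by (cases n) (auto simp: field_simps)
  then show "alive_inverse t c \<le> 1" by (simp add: alive_inverse_def)
qed

lemma abs_alive_inverse_le: "\<bar>alive_inverse t c\<bar> \<le> 1"
  using alive_inverse_bounds[of t c] by simp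

lemma alive_inverse_count_le: "(alive_inverse t c)\<^sup>2 * count_alive (labels m) c t \<le> alive_inverse t c"
proof (cases "finite (alive_at c t)")
  case True
  have "count_alive (labels m) c t \<le> card (alive_at c t)"
    by (simp add: count_alive_eq_card card_mono True)
  then have "alive_inverse t c * (alive_inverse t c * count_alive (labels m) c t) \<le>
      alive_inverse t c * (alive_inverse t c * card (alive_at c t))"
    by (intro mult_left_mono alive_inverse_bounds)
  also have "\<dots> \<le> alive_inverse t c * 1"
    by (intro mult_left_mono alive_inverse_bounds, cases "card (alive_at c t) = 0") (auto simp: alive_inverse_def)
  finally show ?thesis by (simp add: power2_eq_square mult.assoc)
qed (simp add: alive_inverse_def)


lemma expected_alive_inverse_tendsto_0:
  "(\<lambda>n. \<integral>c. alive_inverse (real n) (c :: 'd::finite config) \<partial>conf_law) \<longlonglongrightarrow> 0"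
proof -
  interpret prob_space "conf_law :: 'd config measure" by (rule prob_space_conf_law)
  have "(\<lambda>n. \<integral>c. alive_inverse (real n) (c :: 'd config) \<partial>conf_law) \<longlonglongrightarrow> (\<integral>c. 0 \<partial>(conf_law :: 'd config measure))"
  proof (rule integral_dominated_convergence[where w = "\<lambda>_. 1"])
    show "AE c :: 'd config in conf_law. (\<lambda>n. alive_inverse (real n) c) \<longlonglongrightarrow> 0"
      using AE_finite_alive
    proof eventually_elim
      case (elim c)
      have "filterlim (\<lambda>n. real (card (alive_at c (real n)))) at_top sequentially"
        by (rule filterlim_compose[OF card_alive_at_top filterlim_real_sequentially]) (use elim in blast)
      then show ?case unfolding alive_inverse_def by (rule tendsto_inverse_0_at_top)
    qed
  qed (simp_all add: abs_alive_inverse_le)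
  then show ?thesis by simp
qed

text \<open>The compensated increment of the occupation measure on a time step, relative to the population.\<close>

definition rel_increment :: "(int ^ 'd::finite \<Rightarrow> real) \<Rightarrow> real \<Rightarrow> 'd config \<Rightarrow> real" where
  "rel_increment f t c = (occ c (t + step) f - occ c t f -
     integral {t..t + step} (\<lambda>s. occ c s (gen f))) / card (alive_at c t)"

text \<open>Measurability of \<open>rel_increment\<close> itself is not needed: \<open>X\<close> is a measurable version of it.\<close>

lemma rel_increment_L2:
  fixes f :: "int ^ 'd::finite \<Rightarrow> real"
  assumes K: "\<And>p. \<bar>f p\<bar> \<le> K" and t: "0 \<le> t"
  obtains X :: "'d config \<Rightarrow> real" where
    "AE c in conf_law. X c = rel_increment f t c" "integrable conf_law (\<lambda>c. (X c)\<^sup>2)"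
    "(\<integral>c. (X c)\<^sup>2 \<partial>conf_law) \<le> 80 * K\<^sup>2 * (\<integral>c. alive_inverse t (c :: 'd config) \<partial>conf_law)"
proof -
  interpret alive_weight lam0 lam "\<lambda>A. inverse (real (card A))" t "t + step" "alive_inverse t :: 'd config \<Rightarrow> real"
  proof unfold_locales
    show "alive_inverse t \<equiv> \<lambda>c :: 'd config. inverse (real (card (alive_at c t)))"
      by (rule eq_reflection) (simp add: fun_eq_iff alive_inverse_def)
    show "inverse (real (card A)) \<le> 1" for A :: "nat list set" by (cases "card A") (auto simp: field_simps)
  qed (use step t in \<open>auto intro: measurable_alive_inverse[unfolded alive_inverse_def[abs_def]]\<close>)
  let ?S = "\<lambda>m c. alive_inverse t c * (\<Sum>i\<in>labels m \<times> {..<m}.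
        jump_comp (\<lambda>p e. f (p + e) - f p) t (t + step) c (fst i) (snd i) + ring_comp f t (t + step) c (fst i) (snd i))"
  define X where "X c = lim (\<lambda>m. ?S m c)" for c :: "'d config"
  have [measurable]: "X \<in> borel_measurable conf_law" unfolding X_def by measurable
  have lim: "AE c in conf_law. (\<lambda>m. ?S m c) \<longlonglongrightarrow> rel_increment f t c"
    using AE_good AE_finite_alive
  proof eventually_elim
    case (elim c)
    have "eventually (\<lambda>m. (\<Sum>i\<in>labels m \<times> {..<m}.
        jump_comp (\<lambda>p e. f (p + e) - f p) t (t + step) c (fst i) (snd i) + ring_comp f t (t + step) c (fst i) (snd i)) =
      occ c (t + step) f - occ c t f - integral {t..t + step} (\<lambda>s. occ c s (gen f))) sequentially"
      by (rule occ_decomposition(2)[OF _ _ _ _ K]) (use elim t step(1) in auto)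
    then have "eventually (\<lambda>m. ?S m c = rel_increment f t c) sequentially"
      by eventually_elim (simp add: rel_increment_def alive_inverse_def divide_inverse mult.commute)
    then show ?case by (rule tendsto_eventually)
  qed
  have X: "AE c in conf_law. X c = rel_increment f t c"
    using lim by eventually_elim (simp add: X_def limI)
  have "AE c in conf_law. (\<lambda>m. ?S m c) \<longlonglongrightarrow> X c"
    using lim X by eventually_elim simp
  from L2_limit_bound[OF K _ this alive_inverse_count_le] X show ?thesis by (intro that) measurable
qed

text \<open>Along a sequence of times the relative increments of two test functions vanish almost surely.\<close>

lemma rel_increment_subseq:
  fixes f g :: "int ^ 'd::finite \<Rightarrow> real"
  assumes f: "\<And>p. \<bar>f p\<bar> \<le> 1" and g: "\<And>p. \<bar>g p\<bar> \<le> 1"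
  obtains r :: "nat \<Rightarrow> nat" where "strict_mono r"
    "AE c in conf_law. (\<lambda>n. rel_increment f (real (r n)) c) \<longlonglongrightarrow> 0 \<and> (\<lambda>n. rel_increment g (real (r n)) c) \<longlonglongrightarrow> 0"
proof -
  have "\<exists>X :: 'd config \<Rightarrow> real. (AE c in conf_law. X c = rel_increment h (real n) c) \<and>
      integrable conf_law (\<lambda>c. (X c)\<^sup>2) \<and>
      (\<integral>c. (X c)\<^sup>2 \<partial>conf_law) \<le> 80 * (\<integral>c. alive_inverse (real n) (c :: 'd config) \<partial>conf_law)"
    if h: "\<And>p. \<bar>h p\<bar> \<le> 1" for h :: "int ^ 'd \<Rightarrow> real" and n
  proof -
    obtain X :: "'d config \<Rightarrow> real" where "AE c in conf_law. X c = rel_increment h (real n) c"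
      "integrable conf_law (\<lambda>c. (X c)\<^sup>2)"
      "(\<integral>c. (X c)\<^sup>2 \<partial>conf_law) \<le> 80 * 1\<^sup>2 * (\<integral>c. alive_inverse (real n) (c :: 'd config) \<partial>conf_law)"
      by (rule rel_increment_L2[of h 1 "real n", OF h]) simp
    then show ?thesis by (intro exI[of _ X]) simp
  qed
  then have "\<exists>X :: nat \<Rightarrow> 'd config \<Rightarrow> real. \<forall>n. (AE c in conf_law. X n c = rel_increment h (real n) c) \<and>
      integrable conf_law (\<lambda>c. (X n c)\<^sup>2) \<and>
      (\<integral>c. (X n c)\<^sup>2 \<partial>conf_law) \<le> 80 * (\<integral>c. alive_inverse (real n) (c :: 'd config) \<partial>conf_law)"
    if "\<And>p. \<bar>h p\<bar> \<le> 1" for h :: "int ^ 'd \<Rightarrow> real" using that by (intro choice allI) blast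
  from this[of f, OF f] this[of g, OF g] obtain X Y :: "nat \<Rightarrow> 'd config \<Rightarrow> real" where
    X: "\<And>n. AE c in conf_law. X n c = rel_increment f (real n) c" "\<And>n. integrable conf_law (\<lambda>c. (X n c)\<^sup>2)"
      "\<And>n. (\<integral>c. (X n c)\<^sup>2 \<partial>conf_law) \<le> 80 * (\<integral>c. alive_inverse (real n) (c :: 'd config) \<partial>conf_law)" and
    Y: "\<And>n. AE c in conf_law. Y n c = rel_increment g (real n) c" "\<And>n. integrable conf_law (\<lambda>c. (Y n c)\<^sup>2)"
      "\<And>n. (\<integral>c. (Y n c)\<^sup>2 \<partial>conf_law) \<le> 80 * (\<integral>c. alive_inverse (real n) (c :: 'd config) \<partial>conf_law)"
    by blast
  have "\<exists>r. strict_mono r \<and> (AE c in conf_law. (\<lambda>n. (X (r n) c)\<^sup>2 + (Y (r n) c)\<^sup>2) \<longlonglongrightarrow> 0)"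
  proof (rule tendsto_L1_AE_subseq[where u = "\<lambda>n c. (X n c)\<^sup>2 + (Y n c)\<^sup>2"])
    show "integrable conf_law (\<lambda>c. (X n c)\<^sup>2 + (Y n c)\<^sup>2)" for n
      by (intro Bochner_Integration.integrable_add X Y)
    show "(\<lambda>n. \<integral>c. norm ((X n c)\<^sup>2 + (Y n c)\<^sup>2) \<partial>conf_law) \<longlonglongrightarrow> 0"
    proof (rule tendsto_sandwich[OF _ _ tendsto_const])
      show "(\<lambda>n. 160 * (\<integral>c. alive_inverse (real n) (c :: 'd config) \<partial>conf_law)) \<longlonglongrightarrow> 0"
        using tendsto_mult_left[OF expected_alive_inverse_tendsto_0, of 160] by simp
      have "(\<integral>c. norm ((X n c)\<^sup>2 + (Y n c)\<^sup>2) \<partial>conf_law) = (\<integral>c. (X n c)\<^sup>2 \<partial>conf_law) + (\<integral>c. (Y n c)\<^sup>2 \<partial>conf_law)" for n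
        using X(2)[of n] Y(2)[of n] by simp
      then show "eventually (\<lambda>n. (\<integral>c. norm ((X n c)\<^sup>2 + (Y n c)\<^sup>2) \<partial>conf_law) \<le>
          160 * (\<integral>c. alive_inverse (real n) (c :: 'd config) \<partial>conf_law)) sequentially"
        using X(3) Y(3) by (intro always_eventually allI) (smt (verit))
    qed simp
  qed
  then obtain r where r: "strict_mono r" "AE c in conf_law. (\<lambda>n. (X (r n) c)\<^sup>2 + (Y (r n) c)\<^sup>2) \<longlonglongrightarrow> 0" by blast
  have "AE c in conf_law. \<forall>n. X n c = rel_increment f (real n) c \<and> Y n c = rel_increment g (real n) c"
    using X(1) Y(1) by (simp add: AE_all_countable)
  with r(2) have "AE c in conf_law. (\<lambda>n. rel_increment f (real (r n)) c) \<longlonglongrightarrow> 0 \<and>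
      (\<lambda>n. rel_increment g (real (r n)) c) \<longlonglongrightarrow> 0"
  proof eventually_elim
    case (elim c)
    have sq: "x \<longlonglongrightarrow> 0" if "\<And>n. (x n)\<^sup>2 \<le> z n" "z \<longlonglongrightarrow> 0" for x z :: "nat \<Rightarrow> real"
    proof -
      have "(\<lambda>n. (x n)\<^sup>2) \<longlonglongrightarrow> 0"
        by (rule tendsto_sandwich[OF _ _ tendsto_const that(2)]) (use that(1) in auto)
      then show ?thesis using tendsto_real_sqrt[of "\<lambda>n. (x n)\<^sup>2" 0 sequentially] by (simp add: tendsto_rabs_zero_iff)
    qed
    have "(\<lambda>n. X (r n) c) \<longlonglongrightarrow> 0" "(\<lambda>n. Y (r n) c) \<longlonglongrightarrow> 0"
      by (rule sq[OF _ elim(1)], simp)+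
    then show ?case using elim(2) by simp
  qed
  with r(1) show ?thesis by (rule that)
qed

end

section \<open>The particle system and its configuration\<close>

locale positive_brw = catalytic_brw M lam0 lam J S B + catalytic_rates lam0 lam
  for M :: "'w measure" and lam0 lam J and S :: "nat list \<Rightarrow> nat \<Rightarrow> 'w \<Rightarrow> int ^ 'd::finite" and B
begin

text \<open>The configuration realised by \<open>\<omega>\<close>.\<close>

definition marks :: "'w \<Rightarrow> 'd config" where
  "marks \<omega> = (\<lambda>(u, k). (J u k \<omega>, S u k \<omega>, B u k \<omega>))"

lemma wait_j_marks [simp]: "wait_j (marks \<omega>) u k = J u k \<omega>"
  and wait_b_marks [simp]: "wait_b (marks \<omega>) u k = B u k \<omega>"
  and disp_marks [simp]: "disp (marks \<omega>) u k = S u k \<omega>"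
  by (simp_all add: wait_j_def wait_b_def disp_def marks_def)

lemma measurable_marks_M: "marks \<in> measurable M conf_law"
  and distr_marks: "distr M conf_law marks = conf_law"
proof -
  let ?X = "\<lambda>(u, k) \<omega>. (J u k \<omega>, S u k \<omega>, B u k \<omega>)"
  have "random_variable mark_law (\<lambda>\<omega>. (J u k \<omega>, S u k \<omega>, B u k \<omega>))" for u k
    using marks_indep by (simp add: indep_vars_def)
  then have rv: "random_variable mark_law (?X i)" for i by (cases i) simp
  have eq: "(\<lambda>\<omega>. \<lambda>i\<in>UNIV. ?X i \<omega>) = marks" by (auto simp: fun_eq_iff marks_def)
  have "distr M (PiM UNIV (\<lambda>_. mark_law)) (\<lambda>\<omega>. \<lambda>i\<in>UNIV. ?X i \<omega>) = PiM UNIV (\<lambda>i. distr M mark_law (?X i))"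
    using indep_vars_iff_distr_eq_PiM[where I = UNIV and M' = "\<lambda>_. mark_law" and X = ?X] rv marks_indep by simp
  also have "(\<lambda>i. distr M mark_law (?X i)) = (\<lambda>_. mark_law)" by (auto simp: fun_eq_iff marks_law split: prod.split)
  finally show "distr M conf_law marks = conf_law" unfolding eq conf_law_def .
  have "(\<lambda>\<omega>. \<lambda>i\<in>UNIV. ?X i \<omega>) \<in> measurable M (PiM UNIV (\<lambda>_. mark_law))"
    by (rule measurable_restrict) (rule rv)
  then show "marks \<in> measurable M conf_law" unfolding eq conf_law_def .
qed

lemma AE_marks: "AE c in conf_law. P c \<Longrightarrow> AE \<omega> in M. P (marks \<omega>)"
  using AE_distrD[OF measurable_marks_M, of P] unfolding distr_marks .

lemma branch_rate_eq: "branch_rate x = rate x"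
  by (simp add: branch_rate_def rate_def)

context
  fixes \<omega> assumes good: "good (marks \<omega>)"
begin

lemma num_jumps_eq:
  assumes "jump_age (marks \<omega>) u k \<le> a" "a < jump_age (marks \<omega>) u (Suc k)"
  shows "num_jumps \<omega> u a = k"
proof -
  note m = monoD[OF mono_jump_age[OF good]]
  have "{n. (\<Sum>k\<le>n. J u k \<omega>) \<le> a} = {n. jump_age (marks \<omega>) u (Suc n) \<le> a}"
    by (simp add: jump_age_def lessThan_Suc_atMost)
  also have "\<dots> = {..<k}"
  proof safe
    fix n assume "jump_age (marks \<omega>) u (Suc n) \<le> a"
    then show "n < k" using m[of "Suc k" "Suc n" u] assms(2) by (force simp: not_less)
  next
    fix n assume "n < k"
    then show "jump_age (marks \<omega>) u (Suc n) \<le> a" using m[of "Suc n" k u] assms(1) by simp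
  qed
  finally show ?thesis by (simp add: num_jumps_def)
qed

lemma site_at_age_eq:
  assumes "jump_age (marks \<omega>) u k \<le> a" "a < jump_age (marks \<omega>) u (Suc k)"
  shows "site_at_age \<omega> u p a = site (marks \<omega>) u p k"
  by (simp add: site_at_age_def num_jumps_eq[OF assms] site_def)

lemma rate_integral_segment:
  assumes "jump_age (marks \<omega>) u k \<le> a" "a \<le> jump_age (marks \<omega>) u (Suc k)"
  shows "((\<lambda>s. branch_rate (site_at_age \<omega> u p s)) has_integral
    rate (site (marks \<omega>) u p k) * (a - jump_age (marks \<omega>) u k)) {jump_age (marks \<omega>) u k..a}"
proof (rule has_integral_spike_finite[of "{a}"])
  show "((\<lambda>_. rate (site (marks \<omega>) u p k)) has_integral
    rate (site (marks \<omega>) u p k) * (a - jump_age (marks \<omega>) u k)) {jump_age (marks \<omega>) u k..a}"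
    using has_integral_const_real[of "rate (site (marks \<omega>) u p k)" "jump_age (marks \<omega>) u k" a] assms(1)
    by (simp add: mult.commute)
  show "branch_rate (site_at_age \<omega> u p s) = rate (site (marks \<omega>) u p k)"
    if "s \<in> {jump_age (marks \<omega>) u k..a} - {a}" for s
    using that assms by (subst site_at_age_eq[of u k]) (auto simp: branch_rate_eq)
qed simp

lemma rate_integral:
  assumes "jump_age (marks \<omega>) u k \<le> a" "a < jump_age (marks \<omega>) u (Suc k)"
  shows "integral {0..a} (\<lambda>s. branch_rate (site_at_age \<omega> u p s)) =
    op_time (marks \<omega>) u p k + rate (site (marks \<omega>) u p k) * (a - jump_age (marks \<omega>) u k)"
proof -
  have *: "((\<lambda>s. branch_rate (site_at_age \<omega> u p s)) has_integral op_time (marks \<omega>) u p k) {0..jump_age (marks \<omega>) u k}" for k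
  proof (induction k)
    case (Suc k)
    have "((\<lambda>s. branch_rate (site_at_age \<omega> u p s)) has_integral
        op_time (marks \<omega>) u p k + rate (site (marks \<omega>) u p k) * (jump_age (marks \<omega>) u (Suc k) - jump_age (marks \<omega>) u k))
        {0..jump_age (marks \<omega>) u (Suc k)}"
    proof (rule has_integral_combine[OF _ _ Suc rate_integral_segment])
      show "0 \<le> jump_age (marks \<omega>) u k" by (rule jump_age_nonneg[OF good])
    qed (use monoD[OF mono_jump_age[OF good], of k "Suc k" u] in auto)
    then show ?case by (simp add: op_time_Suc jump_age_Suc)
  qed (simp add: has_integral_refl)
  show ?thesis
    by (rule integral_unique, rule has_integral_combine[OF _ _ * rate_integral_segment])
      (use assms jump_age_nonneg[OF good] in auto)
qed

text \<open>On good configurations, the age at a ring, defined as the first age at which the integrated rate reaches the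
  operational time of the ring, is the function \<open>age\<close> of that operational time.\<close>

lemma branch_age_eq: "branch_age \<omega> u p n = age (marks \<omega>) u p (ring_op (marks \<omega>) u (Suc n))"
proof -
  let ?c = "marks \<omega>"
  define \<beta> k where "\<beta> = ring_op ?c u (Suc n)" and "k = segment ?c u p \<beta>"
  have \<beta>0: "0 \<le> \<beta>" unfolding \<beta>_def by (rule ring_op_nonneg[OF good])
  note seg = segment_bounds[OF good \<beta>0, of u p, folded k_def]
  note ab = age_bounds[OF good \<beta>0, of u p, folded k_def]
  have age: "age ?c u p \<beta> = jump_age ?c u k + (\<beta> - op_time ?c u p k) / rate (site ?c u p k)"
    by (rule age_eq[OF good seg])
  have iff: "\<beta> \<le> integral {0..a} (\<lambda>s. branch_rate (site_at_age \<omega> u p s)) \<longleftrightarrow> age ?c u p \<beta> \<le> a" if "0 \<le> a" for a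
  proof -
    define l where "l = (LEAST l. a < jump_age ?c u (Suc l))"
    have l: "jump_age ?c u l \<le> a" "a < jump_age ?c u (Suc l)"
      unfolding l_def using Least_interval[OF good_jump_age[OF good], of u a] that by simp_all
    let ?I = "op_time ?c u p l + rate (site ?c u p l) * (a - jump_age ?c u l)"
    have I: "op_time ?c u p l \<le> ?I" "?I < op_time ?c u p (Suc l)"
      using l by (auto simp: op_time_Suc jump_age_Suc)
    consider "l < k" | "k < l" | "l = k" by linarith
    then have "\<beta> \<le> ?I \<longleftrightarrow> age ?c u p \<beta> \<le> a"
    proof cases
      case 1
      have "op_time ?c u p (Suc l) \<le> op_time ?c u p k" "jump_age ?c u (Suc l) \<le> jump_age ?c u k"
        using 1 by (auto intro!: monoD[OF mono_op_time[OF good]] monoD[OF mono_jump_age[OF good]])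
      then show ?thesis using I seg l ab by linarith
    next
      case 2
      have "op_time ?c u p (Suc k) \<le> op_time ?c u p l" "jump_age ?c u (Suc k) \<le> jump_age ?c u l"
        using 2 by (auto intro!: monoD[OF mono_op_time[OF good]] monoD[OF mono_jump_age[OF good]])
      then show ?thesis using I seg l ab by linarith
    next
      case 3
      have "\<beta> \<le> ?I \<longleftrightarrow> \<beta> - op_time ?c u p k \<le> (a - jump_age ?c u k) * rate (site ?c u p k)"
        using 3 by (simp add: algebra_simps)
      also have "\<dots> \<longleftrightarrow> (\<beta> - op_time ?c u p k) / rate (site ?c u p k) \<le> a - jump_age ?c u k"
        by (rule pos_divide_le_eq[symmetric]) simp
      finally show ?thesis unfolding age by linarith
    qed
    then show ?thesis by (simp add: rate_integral[OF l])
  qed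
  have "(\<Sum>k\<le>n. B u k \<omega>) = \<beta>" by (simp add: \<beta>_def ring_op_def lessThan_Suc_atMost)
  then have "{a. 0 \<le> a \<and> (\<Sum>k\<le>n. B u k \<omega>) \<le> integral {0..a} (\<lambda>s. branch_rate (site_at_age \<omega> u p s))} = {age ?c u p \<beta>..}"
    using iff age_nonneg[OF good \<beta>0, of u p] by auto
  then show ?thesis by (simp add: branch_age_def \<beta>_def)
qed

lemma birth_eq: "birth \<omega> u = born (marks \<omega>) u"
proof (induction u)
  case (Cons n u)
  let ?r = "ring_op (marks \<omega>) u (Suc n)"
  have "site_at_age \<omega> u p (age (marks \<omega>) u p ?r) = op_site (marks \<omega>) u p ?r" for p
    unfolding op_site_def by (rule site_at_age_eq; rule age_bounds[OF good ring_op_nonneg[OF good]])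
  then show ?case by (simp add: Cons branch_age_eq Let_def split_beta)
qed simp

lemma alive_eq: "alive t \<omega> = alive_at (marks \<omega>) t"
  by (simp add: alive_def alive_at_def birth_eq)

lemma position_eq:
  assumes "u \<in> alive_at (marks \<omega>) t" shows "position t \<omega> u = pos (marks \<omega>) u t"
proof -
  define k where "k = (LEAST k. t < jump_time (marks \<omega>) u (Suc k))"
  have "jump_time (marks \<omega>) u k \<le> t" "t < jump_time (marks \<omega>) u (Suc k)"
    unfolding k_def using Least_interval[OF jump_time_at_top[OF good], of u t] assms
    by (simp_all add: jump_time_0 alive_at_def)
  then have "site_at_age \<omega> u p (t - fst (born (marks \<omega>) u)) = site (marks \<omega>) u p k" for p
    by (intro site_at_age_eq) (auto simp: jump_time_def)
  then show ?thesis by (simp add: position_def pos_def birth_eq k_def)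
qed

lemma integral_normalised_occupation:
  fixes f :: "int ^ 'd \<Rightarrow> real"
  assumes fin: "finite (alive_at (marks \<omega>) t)" and t: "0 \<le> t"
  shows "(\<integral>x. f x \<partial>normalised_occupation t \<omega>) = occ (marks \<omega>) t f / card (alive_at (marks \<omega>) t)"
proof -
  let ?A = "alive_at (marks \<omega>) t"
  define N where "N = card ?A"
  have N: "0 < N" unfolding N_def by (rule finite_alive_card_pos[OF fin t])
  have "1 / of_nat (num_particles t \<omega>) = ennreal (1 / real N)"
    using N by (simp add: num_particles_def alive_eq N_def[symmetric] divide_ennreal ennreal_of_nat_eq_real_of_nat flip: ennreal_1)
  then have "normalised_occupation t \<omega> = density (occupation t \<omega>) (\<lambda>_. ennreal (1 / real N))"
    by (simp add: normalised_occupation_def scale_measure_eq_density)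
  then have "(\<integral>x. f x \<partial>normalised_occupation t \<omega>) = (\<integral>x. f x / N \<partial>occupation t \<omega>)"
    using N by (simp add: integral_density occupation_def)
  also have "\<dots> = (\<integral>u. f (position t \<omega> u) / N \<partial>count_space ?A)"
    unfolding occupation_def alive_eq by (subst integral_distr) simp_all
  also have "\<dots> = (\<Sum>u\<in>?A. f (position t \<omega> u) / N)"
    by (rule lebesgue_integral_count_space_finite[OF fin])
  also have "\<dots> = occ (marks \<omega>) t f / N"
    by (simp add: occ_def position_eq sum_divide_distrib)
  finally show ?thesis by (simp add: N_def)
qed

end

lemma integral_gen_limit_zero:
  fixes \<nu> :: "(int ^ 'd) measure"
  assumes \<nu>: "prob_space \<nu>" "sets \<nu> = UNIV"
    and conv: "AE \<omega> in M. weakly_converges (\<lambda>t. normalised_occupation t \<omega>) \<nu> at_top"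
  shows "(\<integral>p. gen (\<lambda>p. indicator {x} p - measure \<nu> {x}) p \<partial>\<nu>) = 0"
proof -
  interpret N: prob_space \<nu> by (rule \<nu>(1))
  have space: "space \<nu> = UNIV" using sets_eq_imp_space_eq[of \<nu> "count_space UNIV"] \<nu>(2) by simp
  define G :: "int ^ 'd \<Rightarrow> real" where "G p = indicator {x} p - measure \<nu> {x}" for p
  have G: "\<bar>G p\<bar> \<le> 1" for p
  proof -
    have m: "0 \<le> measure \<nu> {x}" "measure \<nu> {x} \<le> 1" by simp_all
    have "G p = 1 - measure \<nu> {x} \<or> G p = - measure \<nu> {x}" by (simp add: G_def indicator_def)
    with m show ?thesis by arith
  qed
  have "integrable \<nu> (\<lambda>p. indicator {x} p :: real)"
    by (rule N.integrable_const_bound[where B = 1]) (auto simp: indicator_def measurable_def \<nu>(2))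
  then have G0: "(\<integral>p. G p \<partial>\<nu>) = 0" using N.prob_space by (simp add: G_def \<nu>(2) space)
  obtain r where r: "strict_mono r"
    "AE c in conf_law. (\<lambda>n. rel_increment G (real (r n)) c) \<longlonglongrightarrow> 0 \<and>
      (\<lambda>n. rel_increment (\<lambda>_. 1) (real (r n)) (c :: 'd config)) \<longlonglongrightarrow> 0"
    by (rule rel_increment_subseq[of G "\<lambda>_. 1"]) (use G in auto)
  have "AE \<omega> in M. (\<integral>p. gen G p \<partial>\<nu>) = 0"
    using AE_marks[OF r(2)] AE_marks[OF AE_good] AE_marks[OF AE_finite_alive] conv
  proof eventually_elim
    case (elim \<omega>)
    let ?c = "marks \<omega>"
    show ?case
    proof (rule limit_stationary[of ?c "\<lambda>f. \<integral>p. f p \<partial>\<nu>" G "\<lambda>n. real (r n)"])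
      fix f :: "int ^ 'd \<Rightarrow> real" and K assume K: "\<And>p. \<bar>f p\<bar> \<le> K"
      have "bounded (range f)" using K by (auto simp: bounded_iff)
      then have "((\<lambda>t. \<integral>x. f x \<partial>normalised_occupation t \<omega>) \<longlongrightarrow> (\<integral>x. f x \<partial>\<nu>)) at_top"
        using elim(4) continuous_on_int_vec[of f] by (simp add: weakly_converges_def)
      moreover have "eventually (\<lambda>t. (\<integral>x. f x \<partial>normalised_occupation t \<omega>) = occ ?c t f / card (alive_at ?c t)) at_top"
        using eventually_ge_at_top[of 0]
        by eventually_elim (rule integral_normalised_occupation, use elim in auto)
      ultimately show "((\<lambda>t. occ ?c t f / card (alive_at ?c t)) \<longlongrightarrow> (\<integral>p. f p \<partial>\<nu>)) at_top"
        by (simp add: tendsto_cong)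
    next
      show "filterlim (\<lambda>n. real (r n)) at_top sequentially"
        by (rule filterlim_compose[OF filterlim_real_sequentially filterlim_subseq[OF r(1)]])
    qed (use elim G G0 in \<open>auto simp: rel_increment_def\<close>)
  qed
  then show ?thesis by (simp add: G_def[abs_def])
qed

end

section \<open>The equations for the limit\<close>

theorem proposition1p2:
  fixes M :: "'w measure"
    and lam0 lam :: real
    and J :: "nat list \<Rightarrow> nat \<Rightarrow> 'w \<Rightarrow> real"
    and S :: "nat list \<Rightarrow> nat \<Rightarrow> 'w \<Rightarrow> int ^ 'd"
    and B :: "nat list \<Rightarrow> nat \<Rightarrow> 'w \<Rightarrow> real"
    and \<nu> :: "(int ^ 'd) measure"
  assumes "lam0 \<ge> lam" and "lam > 0"
    and "catalytic_brw M J S B"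
    and "prob_space \<nu>" and "sets \<nu> = UNIV"
    and "AE \<omega> in M. weakly_converges
           (\<lambda>t. catalytic_brw.normalised_occupation lam0 lam J S B t \<omega>) \<nu> at_top"
  shows "(\<forall>x. x \<noteq> 0 \<longrightarrow>
            (1 + (lam0 - lam) * measure \<nu> {0}) * measure \<nu> {x} =
              1 / (2 * real CARD('d)) *
                (\<Sum>i\<in>UNIV. measure \<nu> {x + axis i 1} + measure \<nu> {x - axis i 1})) \<and>
         (1 - (lam0 - lam) * (1 - measure \<nu> {0})) * measure \<nu> {0} =
              1 / (2 * real CARD('d)) *
                (\<Sum>i\<in>UNIV. measure \<nu> {axis i 1} + measure \<nu> {- axis i 1})"
proof -
  interpret brw: catalytic_brw M lam0 lam J S B by (rule assms(3))
  interpret positive_brw M lam0 lam J S B by unfold_locales (use assms(1,2) in auto)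
  have main: "measure \<nu> {x} + measure \<nu> {x} * (lam + (lam0 - lam) * measure \<nu> {0}) - rate x * measure \<nu> {x} =
      1 / (2 * real CARD('d)) * (\<Sum>i\<in>UNIV. measure \<nu> {x + axis i 1} + measure \<nu> {x - axis i 1})" for x :: "int ^ 'd"
    using integral_gen_limit_zero[OF assms(4,5,6), of x] integral_gen_indicator[OF assms(4,5), of x] by linarith
  show ?thesis
  proof (intro conjI allI impI)
    fix x :: "int ^ 'd" assume "x \<noteq> 0"
    then show "(1 + (lam0 - lam) * measure \<nu> {0}) * measure \<nu> {x} =
              1 / (2 * real CARD('d)) *
                (\<Sum>i\<in>UNIV. measure \<nu> {x + axis i 1} + measure \<nu> {x - axis i 1})"
      unfolding main[symmetric] by (simp add: rate_def algebra_simps)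
  next
    show "(1 - (lam0 - lam) * (1 - measure \<nu> {0})) * measure \<nu> {0} =
              1 / (2 * real CARD('d)) *
                (\<Sum>i\<in>UNIV. measure \<nu> {axis i 1} + measure \<nu> {- axis i 1})"
      using main[of 0] by (simp add: rate_def algebra_simps)
  qed
qed

end
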